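(* Let $N\ge1$ and $b>-N/2$. Let $\mathcal F_b$ be the generalized Fourier transform and $D_{b,n}$ ($n=1,\dots,N$) the operators on $\mathcal S(\mathbb R^N)$ defined in the context. Then, as operators on $\mathcal S(\mathbb R^N)$, $$\mathcal F_bD_{b,n}\mathcal F_b^{-1}=ix_n,\qquad\mathcal F_bx_n\mathcal F_b^{-1}=iD_{b,n}.$$
   Context: $\mathcal H^m(\mathbb R^N)$ is the space of homogeneous harmonic polynomials of degree $m$ on $\mathbb R^N$ (complex coefficients); $\lambda_{N,m}:=\frac{N-2}{2}+m$; $L_\ell^{(\nu)}(t):=\sum_{k=0}^{\ell}\frac{(-1)^k\Gamma(\nu+\ell+1)}{\Gamma(\nu+k+1)(\ell-k)!}\frac{t^k}{k!}$. For $p\in\mathcal H^m(\mathbb R^N)$: $\Phi_{b,\ell,p}(x):=e^{-|x|^2/2}L_\ell^{(b+\lambda_{N,m})}(|x|^2)p(x)$. $W_{b,alg}$ is the complex linear span of all $\Phi_{b,\ell,p}$. With $E=\sum_kx_k\partial_{x_k}$, $H_b:=\Delta+\frac{2b}{|x|^2}\mathcal R$ on $W_{b,alg}$, where $\mathcal R$ is linear with $\mathcal R(f(|x|^2)p(x))=E(f(|x|^2))p(x)$ for $p\in\mathcal H^m(\mathbb R^N)$. $\Omega_b$ is the unique unitary representation of the universal covering $\widetilde{SL}(2,\mathbb R)$ on $L^2(\mathbb R^N,|x|^{2b}dx)$ whose differential on $W_{b,alg}$ is $\begin{pmatrix}0&1\\0&0\end{pmatrix}\mapsto\frac i2|x|^2$,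 $\begin{pmatrix}0&0\\1&0\end{pmatrix}\mapsto\frac i2H_b$, $\begin{pmatrix}1&0\\0&-1\end{pmatrix}\mapsto E+\frac{N+2b}2$, with $\Omega_b(e^{t\left(\begin{smallmatrix}0&-1\\1&0\end{smallmatrix}\right)})\Phi_{b,\ell,p}=e^{-it(b+\lambda_{N,m}+2\ell+1)}\Phi_{b,\ell,p}$. Its space of smooth vectors is $\mathcal S(\mathbb R^N)$, and $H_b$ is extended to $\mathcal S(\mathbb R^N)$ by $\frac i2H_b=d\Omega_b\begin{pmatrix}0&0\\1&0\end{pmatrix}$. $\mathcal F_b:=i^{b+N/2}\Omega_b(e^{\frac\pi2\left(\begin{smallmatrix}0&-1\\1&0\end{smallmatrix}\right)})=i^{b+N/2}e^{\frac{\pi i}4(H_b-|x|^2)}$, $i=e^{\pi i/2}$; it preserves $\mathcal S(\mathbb R^N)$. The operators $D_{b,n}:\mathcal S(\mathbb R^N)\to\mathcal S(\mathbb R^N)$ are defined by the commutator $$D_{b,n}:=\left[\frac{H_b-|x|^2}2,\,x_n\right],$$ where $x_n$ denotes multiplication by the $n$-th coordinate. *)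

theory Defs
  imports "HOL-Analysis.Analysis" "HOL-Algebra.Group"
begin

definition pdiff :: "'n::finite \<Rightarrow> (real^'n \<Rightarrow> complex) \<Rightarrow> real^'n \<Rightarrow> complex" where
  "pdiff k f x = vector_derivative (\<lambda>t. f (x + t *\<^sub>R axis k 1)) (at 0)"

definition laplacian :: "(real^'n::finite \<Rightarrow> complex) \<Rightarrow> real^'n \<Rightarrow> complex" where
  "laplacian f x = (\<Sum>k\<in>UNIV. pdiff k (pdiff k f) x)"

definition euler :: "(real^'n::finite \<Rightarrow> complex) \<Rightarrow> real^'n \<Rightarrow> complex" where
  "euler f x = (\<Sum>k\<in>UNIV. of_real (x $ k) * pdiff k f x)"

definition coord_mult :: "'n::finite \<Rightarrow> (real^'n \<Rightarrow> complex) \<Rightarrow> real^'n \<Rightarrow> complex" where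
  "coord_mult k f x = of_real (x $ k) * f x"

text \<open>A multi-index is given as the list of the coordinates to differentiate in.  Frechet
  differentiability of all iterated partial derivatives is smoothness.\<close>

definition schwartz :: "(real^'n::finite \<Rightarrow> complex) set" where
  "schwartz = {f. \<forall>ks :: 'n list.
      foldr pdiff ks f differentiable_on UNIV \<and>
      (\<forall>j::nat. bounded (range (\<lambda>x. norm x ^ j *\<^sub>R foldr pdiff ks f x)))}"

definition homogeneous_poly :: "nat \<Rightarrow> (real^'n::finite \<Rightarrow> complex) set" where
  "homogeneous_poly m = {p. \<exists>c :: ('n \<Rightarrow> nat) \<Rightarrow> complex. \<forall>x.
      p x = (\<Sum>\<alpha> | sum \<alpha> UNIV = m. c \<alpha> * (\<Prod>k\<in>UNIV. of_real (x $ k) ^ \<alpha> k))}"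

definition harmonic_poly :: "nat \<Rightarrow> (real^'n::finite \<Rightarrow> complex) set" where
  "harmonic_poly m = {p \<in> homogeneous_poly m. \<forall>x. laplacian p x = 0}"

definition lam :: "'n::finite itself \<Rightarrow> nat \<Rightarrow> real" where
  "lam _ m = (real CARD('n) - 2) / 2 + real m"

definition laguerre :: "nat \<Rightarrow> real \<Rightarrow> real \<Rightarrow> real" where
  "laguerre l \<nu> t =
     (\<Sum>k\<le>l. (-1) ^ k * Gamma (\<nu> + real l + 1) / (Gamma (\<nu> + real k + 1) * fact (l - k))
             * (t ^ k / fact k))"

text \<open>The degree \<open>m\<close> is an explicit argument because it cannot be recovered from \<open>p = 0\<close>.\<close>

definition Phi ::
  "real \<Rightarrow> nat \<Rightarrow> nat \<Rightarrow> (real^'n::finite \<Rightarrow> complex) \<Rightarrow> real^'n \<Rightarrow> complex" where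
  "Phi b m l p x =
     of_real (exp (- (norm x)\<^sup>2 / 2) * laguerre l (b + lam TYPE('n) m) ((norm x)\<^sup>2)) * p x"

definition Walg :: "real \<Rightarrow> (real^'n::finite \<Rightarrow> complex) set" where
  "Walg b = {u. \<exists>(J::nat) c m l p. (\<forall>j<J. p j \<in> harmonic_poly (m j)) \<and>
      u = (\<lambda>x. \<Sum>j<J. c j * Phi b (m j) (l j) (p j) x)}"

text \<open>The graph of the linear operator with
  \<open>f(|x|\<^sup>2) p(x) \<mapsto> E(f(|x|\<^sup>2)) p(x)\<close> for harmonic homogeneous \<open>p\<close>, on the
  linear span of all such functions with \<open>f\<close> differentiable; this span contains \<open>Walg b\<close>.\<close>

definition radial_graph ::
  "((real^'n::finite \<Rightarrow> complex) \<times> (real^'n \<Rightarrow> complex)) set" where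
  "radial_graph = {(u, v). \<exists>(J::nat) (f :: nat \<Rightarrow> real \<Rightarrow> complex) m p.
      (\<forall>j<J. f j differentiable_on UNIV \<and> p j \<in> harmonic_poly (m j)) \<and>
      u = (\<lambda>x. \<Sum>j<J. f j ((norm x)\<^sup>2) * p j x) \<and>
      v = (\<lambda>x. \<Sum>j<J. euler (\<lambda>y. f j ((norm y)\<^sup>2)) x * p j x)}"

definition radial_op :: "(real^'n::finite \<Rightarrow> complex) \<Rightarrow> real^'n \<Rightarrow> complex" where
  "radial_op u = (THE v. (u, v) \<in> radial_graph)"

text \<open>At the origin the second summand is \<open>0\<close> (division by zero) rather than its continuous
  extension.  This is immaterial, as \<open>Hb_alg b u\<close> is only ever used almost everywhere.\<close>

definition Hb_alg :: "real \<Rightarrow> (real^'n::finite \<Rightarrow> complex) \<Rightarrow> real^'n \<Rightarrow> complex" where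
  "Hb_alg b u x = laplacian u x + of_real (2 * b / (norm x)\<^sup>2) * radial_op u x"

text \<open>Elements of the Hilbert space are represented by Borel functions, and identities in it are
  identities almost everywhere.\<close>

definition weight :: "real \<Rightarrow> (real^'n::finite) measure" where
  "weight b = density lborel (\<lambda>x. ennreal (norm x powr (2 * b)))"

definition L2 :: "real \<Rightarrow> (real^'n::finite \<Rightarrow> complex) set" where
  "L2 b = {f \<in> borel_measurable borel. integrable (weight b) (\<lambda>x. (norm (f x))\<^sup>2)}"

definition L2_inner ::
  "real \<Rightarrow> (real^'n::finite \<Rightarrow> complex) \<Rightarrow> (real^'n \<Rightarrow> complex) \<Rightarrow> complex" where
  "L2_inner b f h = (LINT x|weight b. f x * cnj (h x))"

definition L2_norm :: "real \<Rightarrow> (real^'n::finite \<Rightarrow> complex) \<Rightarrow> real" where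
  "L2_norm b f = sqrt (LINT x|weight b. (norm (f x))\<^sup>2)"

definition L2_eq ::
  "real \<Rightarrow> (real^'n::finite \<Rightarrow> complex) \<Rightarrow> (real^'n \<Rightarrow> complex) \<Rightarrow> bool" where
  "L2_eq b f h \<longleftrightarrow> (AE x in weight b. f x = h x)"

text \<open>Preservation of the inner product makes such a map compatible with \<open>L2_eq\<close>.\<close>

definition L2_unitary ::
  "real \<Rightarrow> ((real^'n::finite \<Rightarrow> complex) \<Rightarrow> real^'n \<Rightarrow> complex) \<Rightarrow> bool" where
  "L2_unitary b U \<longleftrightarrow>
     (\<forall>f\<in>L2 b. U f \<in> L2 b) \<and>
     (\<forall>f\<in>L2 b. \<forall>h\<in>L2 b. \<forall>c d. L2_eq b (U (\<lambda>x. c * f x + d * h x)) (\<lambda>x. c * U f x + d * U h x)) \<and>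
     (\<forall>f\<in>L2 b. \<forall>h\<in>L2 b. L2_inner b (U f) (U h) = L2_inner b f h) \<and>
     (\<forall>h\<in>L2 b. \<exists>f\<in>L2 b. L2_eq b (U f) h)"

definition SL2 :: "(real^2^2) monoid" where
  "SL2 = \<lparr>carrier = {A. det A = 1}, monoid.mult = (**), one = mat 1\<rparr>"

definition mat2 :: "real \<Rightarrow> real \<Rightarrow> real \<Rightarrow> real \<Rightarrow> real^2^2" where
  "mat2 a b c d = vector [vector [a, b], vector [c, d]]"

definition mexp :: "real^2^2 \<Rightarrow> real^2^2" where
  "mexp X = (\<Sum>k. (((**) X) ^^ k) (mat 1) /\<^sub>R fact k)"

definition topological_group :: "('g::topological_space) monoid \<Rightarrow> bool" where
  "topological_group G \<longleftrightarrow> group G \<and>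
     continuous_on (carrier G \<times> carrier G) (\<lambda>(g, h). g \<otimes>\<^bsub>G\<^esub> h) \<and>
     continuous_on (carrier G) (\<lambda>g. inv\<^bsub>G\<^esub> g)"

definition universal_cover_SL2 ::
  "('g::topological_space) monoid \<Rightarrow> ('g \<Rightarrow> real^2^2) \<Rightarrow> bool" where
  "universal_cover_SL2 G \<pi> \<longleftrightarrow>
     topological_group G \<and> \<pi> \<in> hom G SL2 \<and>
     simply_connected (carrier G) \<and> covering_space (carrier G) \<pi> (carrier SL2)"

text \<open>The exponential map of \<open>G\<close>: the value at \<open>1\<close> of the one-parameter subgroup of \<open>G\<close>
  that lifts \<open>t \<mapsto> mexp (t X)\<close>.\<close>

definition cover_exp ::
  "('g::topological_space) monoid \<Rightarrow> ('g \<Rightarrow> real^2^2) \<Rightarrow> real^2^2 \<Rightarrow> 'g" where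
  "cover_exp G \<pi> X = (THE g. \<exists>\<gamma> :: real \<Rightarrow> 'g.
      continuous_on UNIV \<gamma> \<and> range \<gamma> \<subseteq> carrier G \<and>
      (\<forall>s t. \<gamma> (s + t) = \<gamma> s \<otimes>\<^bsub>G\<^esub> \<gamma> t) \<and>
      (\<forall>t. \<pi> (\<gamma> t) = mexp (t *\<^sub>R X)) \<and> g = \<gamma> 1)"

definition unitary_rep ::
  "real \<Rightarrow> ('g::topological_space) monoid \<Rightarrow>
   ('g \<Rightarrow> (real^'n::finite \<Rightarrow> complex) \<Rightarrow> real^'n \<Rightarrow> complex) \<Rightarrow> bool" where
  "unitary_rep b G \<Omega> \<longleftrightarrow>
     (\<forall>g\<in>carrier G. L2_unitary b (\<Omega> g)) \<and>
     (\<forall>g\<in>carrier G. \<forall>h\<in>carrier G. \<forall>f\<in>L2 b. L2_eq b (\<Omega> (g \<otimes>\<^bsub>G\<^esub> h) f) (\<Omega> g (\<Omega> h f))) \<and>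
     (\<forall>f\<in>L2 b. \<forall>g\<in>carrier G.
        ((\<lambda>h. L2_norm b (\<lambda>x. \<Omega> h f x - \<Omega> g f x)) \<longlongrightarrow> 0) (at g within carrier G))"

text \<open>\<open>has_dOmega b G \<pi> \<Omega> X u w\<close>: the derivative at \<open>t = 0\<close> of
  \<open>\<Omega> (exp (t X)) u\<close> exists in the Hilbert space and equals \<open>w\<close>.\<close>

definition has_dOmega ::
  "real \<Rightarrow> ('g::topological_space) monoid \<Rightarrow> ('g \<Rightarrow> real^2^2) \<Rightarrow>
   ('g \<Rightarrow> (real^'n::finite \<Rightarrow> complex) \<Rightarrow> real^'n \<Rightarrow> complex) \<Rightarrow>
   real^2^2 \<Rightarrow> (real^'n \<Rightarrow> complex) \<Rightarrow> (real^'n \<Rightarrow> complex) \<Rightarrow> bool" where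
  "has_dOmega b G \<pi> \<Omega> X u w \<longleftrightarrow> u \<in> L2 b \<and> w \<in> L2 b \<and>
     ((\<lambda>t. L2_norm b (\<lambda>x. (\<Omega> (cover_exp G \<pi> (t *\<^sub>R X)) u x - u x) / of_real t - w x)) \<longlongrightarrow> 0) (at 0)"

text \<open>Smooth maps from \<open>G\<close> to the Hilbert space: all iterated derivatives along left-invariant
  vector fields (i.e. along trace-free matrices) exist and are continuous.\<close>

coinductive smooth_map ::
  "real \<Rightarrow> ('g::topological_space) monoid \<Rightarrow> ('g \<Rightarrow> real^2^2) \<Rightarrow>
   ('g \<Rightarrow> real^'n::finite \<Rightarrow> complex) \<Rightarrow> bool"
  for b G \<pi> where
  "\<lbrakk>\<forall>g\<in>carrier G. \<phi> g \<in> L2 b;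
    \<forall>g\<in>carrier G. ((\<lambda>h. L2_norm b (\<lambda>x. \<phi> h x - \<phi> g x)) \<longlongrightarrow> 0) (at g within carrier G);
    \<forall>X. trace X = 0 \<longrightarrow> (\<exists>\<psi>. smooth_map b G \<pi> \<psi> \<and>
      (\<forall>g\<in>carrier G.
        ((\<lambda>t. L2_norm b (\<lambda>x. (\<phi> (g \<otimes>\<^bsub>G\<^esub> cover_exp G \<pi> (t *\<^sub>R X)) x - \<phi> g x) / of_real t - \<psi> g x))
          \<longlongrightarrow> 0) (at 0)))\<rbrakk>
   \<Longrightarrow> smooth_map b G \<pi> \<phi>"

definition smooth_vectors ::
  "real \<Rightarrow> ('g::topological_space) monoid \<Rightarrow> ('g \<Rightarrow> real^2^2) \<Rightarrow>
   ('g \<Rightarrow> (real^'n::finite \<Rightarrow> complex) \<Rightarrow> real^'n \<Rightarrow> complex) \<Rightarrow> (real^'n \<Rightarrow> complex) set" where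
  "smooth_vectors b G \<pi> \<Omega> = {u \<in> L2 b. smooth_map b G \<pi> (\<lambda>g. \<Omega> g u)}"

text \<open>The Hilbert space is the one of all square integrable functions for the weight, and an
  operator on it is only determined up to null sets, so that being the representation
  \<open>\<Omega>\<^sub>b\<close> is a predicate on \<open>\<Omega>\<close> rather than a definite description.\<close>

definition is_Omega_b ::
  "real \<Rightarrow> ('g::topological_space) monoid \<Rightarrow> ('g \<Rightarrow> real^2^2) \<Rightarrow>
   ('g \<Rightarrow> (real^'n::finite \<Rightarrow> complex) \<Rightarrow> real^'n \<Rightarrow> complex) \<Rightarrow> bool" where
  "is_Omega_b b G \<pi> \<Omega> \<longleftrightarrow> unitary_rep b G \<Omega> \<and>
     (\<forall>u\<in>Walg b.
        has_dOmega b G \<pi> \<Omega> (mat2 0 1 0 0) u (\<lambda>x. \<i> / 2 * of_real ((norm x)\<^sup>2) * u x) \<and>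
        has_dOmega b G \<pi> \<Omega> (mat2 0 0 1 0) u (\<lambda>x. \<i> / 2 * Hb_alg b u x) \<and>
        has_dOmega b G \<pi> \<Omega> (mat2 1 0 0 (-1)) u
          (\<lambda>x. euler u x + of_real ((real CARD('n) + 2 * b) / 2) * u x)) \<and>
     (\<forall>t m l. \<forall>p\<in>harmonic_poly m.
        L2_eq b (\<Omega> (cover_exp G \<pi> (t *\<^sub>R mat2 0 (-1) 1 0)) (Phi b m l p))
          (\<lambda>x. exp (- \<i> * of_real (t * (b + lam TYPE('n) m + 2 * real l + 1))) * Phi b m l p x))"

text \<open>\<open>Hb\<close> and \<open>Fb\<close> act on Schwartz functions and return the Schwartz representative of an
  element of the Hilbert space; it is unique because continuous functions that agree almost
  everywhere are equal.\<close>

definition Hb ::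
  "real \<Rightarrow> ('g::topological_space) monoid \<Rightarrow> ('g \<Rightarrow> real^2^2) \<Rightarrow>
   ('g \<Rightarrow> (real^'n::finite \<Rightarrow> complex) \<Rightarrow> real^'n \<Rightarrow> complex) \<Rightarrow>
   (real^'n \<Rightarrow> complex) \<Rightarrow> real^'n \<Rightarrow> complex" where
  "Hb b G \<pi> \<Omega> f =
     (THE h. h \<in> schwartz \<and> has_dOmega b G \<pi> \<Omega> (mat2 0 0 1 0) f (\<lambda>x. \<i> / 2 * h x))"

text \<open>The phase is \<open>i\<close> to the power \<open>b + N/2\<close>, with \<open>i = exp (i pi / 2)\<close>.\<close>

definition Fb ::
  "real \<Rightarrow> ('g::topological_space) monoid \<Rightarrow> ('g \<Rightarrow> real^2^2) \<Rightarrow>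
   ('g \<Rightarrow> (real^'n::finite \<Rightarrow> complex) \<Rightarrow> real^'n \<Rightarrow> complex) \<Rightarrow>
   (real^'n \<Rightarrow> complex) \<Rightarrow> real^'n \<Rightarrow> complex" where
  "Fb b G \<pi> \<Omega> f =
     (THE h. h \<in> schwartz \<and>
        L2_eq b h (\<lambda>x. exp (\<i> * of_real (pi / 2 * (b + real CARD('n) / 2)))
                     * \<Omega> (cover_exp G \<pi> ((pi / 2) *\<^sub>R mat2 0 (-1) 1 0)) f x))"

definition Fb_inv ::
  "real \<Rightarrow> ('g::topological_space) monoid \<Rightarrow> ('g \<Rightarrow> real^2^2) \<Rightarrow>
   ('g \<Rightarrow> (real^'n::finite \<Rightarrow> complex) \<Rightarrow> real^'n \<Rightarrow> complex) \<Rightarrow>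
   (real^'n \<Rightarrow> complex) \<Rightarrow> real^'n \<Rightarrow> complex" where
  "Fb_inv b G \<pi> \<Omega> = inv_into schwartz (Fb b G \<pi> \<Omega>)"

definition half_Hb_minus_sq ::
  "real \<Rightarrow> ('g::topological_space) monoid \<Rightarrow> ('g \<Rightarrow> real^2^2) \<Rightarrow>
   ('g \<Rightarrow> (real^'n::finite \<Rightarrow> complex) \<Rightarrow> real^'n \<Rightarrow> complex) \<Rightarrow>
   (real^'n \<Rightarrow> complex) \<Rightarrow> real^'n \<Rightarrow> complex" where
  "half_Hb_minus_sq b G \<pi> \<Omega> f x = (Hb b G \<pi> \<Omega> f x - of_real ((norm x)\<^sup>2) * f x) / 2"

definition Db ::
  "real \<Rightarrow> ('g::topological_space) monoid \<Rightarrow> ('g \<Rightarrow> real^2^2) \<Rightarrow>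
   ('g \<Rightarrow> (real^'n::finite \<Rightarrow> complex) \<Rightarrow> real^'n \<Rightarrow> complex) \<Rightarrow>
   'n \<Rightarrow> (real^'n \<Rightarrow> complex) \<Rightarrow> real^'n \<Rightarrow> complex" where
  "Db b G \<pi> \<Omega> n f x =
     half_Hb_minus_sq b G \<pi> \<Omega> (coord_mult n f) x - coord_mult n (half_Hb_minus_sq b G \<pi> \<Omega> f) x"

end

theory Submission
  imports Defs
begin

text \<open>Let \<open>T = (H\<^sub>b - |x|\<^sup>2) / 2\<close>, so that \<open>i T\<close> is the differential of the rotation subgroup and \<open>\<F>\<^sub>b\<close> is, up to a
phase, \<open>exp (i \<pi> T / 2)\<close>.  The theorem expresses that \<open>[T, [T, x\<^sub>n]] = x\<^sub>n\<close>: multiplication by \<open>x\<^sub>n\<close> and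
\<open>D\<^sub>n = [T, x\<^sub>n]\<close> span a two-dimensional space on which conjugation by \<open>exp (i \<theta> T)\<close> acts by
\<open>x\<^sub>n \<mapsto> cos \<theta> x\<^sub>n + i sin \<theta> D\<^sub>n\<close> and \<open>D\<^sub>n \<mapsto> cos \<theta> D\<^sub>n + i sin \<theta> x\<^sub>n\<close>, and \<open>\<theta> = \<pi> / 2\<close> gives the claim.

The relation is visible on the functions \<open>\<Phi>\<close>.  The product of a harmonic polynomial with \<open>x\<^sub>n\<close> is
\<open>q + |x|\<^sup>2 r\<close> with harmonic \<open>q\<close> and \<open>r\<close> of neighbouring degrees (\<open>coord_mult_harmonic\<close>), and by the recurrences
of the Laguerre polynomials \<open>x\<^sub>n \<Phi> = u + v\<close>, where \<open>\<Phi>\<close> has \<open>T\<close>-eigenvalue \<open>- \<tau>\<close> and \<open>u\<close>, \<open>v\<close> have the eigenvalues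
\<open>- (\<tau> + 1)\<close> and \<open>- (\<tau> - 1)\<close> (\<open>coord_mult_Phi\<close>).  Hence \<open>D\<^sub>n \<Phi> = - u + v\<close>, while \<open>\<F>\<^sub>b\<close> multiplies \<open>\<Phi>\<close>, \<open>u\<close>, \<open>v\<close>
by \<open>\<mu>\<close>, \<open>- i \<mu>\<close>, \<open>i \<mu>\<close>; both identities of the theorem can be read off.

To pass from \<open>\<Phi>\<close> to an arbitrary Schwartz function \<open>f\<close> one pairs with \<open>\<Phi>\<close>: \<open>\<F>\<^sub>b\<close> is unitary, \<open>x\<^sub>n\<close> and \<open>T\<close> are
symmetric, so every operator can be moved to the side of \<open>\<Phi>\<close> (\<open>F_inner_weight_space\<close>, \<open>D_adjoint\<close>), and both
sides of the asserted identities have the same inner products with all \<open>\<Phi>\<close>.  They agree because the \<open>\<Phi>\<close> are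
total in the Hilbert space (\<open>orthogonal_Phi_imp_zero\<close>): their span is stable under the coordinates and
contains the Gaussian, so a function orthogonal to it, multiplied by the Gaussian and the weight, has
vanishing Fourier transform.

Three facts about the representation support this.  The eigenvalue equation for \<open>H\<^sub>b\<close> on \<open>\<Phi>\<close> is deduced
from the known action of the rotations by means of the Gauss decomposition of a rotation
(\<open>dOmega_rot\<close>).  That the operators of the theorem preserve the Schwartz space follows from its being the
space of smooth vectors, which is stable under the group and the Lie algebra (\<open>Omega_schwartz\<close>, \<open>dOmega_schwartz\<close>).  Both need the
exponential map of the covering group, that is, the lifting of one-parameter subgroups
(\<open>one_param_exists\<close>).\<close>

section \<open>Exponentials of trace-free matrices\<close>

lemma matrix_mult_add_left: "(A + B) ** C = A ** C + (B ** C :: real^2^2)"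
  by (simp add: matrix_matrix_mult_def vec_eq_iff sum.distrib distrib_right)

lemma matrix_mult_scaleR [simp]:
  fixes A B :: "real^2^2"
  shows "(k *\<^sub>R A) ** B = k *\<^sub>R (A ** B)" "A ** (k *\<^sub>R B) = k *\<^sub>R (A ** B)"
  by (simp_all add: matrix_matrix_mult_def vec_eq_iff sum_distrib_left mult_ac)

lemma matrix_power_scaleR:
  fixes X :: "real^2^2"
  shows "(((**) (t *\<^sub>R X)) ^^ k) (mat 1) = t ^ k *\<^sub>R (((**) X) ^^ k) (mat 1)"
  by (induction k) (simp_all add: mult.commute)

text \<open>A trace-free \<open>X\<close> satisfies \<open>X\<^sup>2 = - det X\<close> by the theorem of Cayley and Hamilton, so the exponential series
lives in the plane spanned by \<open>1\<close> and \<open>X\<close> and is one of three elementary functions, according to the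
sign of \<open>det X\<close>.\<close>

lemma mexp_square_pos:
  fixes X :: "real^2^2"
  assumes sq: "X ** X = \<delta>\<^sup>2 *\<^sub>R mat 1" and "\<delta> \<noteq> 0"
  shows "mexp (t *\<^sub>R X) = cosh (\<delta> * t) *\<^sub>R mat 1 + (sinh (\<delta> * t) / \<delta>) *\<^sub>R X"
proof -
  have pow: "(((**) X) ^^ k) (mat 1) =
      ((\<delta> ^ k + (- \<delta>) ^ k) / 2) *\<^sub>R mat 1 + ((\<delta> ^ k - (- \<delta>) ^ k) / (2 * \<delta>)) *\<^sub>R X" for k
  proof (induction k)
    case (Suc k)
    have "(((**) X) ^^ Suc k) (mat 1) = X ** (((**) X) ^^ k) (mat 1)"
      by simp
    also have "\<dots> = ((\<delta> ^ k + (- \<delta>) ^ k) / 2) *\<^sub>R X + ((\<delta> ^ k - (- \<delta>) ^ k) / (2 * \<delta>)) *\<^sub>R (X ** X)"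
      by (simp only: Suc.IH matrix_add_ldistrib matrix_mult_scaleR matrix_mul_rid)
    also have "\<dots> = ((\<delta> ^ Suc k + (- \<delta>) ^ Suc k) / 2) *\<^sub>R mat 1
        + ((\<delta> ^ Suc k - (- \<delta>) ^ Suc k) / (2 * \<delta>)) *\<^sub>R X"
    proof -
      have "(\<delta> ^ k - (- \<delta>) ^ k) / (2 * \<delta>) * \<delta>\<^sup>2 = (\<delta> ^ Suc k + (- \<delta>) ^ Suc k) / 2"
           "(\<delta> ^ k + (- \<delta>) ^ k) / 2 = (\<delta> ^ Suc k - (- \<delta>) ^ Suc k) / (2 * \<delta>)"
        using \<open>\<delta> \<noteq> 0\<close> by (simp_all add: field_simps power2_eq_square)
      then show ?thesis
        unfolding sq scaleR_scaleR by (simp only: add.commute)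
    qed
    finally show ?case .
  qed simp
  have e: "(\<lambda>k. (\<delta> * t) ^ k /\<^sub>R fact k) sums exp (\<delta> * t)"
          "(\<lambda>k. (- (\<delta> * t)) ^ k /\<^sub>R fact k) sums exp (- (\<delta> * t))"
    by (rule exp_converges)+
  have "(\<lambda>k. ((inverse 2 * ((\<delta> * t) ^ k /\<^sub>R fact k + (- (\<delta> * t)) ^ k /\<^sub>R fact k)) *\<^sub>R mat 1
      + (inverse (2 * \<delta>) * ((\<delta> * t) ^ k /\<^sub>R fact k - (- (\<delta> * t)) ^ k /\<^sub>R fact k)) *\<^sub>R X)) sums
      ((inverse 2 * (exp (\<delta> * t) + exp (- (\<delta> * t)))) *\<^sub>R mat 1
       + (inverse (2 * \<delta>) * (exp (\<delta> * t) - exp (- (\<delta> * t)))) *\<^sub>R X)"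
    by (intro sums_add sums_scaleR_left sums_mult sums_diff e)
  moreover have "(inverse 2 * ((\<delta> * t) ^ k /\<^sub>R fact k + (- (\<delta> * t)) ^ k /\<^sub>R fact k)) *\<^sub>R mat 1
      + (inverse (2 * \<delta>) * ((\<delta> * t) ^ k /\<^sub>R fact k - (- (\<delta> * t)) ^ k /\<^sub>R fact k)) *\<^sub>R X
      = (((**) (t *\<^sub>R X)) ^^ k) (mat 1) /\<^sub>R fact k" for k
  proof -
    have s: "(- (\<delta> * t)) ^ k = (- \<delta>) ^ k * t ^ k"
      by (metis minus_mult_left power_mult_distrib)
    show ?thesis
      unfolding matrix_power_scaleR pow s
      by (simp add: power_mult_distrib scaleR_add_right divide_simps) (simp add: algebra_simps)
  qed
  ultimately show ?thesis
    unfolding mexp_def by (simp add: sums_iff cosh_def sinh_def field_simps)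
qed

lemma mexp_square_neg:
  fixes X :: "real^2^2"
  assumes sq: "X ** X = - (\<delta>\<^sup>2) *\<^sub>R mat 1" and "\<delta> \<noteq> 0"
  shows "mexp (t *\<^sub>R X) = cos (\<delta> * t) *\<^sub>R mat 1 + (sin (\<delta> * t) / \<delta>) *\<^sub>R X"
proof -
  define c s where "c k = cos_coeff k * fact k" and "s k = sin_coeff k * fact k" for k
  have cs: "c (Suc k) = - s k" "s (Suc k) = c k" "c 0 = 1" "s 0 = 0" for k
    by (simp_all add: c_def s_def cos_coeff_Suc sin_coeff_Suc divide_simps del: of_nat_Suc)
  have pow: "(((**) X) ^^ k) (mat 1) = (c k * \<delta> ^ k) *\<^sub>R mat 1 + (s k * \<delta> ^ k / \<delta>) *\<^sub>R X" for k
  proof (induction k)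
    case (Suc k)
    have "(((**) X) ^^ Suc k) (mat 1) = X ** (((**) X) ^^ k) (mat 1)"
      by simp
    also have "\<dots> = (c k * \<delta> ^ k) *\<^sub>R X + (s k * \<delta> ^ k / \<delta>) *\<^sub>R (X ** X)"
      by (simp only: Suc.IH matrix_add_ldistrib matrix_mult_scaleR matrix_mul_rid)
    also have "\<dots> = (c (Suc k) * \<delta> ^ Suc k) *\<^sub>R mat 1 + (s (Suc k) * \<delta> ^ Suc k / \<delta>) *\<^sub>R X"
      using \<open>\<delta> \<noteq> 0\<close> by (simp add: sq cs field_simps power2_eq_square)
    finally show ?case .
  qed (simp add: cs)
  have "(\<lambda>k. (cos_coeff k *\<^sub>R (\<delta> * t) ^ k) *\<^sub>R mat 1 + (inverse \<delta> * (sin_coeff k *\<^sub>R (\<delta> * t) ^ k)) *\<^sub>R X)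
     sums (cos (\<delta> * t) *\<^sub>R mat 1 + (inverse \<delta> * sin (\<delta> * t)) *\<^sub>R X)"
    by (intro sums_add sums_scaleR_left sums_mult cos_converges sin_converges)
  moreover have "(cos_coeff k *\<^sub>R (\<delta> * t) ^ k) *\<^sub>R mat 1 + (inverse \<delta> * (sin_coeff k *\<^sub>R (\<delta> * t) ^ k)) *\<^sub>R X
      = (((**) (t *\<^sub>R X)) ^^ k) (mat 1) /\<^sub>R fact k" for k
  proof -
    have cc: "cos_coeff k = c k / fact k" "sin_coeff k = s k / fact k"
      by (simp_all add: c_def s_def)
    show ?thesis
      unfolding matrix_power_scaleR pow cc
      by (simp add: power_mult_distrib scaleR_add_right divide_simps algebra_simps)
  qed
  ultimately show ?thesis
    unfolding mexp_def by (simp add: sums_iff divide_inverse mult.commute)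
qed

lemma mexp_square_zero:
  fixes X :: "real^2^2"
  assumes sq: "X ** X = 0"
  shows "mexp (t *\<^sub>R X) = mat 1 + t *\<^sub>R X"
proof -
  have z: "(((**) X) ^^ k) (mat 1) = 0" if "k \<ge> 2" for k
    using that
  proof (induction k rule: dec_induct)
    case base
    show ?case by (simp add: numeral_2_eq_2 sq)
  next
    case (step m)
    then show ?case by (simp add: matrix_matrix_mult_def vec_eq_iff)
  qed
  have "mexp (t *\<^sub>R X) = (\<Sum>k\<in>{0,1}. (((**) (t *\<^sub>R X)) ^^ k) (mat 1) /\<^sub>R fact k)"
    unfolding mexp_def
  proof (rule suminf_finite)
    fix k :: nat
    assume "k \<notin> {0, 1}"
    then show "(((**) (t *\<^sub>R X)) ^^ k) (mat 1) /\<^sub>R fact k = 0"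
      unfolding matrix_power_scaleR by (subst z) auto
  qed simp
  then show ?thesis by simp
qed

lemma square_tracefree:
  fixes X :: "real^2^2"
  assumes "trace X = 0"
  shows "X ** X = (- det X) *\<^sub>R mat 1"
  using assms by (simp add: vec_eq_iff forall_2 matrix_matrix_mult_def sum_2 det_2 trace_def mat_def)
    (algebra)

lemma tracefree_cases:
  fixes X :: "real^2^2"
  assumes "trace X = 0"
  obtains (pos) \<delta> where "\<delta> \<noteq> 0" "X ** X = \<delta>\<^sup>2 *\<^sub>R mat 1"
    | (neg) \<delta> where "\<delta> \<noteq> 0" "X ** X = - (\<delta>\<^sup>2) *\<^sub>R mat 1"
    | (zero) "X ** X = 0"
proof -
  have sq: "X ** X = (- det X) *\<^sub>R mat 1"
    by (rule square_tracefree[OF assms])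
  consider "det X < 0" | "det X > 0" | "det X = 0" by linarith
  then show ?thesis
  proof cases
    case 1
    then show ?thesis
      using sq by (intro pos[of "sqrt (- det X)"]) auto
  next
    case 2
    then show ?thesis
      using sq by (intro neg[of "sqrt (det X)"]) auto
  next
    case 3
    then show ?thesis using sq zero by simp
  qed
qed

text \<open>For trace-free \<open>X\<close> the adjugate of \<open>c + s X\<close> is \<open>c - s X\<close>.\<close>

lemma det_comb_tracefree:
  fixes X :: "real^2^2"
  assumes "trace X = 0"
  shows "det (c *\<^sub>R mat 1 + s *\<^sub>R X) *\<^sub>R mat 1 = c\<^sup>2 *\<^sub>R mat 1 - s\<^sup>2 *\<^sub>R (X ** X)"
  using assms
  by (simp add: vec_eq_iff forall_2 matrix_matrix_mult_def sum_2 det_2 trace_def mat_def) algebra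

lemma mexp_properties:
  fixes X :: "real^2^2"
  assumes tr: "trace X = 0"
  shows continuous_mexp: "continuous_on UNIV (\<lambda>t. mexp (t *\<^sub>R X))"
    and mexp_add: "mexp ((s + t) *\<^sub>R X) = mexp (s *\<^sub>R X) ** mexp (t *\<^sub>R X)"
    and det_mexp: "det (mexp (t *\<^sub>R X)) = 1"
proof -
  have I: "(a *\<^sub>R mat 1 + b *\<^sub>R X) ** (c *\<^sub>R mat 1 + d *\<^sub>R X)
      = (a * c) *\<^sub>R mat 1 + (b * c + a * d) *\<^sub>R X + (b * d) *\<^sub>R (X ** X)" for a b c d
    by (simp add: matrix_add_ldistrib matrix_mult_add_left scaleR_add_left scaleR_add_right add_ac mult_ac)
  have m1: "(mat 1 :: real^2^2) \<noteq> 0"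
    by (simp add: vec_eq_iff mat_def)
  have "continuous_on UNIV (\<lambda>t. mexp (t *\<^sub>R X)) \<and>
    mexp ((s + t) *\<^sub>R X) = mexp (s *\<^sub>R X) ** mexp (t *\<^sub>R X) \<and> det (mexp (t *\<^sub>R X)) = 1"
    using tr
  proof (cases rule: tracefree_cases)
    case (pos \<delta>)
    have "det (mexp (t *\<^sub>R X)) *\<^sub>R mat 1 = ((cosh (\<delta> * t))\<^sup>2 - (sinh (\<delta> * t))\<^sup>2) *\<^sub>R (mat 1 :: real^2^2)"
      unfolding mexp_square_pos[OF pos(2,1)] det_comb_tracefree[OF tr] using pos
      by (simp add: scaleR_diff_left power_divide)
    then have "det (mexp (t *\<^sub>R X)) = 1"
      using m1 by (simp add: hyperbolic_pythagoras del: scaleR_cancel_right) (metis scaleR_cancel_right scaleR_one)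
    moreover have "mexp ((s + t) *\<^sub>R X) = mexp (s *\<^sub>R X) ** mexp (t *\<^sub>R X)"
      unfolding mexp_square_pos[OF pos(2,1)] I using pos
      by (simp add: distrib_left cosh_add sinh_add scaleR_add_left add_divide_distrib power2_eq_square mult.commute)
    ultimately show ?thesis
      unfolding mexp_square_pos[OF pos(2,1)] using pos by (auto intro!: continuous_intros)
  next
    case (neg \<delta>)
    have "det (mexp (t *\<^sub>R X)) *\<^sub>R mat 1 = ((cos (\<delta> * t))\<^sup>2 + (sin (\<delta> * t))\<^sup>2) *\<^sub>R (mat 1 :: real^2^2)"
      unfolding mexp_square_neg[OF neg(2,1)] det_comb_tracefree[OF tr] using neg
      by (simp add: power_divide flip: scaleR_add_left)
    then have "det (mexp (t *\<^sub>R X)) = 1"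
      using m1 by (simp del: scaleR_cancel_right) (metis scaleR_cancel_right scaleR_one)
    moreover have "mexp ((s + t) *\<^sub>R X) = mexp (s *\<^sub>R X) ** mexp (t *\<^sub>R X)"
      unfolding mexp_square_neg[OF neg(2,1)] I using neg
      by (simp add: distrib_left cos_add sin_add scaleR_add_left scaleR_diff_left add_divide_distrib power2_eq_square mult.commute)
    ultimately show ?thesis
      unfolding mexp_square_neg[OF neg(2,1)] using neg by (auto intro!: continuous_intros)
  next
    case zero
    have "det (1 *\<^sub>R mat 1 + t *\<^sub>R X) *\<^sub>R mat 1 = 1 *\<^sub>R (mat 1 :: real^2^2)"
      unfolding det_comb_tracefree[OF tr] using zero by simp
    then have "det (mexp (t *\<^sub>R X)) = 1"
      unfolding mexp_square_zero[OF zero] using m1 by (metis scaleR_cancel_right scaleR_one)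
    moreover have "mexp ((s + t) *\<^sub>R X) = mexp (s *\<^sub>R X) ** mexp (t *\<^sub>R X)"
      unfolding mexp_square_zero[OF zero] using I[of 1 s 1 t] zero by (simp add: add.commute)
    ultimately show ?thesis
      unfolding mexp_square_zero[OF zero] by (auto intro!: continuous_intros)
  qed
  then show "continuous_on UNIV (\<lambda>t. mexp (t *\<^sub>R X))"
    "mexp ((s + t) *\<^sub>R X) = mexp (s *\<^sub>R X) ** mexp (t *\<^sub>R X)" "det (mexp (t *\<^sub>R X)) = 1"
    by auto
qed

lemma mexp_0: "mexp 0 = mat 1"
  using mexp_square_zero[of 0 0] by (simp add: matrix_matrix_mult_def vec_eq_iff)

lemma mexp_lower: "mexp (t *\<^sub>R mat2 0 0 1 0) = mat2 1 0 t 1"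
  by (subst mexp_square_zero)
     (simp_all add: mat2_def vec_eq_iff forall_2 matrix_matrix_mult_def sum_2 mat_def)

lemma mexp_upper: "mexp (t *\<^sub>R mat2 0 1 0 0) = mat2 1 t 0 1"
  by (subst mexp_square_zero)
     (simp_all add: mat2_def vec_eq_iff forall_2 matrix_matrix_mult_def sum_2 mat_def)

lemma mexp_diag: "mexp (t *\<^sub>R mat2 1 0 0 (-1)) = mat2 (exp t) 0 0 (exp (- t))"
  by (subst mexp_square_pos[where \<delta> = 1])
     (simp_all add: mat2_def vec_eq_iff forall_2 matrix_matrix_mult_def sum_2 mat_def cosh_def sinh_def field_simps)

lemma mexp_rotation: "mexp (t *\<^sub>R mat2 0 (-1) 1 0) = mat2 (cos t) (- sin t) (sin t) (cos t)"
  by (subst mexp_square_neg[where \<delta> = 1])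
     (simp_all add: mat2_def vec_eq_iff forall_2 matrix_matrix_mult_def sum_2 mat_def)

text \<open>The three one-parameter groups on the right are those whose differentials are prescribed for the
representation.\<close>

lemma rotation_gauss_decomposition:
  assumes "cos t > 0"
  shows "mexp (t *\<^sub>R mat2 0 (-1) 1 0) = mexp (tan t *\<^sub>R mat2 0 0 1 0)
    ** mexp (ln (cos t) *\<^sub>R mat2 1 0 0 (-1)) ** mexp ((- tan t) *\<^sub>R mat2 0 1 0 0)"
proof -
  have "cos t * cos t + sin t * sin t = 1"
    by (metis power2_eq_square sin_cos_squared_add2)
  then have "cos t = 1 / cos t - sin t * (sin t / cos t)"
    using assms by (simp add: field_simps)
  then show ?thesis
    unfolding mexp_lower mexp_upper mexp_diag mexp_rotation using assms
    by (simp add: mat2_def vec_eq_iff forall_2 matrix_matrix_mult_def sum_2 tan_def exp_minus field_simps)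
qed

lemma trace_mat2 [simp]: "trace (mat2 a b c d) = a + d"
  by (simp add: mat2_def trace_def sum_2)

lemma mexp_conjugate:
  assumes "P ** Q = mat 1" "Q ** P = mat 1" "trace X = 0"
  shows "mexp (Q ** X ** P) = Q ** mexp X ** P"
proof -
  define L where "L Y = Q ** Y ** P" for Y
  have scl: "L (c *\<^sub>R Y) = c *\<^sub>R L Y" and add: "L (Y + Z) = L Y + L Z" for c Y Z
    unfolding L_def
    by (simp_all add: matrix_add_ldistrib matrix_mult_add_left)
  have one: "L (mat 1) = mat 1"
    by (simp add: L_def assms)
  have sq: "L X ** L X = L (X ** X)"
    unfolding L_def by (metis assms(1) matrix_mul_assoc matrix_mul_lid)
  show ?thesis
    using assms(3)
  proof (cases rule: tracefree_cases)
    case (pos \<delta>)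
    then have "L X ** L X = \<delta>\<^sup>2 *\<^sub>R mat 1" by (simp add: sq scl one)
    from mexp_square_pos[OF this pos(1), of 1] mexp_square_pos[OF pos(2,1), of 1] show ?thesis
      by (fold L_def) (simp add: scl add one)
  next
    case (neg \<delta>)
    then have "L X ** L X = - (\<delta>\<^sup>2) *\<^sub>R mat 1" by (simp only: sq scl one)
    from mexp_square_neg[OF this neg(1), of 1] mexp_square_neg[OF neg(2,1), of 1] show ?thesis
      by (fold L_def) (simp add: scl add one)
  next
    case zero
    then have "L X ** L X = 0" using scl[of 0] by (simp add: sq)
    from mexp_square_zero[OF this, of 1] mexp_square_zero[OF zero, of 1] show ?thesis
      by (fold L_def) (simp add: scl add one)
  qed
qed

section \<open>One-parameter subgroups of the universal covering group\<close>

text \<open>Two lifts of the same map agree near a point exactly if they pass through the same sheet there, so whether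
they agree is locally constant.  The covering space is an arbitrary topological space here, as the
covering group below is.\<close>

lemma covering_space_lift_eq:
  assumes cov: "covering_space c p S"
    and g: "continuous_on T g" "g \<in> T \<rightarrow> c"
    and h: "continuous_on T h" "h \<in> T \<rightarrow> c"
    and eq: "\<And>x. x \<in> T \<Longrightarrow> p (g x) = p (h x)"
    and T: "connected T" "a \<in> T" "x \<in> T" "g a = h a"
  shows "g x = h x"
proof -
  have loc: "eventually (\<lambda>z. (g y = h y) = (g z = h z)) (at y within T)" if y: "y \<in> T" for y
  proof -
    have "p (g y) \<in> S"
      using cov g y unfolding covering_space_def by auto
    then obtain T0 v where T0: "p (g y) \<in> T0" "\<Union>v = c \<inter> p -` T0"
        and v: "\<And>u. u \<in> v \<Longrightarrow> openin (top_of_set c) u" "pairwise disjnt v"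
          "\<And>u. u \<in> v \<Longrightarrow> \<exists>q. homeomorphism u T0 p q"
      using cov unfolding covering_space_def by metis
    have "g y \<in> \<Union>v" "h y \<in> \<Union>v"
      using T0 g h y eq[OF y] by auto
    then obtain u u' where u: "u \<in> v" "g y \<in> u" "u' \<in> v" "h y \<in> u'"
      by blast
    obtain O1 O2 where O: "open O1" "u = c \<inter> O1" "open O2" "u' = c \<inter> O2"
      using v(1) u unfolding openin_open by metis
    have inj: "inj_on p u"
      using v(3)[OF u(1)] unfolding homeomorphism_def by (metis inj_onI)
    have "eventually (\<lambda>z. g z \<in> O1) (at y within T)" "eventually (\<lambda>z. h z \<in> O2) (at y within T)"
      using g(1) h(1) y O u unfolding continuous_on_def by (auto dest: topological_tendstoD)
    moreover have "eventually (\<lambda>z. z \<in> T) (at y within T)"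
      by (simp add: eventually_at_filter)
    ultimately show ?thesis
    proof eventually_elim
      case (elim z)
      then have z: "g z \<in> u" "h z \<in> u'" "p (g z) = p (h z)"
        using O g h eq by auto
      show ?case
      proof (cases "u = u'")
        case True
        then show ?thesis
          using inj z u eq[OF y] by (metis inj_on_def)
      next
        case False
        then have "u \<inter> u' = {}"
          using v(2) u unfolding pairwise_def disjnt_def by blast
        then show ?thesis using z u by auto
      qed
    qed
  qed
  have "(g a = h a) = (g x = h x)"
    by (rule connected_local_const[OF T(1-3)]) (use loc in blast)
  then show ?thesis using T(4) by simp
qed

locale SL2_cover =
  fixes G :: "('g::topological_space) monoid" (structure) and \<pi> :: "'g \<Rightarrow> real^2^2"
  assumes cover: "universal_cover_SL2 G \<pi>"
begin

abbreviation cexp :: "real^2^2 \<Rightarrow> 'g" where "cexp \<equiv> cover_exp G \<pi>"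

sublocale group G
  using cover unfolding universal_cover_SL2_def topological_group_def by blast

lemma covering: "covering_space (carrier G) \<pi> {A. det A = 1}"
  using cover unfolding universal_cover_SL2_def SL2_def by simp

lemma \<pi>_mult: "x \<in> carrier G \<Longrightarrow> y \<in> carrier G \<Longrightarrow> \<pi> (x \<otimes> y) = \<pi> x ** \<pi> y"
  using cover unfolding universal_cover_SL2_def hom_def SL2_def by simp

lemma det_\<pi>: "x \<in> carrier G \<Longrightarrow> det (\<pi> x) = 1"
  using cover unfolding universal_cover_SL2_def hom_def SL2_def by auto

lemma \<pi>_one: "\<pi> \<one> = mat 1"
proof -
  have "\<pi> \<one> ** \<pi> \<one> = \<pi> \<one>"
    using \<pi>_mult[of "\<one>" "\<one>"] by simp
  moreover have "invertible (\<pi> \<one>)"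
    using det_\<pi>[of "\<one>"] by (simp add: invertible_det_nz)
  ultimately show ?thesis
    unfolding invertible_def by (metis matrix_mul_assoc matrix_mul_lid)
qed

lemma \<pi>_inv:
  assumes "x \<in> carrier G"
  shows "\<pi> x ** \<pi> (inv\<^bsub>G\<^esub> x) = mat 1" "\<pi> (inv\<^bsub>G\<^esub> x) ** \<pi> x = mat 1"
  using assms by (simp_all add: \<pi>_one flip: \<pi>_mult)

lemma continuous_on_mult:
  assumes "continuous_on T f" "continuous_on T h" "f \<in> T \<rightarrow> carrier G" "h \<in> T \<rightarrow> carrier G"
  shows "continuous_on T (\<lambda>x. f x \<otimes> h x)"
proof -
  have "continuous_on (carrier G \<times> carrier G) (\<lambda>(g, h). g \<otimes> h)"
    using cover unfolding universal_cover_SL2_def topological_group_def by blast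
  moreover have "continuous_on T (\<lambda>x. (f x, h x))"
    using assms by (intro continuous_intros)
  ultimately show ?thesis
    using continuous_on_compose2[of _ "\<lambda>(g, h). g \<otimes> h" T "\<lambda>x. (f x, h x)"] assms by auto
qed

text \<open>The curves in the definition of \<open>cover_exp\<close>.\<close>

definition one_param :: "real^2^2 \<Rightarrow> (real \<Rightarrow> 'g) \<Rightarrow> bool" where
  "one_param X \<gamma> \<longleftrightarrow> continuous_on UNIV \<gamma> \<and> range \<gamma> \<subseteq> carrier G \<and>
      (\<forall>s t. \<gamma> (s + t) = \<gamma> s \<otimes> \<gamma> t) \<and> (\<forall>t. \<pi> (\<gamma> t) = mexp (t *\<^sub>R X))"

lemma lift_eq:
  assumes "continuous_on T g" "g \<in> T \<rightarrow> carrier G" "continuous_on T h" "h \<in> T \<rightarrow> carrier G"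
    and "\<And>x. x \<in> T \<Longrightarrow> \<pi> (g x) = \<pi> (h x)" "connected T" "a \<in> T" "x \<in> T" "g a = h a"
  shows "g x = h x"
  using covering_space_lift_eq[OF covering] assms by blast

text \<open>Near the identity the curve \<open>t \<mapsto> exp (t X)\<close> lifts through a sheet of the covering.
  The doubling \<open>\<sigma> (t / 2)\<^sup>2\<close> of a lift is a lift on an interval of twice the length, and lifts
  of a connected set are unique; so the doublings fit together to a lift on the whole line, which
  by uniqueness again is a homomorphism.\<close>

lemma one_param_exists:
  assumes tr: "trace X = 0"
  shows "\<exists>\<gamma>. one_param X \<gamma>"
proof -
  define m where "m t = mexp (t *\<^sub>R X)" for t
  have contm: "continuous_on UNIV m" and m_add: "m (s + t) = m s ** m t" and detm: "det (m t) = 1" for s t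
    unfolding m_def by (rule mexp_properties[OF tr])+
  have m0: "m 0 = mat 1" by (simp add: m_def mexp_0)
  have "\<forall>x \<in> {A :: real^2^2. det A = 1}. \<exists>T. x \<in> T \<and> openin (top_of_set {A. det A = 1}) T \<and>
      (\<exists>v. \<Union>v = carrier G \<inter> \<pi> -` T \<and> (\<forall>u \<in> v. openin (top_of_set (carrier G)) u) \<and>
        pairwise disjnt v \<and> (\<forall>u \<in> v. \<exists>q. homeomorphism u T \<pi> q))"
    using covering unfolding covering_space_def by (elim conjE)
  from bspec[OF this, of "mat 1"]
  obtain T0 v where T0: "mat 1 \<in> T0" "openin (top_of_set {A. det A = 1}) T0" "\<Union>v = carrier G \<inter> \<pi> -` T0"
      and v: "\<forall>u \<in> v. \<exists>q. homeomorphism u T0 \<pi> q"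
    by (auto simp del: vimage_eq)
  have "\<one> \<in> \<Union>v"
    using T0 \<pi>_one by simp
  then obtain u q where u: "u \<in> v" "\<one> \<in> u" "homeomorphism u T0 \<pi> q"
    using v by blast
  obtain U where U: "open U" "T0 = {A. det A = 1} \<inter> U"
    using T0(2) unfolding openin_open by auto
  have "open (m -` U)"
    using open_vimage[OF U(1) contm] .
  moreover have "0 \<in> m -` U"
    using U T0 m0 by simp
  ultimately obtain d where d: "d > 0" "ball 0 d \<subseteq> m -` U"
    by (meson openE)
  (* the k-th doubling of the lift through the sheet u, a lift on an interval of length 2^k d about 0 *)
  define \<sigma> where "\<sigma> = rec_nat (\<lambda>t. q (m t)) (\<lambda>_ s t. s (t / 2) \<otimes> s (t / 2))"
  have \<sigma>_0: "\<sigma> 0 = (\<lambda>t. q (m t))" and \<sigma>_Suc: "\<sigma> (Suc k) = (\<lambda>t. \<sigma> k (t / 2) \<otimes> \<sigma> k (t / 2))" for k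
    by (simp_all add: \<sigma>_def)
  define B where "B k = ball (0::real) (2 ^ k * d)" for k :: nat
  have B_half: "t / 2 \<in> B k" if "t \<in> B (Suc k)" for t k
    using that by (simp add: B_def)
  have \<sigma>: "continuous_on (B k) (\<sigma> k) \<and> (\<forall>t\<in>B k. \<sigma> k t \<in> carrier G \<and> \<pi> (\<sigma> k t) = m t) \<and> \<sigma> k 0 = \<one>" for k
  proof (induction k)
    case 0
    have mT: "m t \<in> T0" if "t \<in> B 0" for t
      using that d U detm by (auto simp: B_def)
    have "continuous_on (B 0) (\<lambda>t. q (m t))"
    proof (rule continuous_on_compose2[of T0 q])
      show "continuous_on T0 q"
        using u(3) unfolding homeomorphism_def by blast
      show "continuous_on (B 0) m"
        by (rule continuous_on_subset[OF contm]) simp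
    qed (use mT in blast)
    moreover have "q (m t) \<in> carrier G \<and> \<pi> (q (m t)) = m t" if "t \<in> B 0" for t
    proof -
      have "\<pi> (q (m t)) = m t" "q ` T0 = u"
        using mT[OF that] u(3) unfolding homeomorphism_def by auto
      then show ?thesis
        using mT[OF that] u(1) T0(3) by blast
    qed
    moreover have "q (m 0) = \<one>"
      using u m0 \<pi>_one unfolding homeomorphism_def by metis
    ultimately show ?case by (simp add: \<sigma>_0)
  next
    case (Suc k)
    have c: "continuous_on (B (Suc k)) (\<lambda>t. \<sigma> k (t / 2))"
      by (rule continuous_on_compose2[OF Suc.IH[THEN conjunct1]]) (use B_half in \<open>auto intro!: continuous_intros\<close>)
    moreover have "(\<lambda>t. \<sigma> k (t / 2)) \<in> B (Suc k) \<rightarrow> carrier G"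
      using Suc.IH B_half by blast
    ultimately have "continuous_on (B (Suc k)) (\<sigma> (Suc k))"
      unfolding \<sigma>_Suc by (intro continuous_on_mult)
    moreover have "\<pi> (\<sigma> (Suc k) t) = m t" if "t \<in> B (Suc k)" for t
      using Suc.IH B_half[OF that] m_add[of "t/2" "t/2"] by (simp add: \<sigma>_Suc \<pi>_mult)
    ultimately show ?case
      using Suc.IH B_half by (auto simp: \<sigma>_Suc)
  qed
  have agree: "\<sigma> j t = \<sigma> k t" if "j \<le> k" "t \<in> B j" for j k t
  proof (rule lift_eq[where T = "B j" and a = 0])
    have sub: "B j \<subseteq> B k"
      using that d by (auto simp: B_def intro!: subset_ball mult_right_mono power_increasing)
    show "continuous_on (B j) (\<sigma> k)"
      using \<sigma>[of k] sub continuous_on_subset by blast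
    show "\<sigma> k \<in> B j \<rightarrow> carrier G"
      using \<sigma>[of k] sub by auto
    show "\<pi> (\<sigma> j x) = \<pi> (\<sigma> k x)" if "x \<in> B j" for x
      using \<sigma>[of k] \<sigma>[of j] sub that by auto
    show "continuous_on (B j) (\<sigma> j)" "\<sigma> j \<in> B j \<rightarrow> carrier G" "\<sigma> j 0 = \<sigma> k 0"
      using \<sigma>[of j] \<sigma>[of k] by auto
    show "connected (B j)" "0 \<in> B j" "t \<in> B j"
      using that d by (auto simp: B_def)
  qed
  have ex: "\<exists>k. t \<in> B k" for t
  proof -
    obtain k where "\<bar>t\<bar> / d < 2 ^ k"
      using real_arch_pow[of 2 "\<bar>t\<bar> / d"] by auto
    then show ?thesis using d by (auto simp: B_def field_simps)
  qed
  define \<gamma> where "\<gamma> t = \<sigma> (SOME k. t \<in> B k) t" for t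
  have \<gamma>: "\<gamma> t = \<sigma> k t" if "t \<in> B k" for t k
  proof -
    define j where "j = (SOME k. t \<in> B k)"
    have j: "t \<in> B j"
      unfolding j_def using ex[of t] by (rule someI_ex)
    have "\<sigma> j t = \<sigma> k t"
    proof (cases "j \<le> k")
      case True
      then show ?thesis using j by (rule agree)
    next
      case False
      then show ?thesis using agree[of k j t] that by simp
    qed
    then show ?thesis by (simp only: \<gamma>_def j_def)
  qed
  have cont: "continuous_on UNIV \<gamma>"
  proof -
    have "continuous_on (B k) \<gamma>" for k
      using \<sigma>[of k] \<gamma> continuous_on_cong[of "B k" "B k" \<gamma> "\<sigma> k"] by simp
    then have "continuous_on (\<Union>k. B k) \<gamma>"
      by (intro continuous_on_open_UN) (auto simp: B_def)
    moreover have "(\<Union>k. B k) = UNIV" using ex by auto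
    ultimately show ?thesis by simp
  qed
  have car: "\<gamma> t \<in> carrier G" and proj: "\<pi> (\<gamma> t) = m t" for t
    using ex[of t] \<gamma>[of t] \<sigma> by metis+
  have one: "\<gamma> 0 = \<one>"
    using ex[of 0] \<gamma>[of 0] \<sigma> by metis
  have "\<gamma> (s + t) = \<gamma> s \<otimes> \<gamma> t" for s t
  proof (rule lift_eq[where T = UNIV and a = 0 and g = "\<lambda>t. \<gamma> (s + t)" and h = "\<lambda>t. \<gamma> s \<otimes> \<gamma> t"])
    show "continuous_on UNIV (\<lambda>t. \<gamma> (s + t))"
      by (intro continuous_on_compose2[OF cont] continuous_intros) auto
    show "continuous_on UNIV (\<lambda>t. \<gamma> s \<otimes> \<gamma> t)"
      using car by (intro continuous_on_mult cont continuous_intros) auto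
  qed (use car proj m_add one in \<open>auto simp: \<pi>_mult\<close>)
  then show ?thesis
    unfolding one_param_def using cont car proj[unfolded m_def] by blast
qed

lemma one_param_at_0: "one_param X \<gamma> \<Longrightarrow> \<gamma> 0 = \<one>"
  unfolding one_param_def by (metis add.right_neutral l_cancel_one' range_subsetD)

lemma one_param_unique:
  assumes "one_param X \<gamma>" "one_param X \<gamma>'"
  shows "\<gamma> t = \<gamma>' t"
proof (rule lift_eq[where T = UNIV and a = 0])
  show "continuous_on UNIV \<gamma>" "\<gamma> \<in> UNIV \<rightarrow> carrier G" "continuous_on UNIV \<gamma>'" "\<gamma>' \<in> UNIV \<rightarrow> carrier G"
    "\<pi> (\<gamma> t) = \<pi> (\<gamma>' t)" for t
    using assms unfolding one_param_def by auto
  show "\<gamma> 0 = \<gamma>' 0"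
    using assms by (simp add: one_param_at_0)
qed auto

lemma cover_exp_eq:
  assumes "one_param X \<gamma>"
  shows "cexp X = \<gamma> 1"
proof -
  have "cexp X = (THE g. \<exists>\<gamma>. one_param X \<gamma> \<and> g = \<gamma> 1)"
    unfolding cover_exp_def one_param_def by (simp only: conj_assoc)
  also have "\<dots> = \<gamma> 1"
    using assms one_param_unique by (intro the_equality) blast+
  finally show ?thesis .
qed

lemma cover_exp_scaleR:
  assumes "one_param X \<gamma>"
  shows "cexp (t *\<^sub>R X) = \<gamma> t"
proof -
  have "one_param (t *\<^sub>R X) (\<lambda>s. \<gamma> (s * t))"
    using assms unfolding one_param_def
    by (auto simp: distrib_right intro!: continuous_on_compose2[of UNIV \<gamma>] continuous_intros)
  from cover_exp_eq[OF this] show ?thesis by simp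
qed

context
  fixes X :: "real^2^2"
  assumes X: "trace X = 0"
begin

lemma one_param_cover_exp: "one_param X (\<lambda>t. cexp (t *\<^sub>R X))"
  using one_param_exists[OF X] cover_exp_scaleR by (metis (no_types, lifting) ext)

lemma cover_exp_closed: "cexp (t *\<^sub>R X) \<in> carrier G"
  using one_param_cover_exp unfolding one_param_def by blast

lemma cover_exp_add:
  "cexp ((s + t) *\<^sub>R X) = cexp (s *\<^sub>R X) \<otimes> cexp (t *\<^sub>R X)"
  using one_param_cover_exp unfolding one_param_def by blast

lemma continuous_on_cover_exp: "continuous_on UNIV (\<lambda>t. cexp (t *\<^sub>R X))"
  using one_param_cover_exp unfolding one_param_def by blast

lemma \<pi>_cover_exp: "\<pi> (cexp (t *\<^sub>R X)) = mexp (t *\<^sub>R X)"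
  using one_param_cover_exp unfolding one_param_def by blast

lemma cover_exp_0: "cexp (0 *\<^sub>R X) = \<one>"
  using one_param_at_0[OF one_param_cover_exp] by simp

lemma cover_exp_minus: "cexp ((- t) *\<^sub>R X) = inv\<^bsub>G\<^esub> (cexp (t *\<^sub>R X))"
proof -
  have "cexp ((- t) *\<^sub>R X) \<otimes> cexp (t *\<^sub>R X) = \<one>"
    using cover_exp_add[of "- t" t] cover_exp_0 by simp
  then show ?thesis
    using cover_exp_closed[of t] cover_exp_closed[of "- t"] by (metis inv_equality)
qed

text \<open>Conjugation by \<open>g\<close> maps the lift of \<open>t \<mapsto> exp (t X)\<close> to a one-parameter subgroup lifting the exponential of
the conjugate matrix; by uniqueness it is the lift of that exponential.\<close>

lemma cover_exp_conjugate:
  assumes g: "g \<in> carrier G"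
  shows "cexp (t *\<^sub>R (\<pi> (inv\<^bsub>G\<^esub> g) ** X ** \<pi> g)) = inv\<^bsub>G\<^esub> g \<otimes> cexp (t *\<^sub>R X) \<otimes> g"
proof (rule cover_exp_scaleR)
  let ?\<gamma> = "\<lambda>t. cexp (t *\<^sub>R X)"
  have car: "?\<gamma> t \<in> carrier G" for t by (rule cover_exp_closed)
  have "continuous_on UNIV (\<lambda>t. inv\<^bsub>G\<^esub> g \<otimes> ?\<gamma> t \<otimes> g)"
    using car g by (intro continuous_on_mult continuous_on_cover_exp continuous_intros) auto
  moreover have "inv\<^bsub>G\<^esub> g \<otimes> ?\<gamma> (s + t) \<otimes> g
      = (inv\<^bsub>G\<^esub> g \<otimes> ?\<gamma> s \<otimes> g) \<otimes> (inv\<^bsub>G\<^esub> g \<otimes> ?\<gamma> t \<otimes> g)" for s t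
  proof -
    have "(inv\<^bsub>G\<^esub> g \<otimes> ?\<gamma> s \<otimes> g) \<otimes> (inv\<^bsub>G\<^esub> g \<otimes> ?\<gamma> t \<otimes> g)
        = inv\<^bsub>G\<^esub> g \<otimes> ?\<gamma> s \<otimes> (g \<otimes> inv\<^bsub>G\<^esub> g) \<otimes> ?\<gamma> t \<otimes> g"
      using car[of s] car[of t] g by (simp only: m_assoc m_closed inv_closed)
    then show ?thesis
      unfolding cover_exp_add using car[of s] car[of t] g by (simp add: m_assoc)
  qed
  moreover have "\<pi> (inv\<^bsub>G\<^esub> g \<otimes> ?\<gamma> t \<otimes> g) = mexp (t *\<^sub>R (\<pi> (inv\<^bsub>G\<^esub> g) ** X ** \<pi> g))" for t
  proof -
    have "trace (t *\<^sub>R X) = 0"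
      using X by (simp add: trace_def flip: sum_distrib_left)
    from mexp_conjugate[OF \<pi>_inv[OF g] this] show ?thesis
      using car[of t] g by (simp add: \<pi>_mult \<pi>_cover_exp)
  qed
  ultimately show "one_param (\<pi> (inv\<^bsub>G\<^esub> g) ** X ** \<pi> g) (\<lambda>t. inv\<^bsub>G\<^esub> g \<otimes> ?\<gamma> t \<otimes> g)"
    unfolding one_param_def using car g by auto
qed

end

text \<open>Both sides are lifts of the same curve of matrices that start at \<open>1\<close>.\<close>

lemma cover_exp_gauss_decomposition:
  assumes "\<bar>t\<bar> < pi / 2"
  shows "cexp (t *\<^sub>R mat2 0 (-1) 1 0) = cexp (tan t *\<^sub>R mat2 0 0 1 0)
    \<otimes> cexp (ln (cos t) *\<^sub>R mat2 1 0 0 (-1)) \<otimes> cexp ((- tan t) *\<^sub>R mat2 0 1 0 0)"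
proof (rule lift_eq[where T = "{- pi / 2 <..< pi / 2}" and a = 0 and x = t
      and g = "\<lambda>t. cexp (t *\<^sub>R mat2 0 (-1) 1 0)"
      and h = "\<lambda>t. cexp (tan t *\<^sub>R mat2 0 0 1 0)
    \<otimes> cexp (ln (cos t) *\<^sub>R mat2 1 0 0 (-1)) \<otimes> cexp ((- tan t) *\<^sub>R mat2 0 1 0 0)"])
  let ?T = "{- pi / 2 <..< pi / 2}"
  have tr: "trace (mat2 0 (-1) 1 0) = 0" "trace (mat2 0 0 1 0) = 0" "trace (mat2 0 1 0 0) = 0"
    "trace (mat2 1 0 0 (-1)) = 0" by simp_all
  have pos: "cos t > 0" if "t \<in> ?T" for t
    using that by (intro cos_gt_zero_pi) auto
  then have nz: "cos t \<noteq> 0" if "t \<in> ?T" for t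
    using that by force
  have comp: "continuous_on ?T (\<lambda>t. cexp (f t *\<^sub>R X))"
    if "trace X = 0" "continuous_on ?T f" for X f
    by (rule continuous_on_compose2[OF continuous_on_cover_exp[OF that(1)] that(2)]) auto
  show "continuous_on ?T (\<lambda>t. cexp (t *\<^sub>R mat2 0 (-1) 1 0))"
    by (intro comp tr continuous_intros)
  show "continuous_on ?T (\<lambda>t. cexp (tan t *\<^sub>R mat2 0 0 1 0)
    \<otimes> cexp (ln (cos t) *\<^sub>R mat2 1 0 0 (-1)) \<otimes> cexp ((- tan t) *\<^sub>R mat2 0 1 0 0))"
    using nz tr cover_exp_closed
    by (intro comp tr continuous_on_mult continuous_intros) (auto simp del: scaleR_minus_left)
  show "\<pi> (cexp (t *\<^sub>R mat2 0 (-1) 1 0)) = \<pi> (cexp (tan t *\<^sub>R mat2 0 0 1 0)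
    \<otimes> cexp (ln (cos t) *\<^sub>R mat2 1 0 0 (-1)) \<otimes> cexp ((- tan t) *\<^sub>R mat2 0 1 0 0))"
    if "t \<in> ?T" for t
    using rotation_gauss_decomposition[OF pos[OF that]]
    by (simp add: \<pi>_mult \<pi>_cover_exp cover_exp_closed tr del: scaleR_minus_left)
  show "(\<lambda>t. cexp (tan t *\<^sub>R mat2 0 0 1 0)
    \<otimes> cexp (ln (cos t) *\<^sub>R mat2 1 0 0 (-1)) \<otimes> cexp ((- tan t) *\<^sub>R mat2 0 1 0 0))
    \<in> ?T \<rightarrow> carrier G"
    using cover_exp_closed by (auto simp del: scaleR_minus_left)
qed (use assms cover_exp_closed cover_exp_0[of "mat2 0 (-1) 1 0"] in \<open>auto simp: abs_less_iff\<close>)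

end

section \<open>The Hilbert space\<close>

lemma sets_weight [simp, measurable_cong]: "sets (weight b) = sets borel"
  by (simp add: weight_def)

lemma space_weight [simp]: "space (weight b) = UNIV"
  by (simp add: weight_def)

text \<open>The density of the weight is positive outside the origin.\<close>

lemma AE_weight_iff: "(AE x in (weight b :: (real^'n::finite) measure). P x) \<longleftrightarrow> (AE x in lborel. P x)"
proof -
  have "AE x in lborel. x \<noteq> (0 :: real^'n)"
    by (rule AE_lborel_singleton)
  then have "(AE x in lborel. P x) \<longleftrightarrow> (AE x in (lborel :: (real^'n) measure). ennreal (norm x powr (2 * b)) > 0 \<longrightarrow> P x)"
    by (intro iffI; elim AE_mp) (auto intro!: AE_I2)
  then show ?thesis
    unfolding weight_def by (subst AE_density) auto
qed

lemma L2_measurable [measurable_dest]: "f \<in> L2 b \<Longrightarrow> f \<in> borel_measurable borel"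
  by (simp add: L2_def)

lemma L2_integrable_mult:
  assumes f: "f \<in> L2 b" and h: "h \<in> L2 b"
  shows "integrable (weight b) (\<lambda>x. f x * h x)"
proof (rule Bochner_Integration.integrable_bound)
  show "integrable (weight b) (\<lambda>x. (norm (f x))\<^sup>2 + (norm (h x))\<^sup>2)"
    using f h by (auto simp: L2_def)
  have "norm (f x * h x) \<le> (norm (f x))\<^sup>2 + (norm (h x))\<^sup>2" for x
    using sum_squares_bound[of "norm (f x)" "norm (h x)"] mult_nonneg_nonneg[of "norm (f x)" "norm (h x)"]
    by (simp add: norm_mult del: mult_nonneg_nonneg)
  then show "AE x in weight b. norm (f x * h x) \<le> norm ((norm (f x))\<^sup>2 + (norm (h x))\<^sup>2)"
    by (auto intro!: AE_I2 order.trans[OF _ abs_ge_self])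
  show "(\<lambda>x. f x * h x) \<in> borel_measurable (weight b)"
    using L2_measurable[OF f] L2_measurable[OF h] by measurable
qed

lemma borel_measurable_cnj [measurable (raw)]:
  "f \<in> borel_measurable M \<Longrightarrow> (\<lambda>x. cnj (f x)) \<in> borel_measurable M"
  by (rule measurable_compose[OF _ borel_measurable_continuous_onI]) (auto intro: continuous_intros)

lemma L2_cnj: "h \<in> L2 b \<Longrightarrow> (\<lambda>x. cnj (h x)) \<in> L2 b"
  by (auto simp: L2_def)

lemma L2_integrable_inner:
  "f \<in> L2 b \<Longrightarrow> h \<in> L2 b \<Longrightarrow> integrable (weight b) (\<lambda>x. f x * cnj (h x))"
  by (rule L2_integrable_mult[OF _ L2_cnj])

lemma L2_scale [intro]:
  assumes "f \<in> L2 b" shows "(\<lambda>x. c * f x) \<in> L2 b"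
  using assms by (auto simp: L2_def norm_mult power_mult_distrib)

lemma L2_add [intro]:
  assumes f: "f \<in> L2 b" and h: "h \<in> L2 b" shows "(\<lambda>x. f x + h x) \<in> L2 b"
  unfolding L2_def
proof (intro CollectI conjI)
  show m: "(\<lambda>x. f x + h x) \<in> borel_measurable borel"
    using L2_measurable[OF f] L2_measurable[OF h] by measurable
  show "integrable (weight b) (\<lambda>x. (norm (f x + h x))\<^sup>2)"
  proof (rule Bochner_Integration.integrable_bound)
    show "integrable (weight b) (\<lambda>x. 2 * (norm (f x))\<^sup>2 + 2 * (norm (h x))\<^sup>2)"
      using f h by (auto simp: L2_def)
    have "(norm (f x + h x))\<^sup>2 \<le> 2 * (norm (f x))\<^sup>2 + 2 * (norm (h x))\<^sup>2" for x
    proof -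
      have "(norm (f x + h x))\<^sup>2 \<le> (norm (f x) + norm (h x))\<^sup>2"
        by (intro power_mono norm_triangle_ineq) auto
      also have "\<dots> \<le> 2 * (norm (f x))\<^sup>2 + 2 * (norm (h x))\<^sup>2"
        using sum_squares_bound[of "norm (f x)" "norm (h x)"] by (simp add: power2_sum)
      finally show ?thesis .
    qed
    then show "AE x in weight b. norm ((norm (f x + h x))\<^sup>2) \<le> norm (2 * (norm (f x))\<^sup>2 + 2 * (norm (h x))\<^sup>2)"
      by (auto intro!: AE_I2 order.trans[OF _ abs_ge_self])
  qed (use m in measurable)
qed

lemma L2_diff [intro]:
  assumes f: "f \<in> L2 b" and h: "h \<in> L2 b" shows "(\<lambda>x. f x - h x) \<in> L2 b"
  using L2_add[OF f L2_scale[OF h, of "- 1"]] by simp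

lemma L2_divide [intro]:
  assumes "f \<in> L2 b" shows "(\<lambda>x. f x / c) \<in> L2 b"
  using L2_scale[OF assms, of "1 / c"] by simp

lemma L2_zero [simp]: "(\<lambda>x. 0) \<in> L2 b"
  by (simp add: L2_def)

lemma L2_eq_refl [simp]: "L2_eq b f f"
  by (simp add: L2_eq_def)

lemma L2_eq_sym: "L2_eq b f h \<Longrightarrow> L2_eq b h f"
  unfolding L2_eq_def by (elim AE_mp) (auto intro!: AE_I2)

lemma L2_eq_trans [trans]: "L2_eq b f h \<Longrightarrow> L2_eq b h k \<Longrightarrow> L2_eq b f k"
  unfolding L2_eq_def by (auto elim!: AE_mp)

lemma L2_eq_lin:
  "L2_eq b f f' \<Longrightarrow> L2_eq b h h' \<Longrightarrow> L2_eq b (\<lambda>x. c * f x + d * h x) (\<lambda>x. c * f' x + d * h' x)"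
  unfolding L2_eq_def by (auto elim!: AE_mp)

lemma L2_eq_scale:
  assumes "L2_eq b f h" shows "L2_eq b (\<lambda>x. c * f x) (\<lambda>x. c * h x)"
  using assms unfolding L2_eq_def by eventually_elim simp

lemma L2_eq_diff:
  "L2_eq b f f' \<Longrightarrow> L2_eq b h h' \<Longrightarrow> L2_eq b (\<lambda>x. f x - h x) (\<lambda>x. f' x - h' x)"
  unfolding L2_eq_def by (auto elim!: AE_mp)

lemma L2_inner_cong:
  assumes "f \<in> L2 b" "f' \<in> L2 b" "h \<in> L2 b" "h' \<in> L2 b" "L2_eq b f f'" "L2_eq b h h'"
  shows "L2_inner b f h = L2_inner b f' h'"
proof -
  note [measurable] = assms(1-4)[THEN L2_measurable]
  have "AE x in weight b. f x * cnj (h x) = f' x * cnj (h' x)"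
    using assms(5,6) unfolding L2_eq_def by (auto elim!: AE_mp)
  then show ?thesis
    unfolding L2_inner_def by (intro integral_cong_AE) measurable
qed

lemma L2_norm_cong:
  assumes "f \<in> L2 b" "f' \<in> L2 b" "L2_eq b f f'"
  shows "L2_norm b f = L2_norm b f'"
proof -
  note [measurable] = assms(1-2)[THEN L2_measurable]
  have "(LINT x|weight b. (norm (f x))\<^sup>2) = (LINT x|weight b. (norm (f' x))\<^sup>2)"
    using assms(3) unfolding L2_eq_def by (intro integral_cong_AE) (measurable, auto)
  then show ?thesis by (simp add: L2_norm_def)
qed

lemma L2_norm_nonneg [simp]: "L2_norm b f \<ge> 0"
  by (simp add: L2_norm_def)

lemma L2_norm_scale [simp]: "L2_norm b (\<lambda>x. c * f x) = norm c * L2_norm b f"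
  by (simp add: L2_norm_def norm_mult power_mult_distrib real_sqrt_mult)

lemma L2_norm_zero [simp]: "L2_norm b (\<lambda>x. 0) = 0"
  by (simp add: L2_norm_def)

lemma L2_norm_minus_commute: "L2_norm b (\<lambda>x. f x - h x) = L2_norm b (\<lambda>x. h x - f x)"
  by (simp add: L2_norm_def norm_minus_commute)

lemma L2_inner_self: "L2_inner b f f = of_real ((L2_norm b f)\<^sup>2)"
proof -
  have "L2_inner b f f = (LINT x|weight b. complex_of_real ((norm (f x))\<^sup>2))"
    unfolding L2_inner_def by (simp only: complex_norm_square)
  also have "\<dots> = of_real (LINT x|weight b. (norm (f x))\<^sup>2)"
    by (rule integral_complex_of_real)
  also have "(LINT x|weight b. (norm (f x))\<^sup>2) = (L2_norm b f)\<^sup>2"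
    by (simp add: L2_norm_def)
  finally show ?thesis .
qed

lemma L2_norm_0_iff:
  assumes "f \<in> L2 b"
  shows "L2_norm b f = 0 \<longleftrightarrow> L2_eq b f (\<lambda>x. 0)"
proof -
  have "L2_norm b f = 0 \<longleftrightarrow> (LINT x|weight b. (norm (f x))\<^sup>2) = 0"
    by (simp add: L2_norm_def)
  also have "\<dots> \<longleftrightarrow> (AE x in weight b. (norm (f x))\<^sup>2 = 0)"
    using assms by (intro integral_nonneg_eq_0_iff_AE) (auto simp: L2_def)
  finally show ?thesis by (simp add: L2_eq_def)
qed

lemma L2_norm_diff_0_iff:
  assumes "f \<in> L2 b" "h \<in> L2 b"
  shows "L2_norm b (\<lambda>x. f x - h x) = 0 \<longleftrightarrow> L2_eq b f h"
  using L2_norm_0_iff[OF L2_diff[OF assms]] by (simp add: L2_eq_def)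

lemma L2_inner_add_left:
  assumes "f \<in> L2 b" "f' \<in> L2 b" "h \<in> L2 b"
  shows "L2_inner b (\<lambda>x. f x + f' x) h = L2_inner b f h + L2_inner b f' h"
  using assms unfolding L2_inner_def
  by (simp add: distrib_right Bochner_Integration.integral_add L2_integrable_inner)

lemma L2_inner_diff_left:
  assumes "f \<in> L2 b" "f' \<in> L2 b" "h \<in> L2 b"
  shows "L2_inner b (\<lambda>x. f x - f' x) h = L2_inner b f h - L2_inner b f' h"
  using assms unfolding L2_inner_def
  by (simp add: left_diff_distrib Bochner_Integration.integral_diff L2_integrable_inner)

lemma L2_inner_scale_left: "L2_inner b (\<lambda>x. c * f x) h = c * L2_inner b f h"
  unfolding L2_inner_def by (simp add: mult.assoc)

lemma L2_inner_commute: "L2_inner b f h = cnj (L2_inner b h f)"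
  unfolding L2_inner_def by (subst Bochner_Integration.integral_cnj[symmetric]) (simp add: mult.commute)

lemma L2_inner_scale_right: "L2_inner b f (\<lambda>x. c * h x) = cnj c * L2_inner b f h"
  by (subst (1 2) L2_inner_commute) (simp add: L2_inner_scale_left)

lemma L2_inner_add_right:
  assumes "f \<in> L2 b" "h \<in> L2 b" "h' \<in> L2 b"
  shows "L2_inner b f (\<lambda>x. h x + h' x) = L2_inner b f h + L2_inner b f h'"
  by (subst (1 2 3) L2_inner_commute) (simp add: L2_inner_add_left assms)

lemma L2_inner_diff_right:
  assumes "f \<in> L2 b" "h \<in> L2 b" "h' \<in> L2 b"
  shows "L2_inner b f (\<lambda>x. h x - h' x) = L2_inner b f h - L2_inner b f h'"
  by (subst (1 2 3) L2_inner_commute) (simp add: L2_inner_diff_left assms)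

text \<open>As equality in the Hilbert space is equality almost everywhere, \<open>L2_inner\<close> is only a semi-inner product on
functions, and the case \<open>L2_norm b h = 0\<close> is separate.\<close>

lemma L2_Cauchy_Schwarz:
  assumes f: "f \<in> L2 b" and h: "h \<in> L2 b"
  shows "norm (L2_inner b f h) \<le> L2_norm b f * L2_norm b h"
proof (cases "L2_norm b h = 0")
  case True
  then have "L2_inner b f h = L2_inner b f (\<lambda>x. 0)"
    using L2_norm_0_iff[OF h] by (intro L2_inner_cong f h L2_zero) auto
  then show ?thesis by (simp add: L2_inner_def True)
next
  case False
  define a where "a = L2_inner b f h"
  define N where "N = (L2_norm b h)\<^sup>2"
  have N: "N > 0" using False by (simp add: N_def)
  (* c * h is the projection of f to the span of h, and f - c * h has nonnegative squared norm *)
  define c where "c = a / of_real N"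
  have ch: "(\<lambda>x. c * h x) \<in> L2 b" using h by (rule L2_scale)
  have cN: "c * of_real N = a"
    using N by (simp add: c_def)
  have "of_real ((L2_norm b (\<lambda>x. f x - c * h x))\<^sup>2)
      = (L2_inner b f f - cnj c * a) - c * (cnj a - cnj c * of_real N)"
    using f h ch unfolding L2_inner_self[symmetric]
    by (simp only: L2_inner_diff_left L2_inner_diff_right L2_diff L2_inner_scale_left L2_inner_scale_right)
       (simp add: a_def N_def L2_inner_self L2_inner_commute[of b h f] algebra_simps)
  also have "\<dots> = L2_inner b f f - cnj c * a"
    using cN by (metis complex_cnj_complex_of_real complex_cnj_mult diff_self diff_zero mult_zero_right)
  also have "cnj c * a = of_real ((norm a)\<^sup>2 / N)"
    by (simp add: c_def complex_norm_square mult.commute del: of_real_power)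
  finally have "(L2_norm b (\<lambda>x. f x - c * h x))\<^sup>2 = (L2_norm b f)\<^sup>2 - (norm a)\<^sup>2 / N"
    unfolding L2_inner_self of_real_diff[symmetric] of_real_eq_iff .
  then have "(norm a)\<^sup>2 / N \<le> (L2_norm b f)\<^sup>2"
    by (metis diff_ge_0_iff_ge zero_le_power2)
  then have "(norm a)\<^sup>2 \<le> (L2_norm b f * L2_norm b h)\<^sup>2"
    using N by (simp add: field_simps N_def power_mult_distrib)
  then show ?thesis
    unfolding a_def by (rule power2_le_imp_le) simp
qed

lemma L2_norm_triangle:
  assumes f: "f \<in> L2 b" and h: "h \<in> L2 b"
  shows "L2_norm b (\<lambda>x. f x + h x) \<le> L2_norm b f + L2_norm b h"
proof (rule power2_le_imp_le)
  have "complex_of_real ((L2_norm b (\<lambda>x. f x + h x))\<^sup>2) =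
      of_real ((L2_norm b f)\<^sup>2) + L2_inner b f h + cnj (L2_inner b f h) + of_real ((L2_norm b h)\<^sup>2)"
    using f h unfolding L2_inner_self[symmetric]
    by (simp add: L2_inner_add_left L2_inner_add_right L2_add flip: L2_inner_commute[of b h f])
  then have "(L2_norm b (\<lambda>x. f x + h x))\<^sup>2 = (L2_norm b f)\<^sup>2 + 2 * Re (L2_inner b f h) + (L2_norm b h)\<^sup>2"
    by (simp add: complex_eq_iff)
  also have "\<dots> \<le> (L2_norm b f)\<^sup>2 + 2 * (L2_norm b f * L2_norm b h) + (L2_norm b h)\<^sup>2"
    using L2_Cauchy_Schwarz[OF f h] complex_Re_le_cmod[of "L2_inner b f h"] by simp
  also have "\<dots> = (L2_norm b f + L2_norm b h)\<^sup>2"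
    by (simp add: power2_sum)
  finally show "(L2_norm b (\<lambda>x. f x + h x))\<^sup>2 \<le> (L2_norm b f + L2_norm b h)\<^sup>2" .
qed simp

lemma L2_norm_triangle_diff:
  assumes "f \<in> L2 b" "h \<in> L2 b" "k \<in> L2 b"
  shows "L2_norm b (\<lambda>x. f x - k x) \<le> L2_norm b (\<lambda>x. f x - h x) + L2_norm b (\<lambda>x. h x - k x)"
  using L2_norm_triangle[of "\<lambda>x. f x - h x" b "\<lambda>x. h x - k x"] assms by auto

text \<open>Membership in \<open>L2\<close> is part of the notion since \<open>L2_norm\<close> is \<open>0\<close> for functions that are not square
integrable, so that convergence of the norms alone would say nothing.\<close>

definition L2_tendsto ::
  "real \<Rightarrow> ('a \<Rightarrow> real^'n::finite \<Rightarrow> complex) \<Rightarrow> (real^'n \<Rightarrow> complex) \<Rightarrow> 'a filter \<Rightarrow> bool" where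
  "L2_tendsto b \<phi> w F \<longleftrightarrow> w \<in> L2 b \<and> (\<forall>\<^sub>F t in F. \<phi> t \<in> L2 b) \<and> ((\<lambda>t. L2_norm b (\<lambda>x. \<phi> t x - w x)) \<longlongrightarrow> 0) F"

lemma L2_tendsto_unique:
  assumes "L2_tendsto b \<phi> v F" "L2_tendsto b \<phi> w F" "F \<noteq> bot"
  shows "L2_eq b v w"
proof -
  have v: "v \<in> L2 b" and w: "w \<in> L2 b" using assms by (auto simp: L2_tendsto_def)
  have "((\<lambda>t. L2_norm b (\<lambda>x. \<phi> t x - v x) + L2_norm b (\<lambda>x. \<phi> t x - w x)) \<longlongrightarrow> 0 + 0) F"
    using assms by (intro tendsto_add) (auto simp: L2_tendsto_def)
  moreover have "\<forall>\<^sub>F t in F. \<phi> t \<in> L2 b" using assms by (simp add: L2_tendsto_def)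
  then have "\<forall>\<^sub>F t in F. L2_norm b (\<lambda>x. v x - w x) \<le> L2_norm b (\<lambda>x. \<phi> t x - v x) + L2_norm b (\<lambda>x. \<phi> t x - w x)"
    by eventually_elim (use L2_norm_triangle_diff[OF v _ w] L2_norm_minus_commute in metis)
  ultimately have "L2_norm b (\<lambda>x. v x - w x) \<le> 0 + 0"
    using assms(3) tendsto_lowerbound by blast
  then have "L2_eq b (\<lambda>x. v x - w x) (\<lambda>x. 0)"
    using L2_norm_0_iff[OF L2_diff[OF v w]] L2_norm_nonneg[of b "\<lambda>x. v x - w x"] by linarith
  then show ?thesis by (simp add: L2_eq_def)
qed

lemma L2_tendsto_add:
  assumes "L2_tendsto b \<phi> v F" "L2_tendsto b \<psi> w F"
  shows "L2_tendsto b (\<lambda>t x. \<phi> t x + \<psi> t x) (\<lambda>x. v x + w x) F"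
proof -
  have v: "v \<in> L2 b" and w: "w \<in> L2 b" using assms by (auto simp: L2_tendsto_def)
  have mem: "\<forall>\<^sub>F t in F. \<phi> t \<in> L2 b \<and> \<psi> t \<in> L2 b"
    using assms by (auto simp: L2_tendsto_def intro: eventually_conj)
  have "((\<lambda>t. L2_norm b (\<lambda>x. (\<phi> t x + \<psi> t x) - (v x + w x))) \<longlongrightarrow> 0) F"
  proof (rule Lim_null_comparison)
    show "((\<lambda>t. L2_norm b (\<lambda>x. \<phi> t x - v x) + L2_norm b (\<lambda>x. \<psi> t x - w x)) \<longlongrightarrow> 0) F"
      using tendsto_add[of _ 0 F _ 0] assms by (auto simp: L2_tendsto_def)
    show "\<forall>\<^sub>F t in F. norm (L2_norm b (\<lambda>x. (\<phi> t x + \<psi> t x) - (v x + w x)))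
        \<le> L2_norm b (\<lambda>x. \<phi> t x - v x) + L2_norm b (\<lambda>x. \<psi> t x - w x)"
      using mem
    proof eventually_elim
      case (elim t)
      have e: "(\<phi> t x + \<psi> t x) - (v x + w x) = (\<phi> t x - v x) + (\<psi> t x - w x)" for x
        by simp
      show ?case
        unfolding e using L2_norm_triangle[OF L2_diff[of "\<phi> t" b v] L2_diff[of "\<psi> t" b w]] elim v w by simp
    qed
  qed
  then show ?thesis
    using mem v w unfolding L2_tendsto_def by (auto elim: eventually_mono)
qed

lemma L2_tendsto_inner:
  assumes "L2_tendsto b \<phi> w F" "h \<in> L2 b"
  shows "((\<lambda>t. L2_inner b (\<phi> t) h) \<longlongrightarrow> L2_inner b w h) F"
proof (rule Lim_null[THEN iffD2], rule Lim_null_comparison)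
  have "((\<lambda>t. L2_norm b (\<lambda>x. \<phi> t x - w x) * L2_norm b h) \<longlongrightarrow> 0 * L2_norm b h) F"
    using assms by (intro tendsto_mult) (auto simp: L2_tendsto_def)
  then show "((\<lambda>t. L2_norm b (\<lambda>x. \<phi> t x - w x) * L2_norm b h) \<longlongrightarrow> 0) F" by simp
  have w: "w \<in> L2 b" and "\<forall>\<^sub>F t in F. \<phi> t \<in> L2 b" using assms by (auto simp: L2_tendsto_def)
  from this(2) show "\<forall>\<^sub>F t in F. norm (L2_inner b (\<phi> t) h - L2_inner b w h)
      \<le> L2_norm b (\<lambda>x. \<phi> t x - w x) * L2_norm b h"
  proof eventually_elim
    case (elim t)
    from L2_Cauchy_Schwarz[OF L2_diff[OF elim w] assms(2)] show ?case
      using L2_inner_diff_left[OF elim w assms(2)] by simp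
  qed
qed

section \<open>Integrability against the weight and Schwartz functions\<close>

text \<open>The closed shells of radii \<open>2\<^sup>k\<close> for integers \<open>k\<close> cover the complement of the origin.\<close>

definition shell :: "real \<Rightarrow> (real^'n::finite) set" where
  "shell r = {x. r \<le> norm x \<and> norm x \<le> 2 * r}"

lemma shell_borel [measurable]: "shell r \<in> sets borel"
  unfolding shell_def by measurable

lemma emeasure_weight_shell_1: "emeasure (weight b) (shell 1 :: (real^'n::finite) set) < \<infinity>"
proof -
  let ?C = "1 + 2 powr (2 * b)"
  have "emeasure (weight b) (shell 1 :: (real^'n) set)
      = (\<integral>\<^sup>+x. ennreal (norm x powr (2 * b)) * indicator (shell 1 :: (real^'n) set) x \<partial>lborel)"
    unfolding weight_def by (subst emeasure_density) auto
  also have "\<dots> \<le> (\<integral>\<^sup>+x. ennreal ?C * indicator (cball (0 :: real^'n) 2) x \<partial>lborel)"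
  proof (rule nn_integral_mono)
    fix x :: "real^'n"
    show "ennreal (norm x powr (2 * b)) * indicator (shell 1) x \<le> ennreal ?C * indicator (cball 0 2) x"
    proof (cases "x \<in> shell 1")
      case True
      then have n: "1 \<le> norm x" "norm x \<le> 2"
        by (auto simp: shell_def)
      have "norm x powr (2 * b) \<le> ?C"
      proof (cases "b \<ge> 0")
        case True
        then have "norm x powr (2 * b) \<le> 2 powr (2 * b)"
          using n by (intro powr_mono2) auto
        then show ?thesis by simp
      next
        case False
        then have "norm x powr (2 * b) \<le> 1 powr (2 * b)"
          using n by (intro powr_mono2') auto
        then show ?thesis
          by (simp add: add_increasing2)
      qed
      then show ?thesis using True n by (simp add: ennreal_leI indicator_def del: ennreal_plus)
    qed simp
  qed
  also have "\<dots> = ennreal ?C * emeasure lborel (cball (0 :: real^'n) 2)"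
    by (subst nn_integral_cmult_indicator) auto
  also have "\<dots> < \<infinity>"
    using emeasure_bounded_finite[OF bounded_cball[of "0 :: real^'n" 2]] by (simp add: ennreal_mult_less_top)
  finally show ?thesis .
qed

text \<open>The measure \<open>|x|\<^bsup>2 b\<^esup> dx\<close> is homogeneous of degree \<open>N + 2 b\<close>.\<close>

lemma emeasure_weight_shell:
  assumes c: "c > 0"
  shows "emeasure (weight b) (shell c :: (real^'n::finite) set)
    = ennreal (c powr (real CARD('n) + 2 * b)) * emeasure (weight b) (shell 1 :: (real^'n) set)"
proof -
  let ?w = "\<lambda>x :: real^'n. ennreal (norm x powr (2 * b))"
  have sh: "indicator (shell c) (c *\<^sub>R x) = (indicator (shell 1) x :: ennreal)" for x :: "real^'n"
    using c by (auto simp: shell_def indicator_def)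
  have "emeasure (weight b) (shell c :: (real^'n) set)
      = (\<integral>\<^sup>+x. ?w x * indicator (shell c) x \<partial>lborel)"
    unfolding weight_def by (subst emeasure_density) auto
  also have "\<dots> = (\<integral>\<^sup>+x. ?w x * indicator (shell c) x
      \<partial>density (distr lborel borel (\<lambda>x. 0 + c *\<^sub>R x)) (\<lambda>_. ennreal (\<bar>c\<bar> ^ DIM(real^'n))))"
    using lborel_affine[of c "0 :: real^'n"] c by simp
  also have "\<dots> = (\<integral>\<^sup>+x. ennreal (c ^ CARD('n)) * (?w (c *\<^sub>R x) * indicator (shell c) (c *\<^sub>R x)) \<partial>lborel)"
    using c by (subst nn_integral_density) (auto simp: nn_integral_distr)
  also have "\<dots> = (\<integral>\<^sup>+x. ennreal (c powr (real CARD('n) + 2 * b)) * (?w x * indicator (shell 1) x) \<partial>lborel)"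
    unfolding sh using c
    by (intro nn_integral_cong)
       (simp add: powr_mult powr_add powr_realpow ennreal_mult mult_ac)
  also have "\<dots> = ennreal (c powr (real CARD('n) + 2 * b)) * emeasure (weight b) (shell 1 :: (real^'n) set)"
    unfolding weight_def by (subst nn_integral_cmult) (auto simp: emeasure_density)
  finally show ?thesis .
qed

lemma dyadic_of_log:
  assumes "r > 0" "real k \<le> log 2 r" "log 2 r \<le> real k + 1"
  shows "2 ^ k \<le> r" "r \<le> 2 * 2 ^ k"
proof -
  have "2 powr log 2 r = r" using assms(1) by simp
  moreover have "2 powr real k \<le> 2 powr log 2 r" "2 powr log 2 r \<le> 2 powr (real k + 1)"
    using assms by (intro powr_mono; simp)+
  ultimately show "2 ^ k \<le> r" "r \<le> 2 * 2 ^ k"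
    by (simp_all add: powr_add powr_realpow)
qed

text \<open>The dyadic shells of radius \<open>2\<^sup>k\<close> have measure proportional to \<open>2\<^bsup>k (N + 2 b)\<^esup>\<close>.  Towards the
  origin this is summable because \<open>N + 2 b > 0\<close>, towards infinity a high power of \<open>1 + |x|\<close> in the
  denominator makes it so.\<close>

lemma weight_decay_integrable:
  assumes b: "b > - real CARD('n::finite) / 2"
  obtains J :: nat where "integrable (weight b :: (real^'n) measure) (\<lambda>x. 1 / (1 + norm x) ^ J)"
proof -
  define s where "s = real CARD('n) + 2 * b"
  have s: "s > 0" using b by (simp add: s_def field_simps)
  obtain J :: nat where J: "real J > s" using reals_Archimedean2 by blast
  let ?S = "\<lambda>r. shell r :: (real^'n) set"
  define M where "M = emeasure (weight b) (?S 1)"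
  have M: "M < \<infinity>" unfolding M_def by (rule emeasure_weight_shell_1)
  (* the summand for k dominates the integrand on the shells of radii 2^k and 2^(-k-1) *)
  define f where "f k x = ennreal ((1/2) ^ (k * J)) * indicator (?S (2 ^ k)) x + indicator (?S ((1/2) ^ Suc k)) x"
    for k :: nat and x
  have fM: "(\<integral>\<^sup>+x. f k x \<partial>weight b) = ennreal ((2 powr (s - real J)) ^ k + 2 powr (- s) * (2 powr (- s)) ^ k) * M" for k
  proof -
    have "(\<integral>\<^sup>+x. f k x \<partial>weight b) = ennreal ((1/2) ^ (k * J)) * emeasure (weight b) (?S (2 ^ k))
        + emeasure (weight b) (?S ((1/2) ^ Suc k))"
      unfolding f_def by (subst nn_integral_add) (auto simp: nn_integral_cmult_indicator)
    also have "\<dots> = ennreal ((1/2) ^ (k * J) * (2 ^ k) powr s + ((1/2) ^ Suc k) powr s) * M"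
      by (subst (1 2) emeasure_weight_shell)
         (auto simp: M_def s_def ennreal_mult ennreal_plus distrib_right mult.assoc)
    also have "(1/2) ^ (k * J) * (2 ^ k) powr s = (2 powr (s - real J)) ^ k"
      by (simp add: powr_diff power_divide powr_powr mult.commute flip: powr_realpow)
    also have "((1/2) ^ Suc k) powr s = 2 powr (- s) * (2 powr (- s)) ^ k"
      by (simp add: powr_mult powr_power powr_divide powr_minus field_simps flip: powr_realpow)
        (simp add: powr_powr mult.commute)
    finally show ?thesis .
  qed
  have "summable (\<lambda>k. (2 powr (s - real J)) ^ k + 2 powr (- s) * (2 powr (- s)) ^ k)"
    using s J by (intro summable_add summable_mult summable_geometric) (auto simp: powr_less_one)
  then have "(\<Sum>k. ennreal ((2 powr (s - real J)) ^ k + 2 powr (- s) * (2 powr (- s)) ^ k)) < \<infinity>"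
    unfolding infinity_ennreal_def less_top[symmetric] by (intro ennreal_suminf_neq_top) auto
  then have fin: "(\<Sum>k. \<integral>\<^sup>+x. f k x \<partial>weight b) < \<infinity>"
    unfolding fM using M by (simp add: ennreal_suminf_multc ennreal_mult_less_top less_top)
  have "(\<integral>\<^sup>+x. ennreal (norm (1 / (1 + norm x) ^ J)) \<partial>(weight b :: (real^'n) measure))
      \<le> (\<integral>\<^sup>+x. (\<Sum>k. f k x) \<partial>weight b)"
  proof (rule nn_integral_mono_AE)
    have "ennreal (norm (1 / (1 + norm x) ^ J)) \<le> (\<Sum>k. f k x)" if x: "x \<noteq> 0" for x :: "real^'n"
    proof -
      have "\<exists>k. ennreal (norm (1 / (1 + norm x) ^ J)) \<le> f k x"
      proof (cases "norm x \<ge> 1")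
        case True
        define k where "k = nat \<lfloor>log 2 (norm x)\<rfloor>"
        have k: "real k \<le> log 2 (norm x)" "log 2 (norm x) \<le> real k + 1"
        proof -
          have "\<lfloor>log 2 (norm x)\<rfloor> \<ge> 0"
            unfolding zero_le_floor using True by (subst zero_le_log_cancel_iff) linarith+
          then have "real k = of_int \<lfloor>log 2 (norm x)\<rfloor>"
            by (simp add: k_def)
          then show "real k \<le> log 2 (norm x)" "log 2 (norm x) \<le> real k + 1"
            by linarith+
        qed
        have nk: "2 ^ k \<le> norm x" "norm x \<le> 2 * 2 ^ k"
          by (rule dyadic_of_log[OF _ k], use True in linarith)+
        have "1 / (1 + norm x) ^ J \<le> 1 / (2 ^ k) ^ J"
          using nk by (intro divide_left_mono power_mono mult_pos_pos) (auto intro: add_pos_nonneg)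
        also have "\<dots> = (1/2) ^ (k * J)"
          by (simp add: power_mult power_divide)
        finally have "ennreal (norm (1 / (1 + norm x) ^ J)) \<le> ennreal ((1/2) ^ (k * J))"
          by (intro ennreal_leI) simp
        moreover have "x \<in> ?S (2 ^ k)" using nk by (simp add: shell_def)
        ultimately have "ennreal (norm (1 / (1 + norm x) ^ J)) \<le> f k x"
          unfolding f_def by (simp add: add_increasing2)
        then show ?thesis ..
      next
        case False
        define k where "k = nat \<lfloor>log 2 (1 / norm x)\<rfloor>"
        have pos: "norm x > 0" "1 / norm x \<ge> 1" using x False by auto
        have k: "real k \<le> log 2 (1 / norm x)" "log 2 (1 / norm x) \<le> real k + 1"
        proof -
          have "log 2 (1 / norm x) \<ge> 0"
            using pos by (subst zero_le_log_cancel_iff) auto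
          then have "real k = of_int \<lfloor>log 2 (1 / norm x)\<rfloor>"
            unfolding k_def by simp
          then show "real k \<le> log 2 (1 / norm x)" "log 2 (1 / norm x) \<le> real k + 1"
            by linarith+
        qed
        have "2 ^ k \<le> 1 / norm x" "1 / norm x \<le> 2 * 2 ^ k"
          by (rule dyadic_of_log[OF _ k], use pos in linarith)+
        then have "x \<in> ?S ((1/2) ^ Suc k)"
          using pos by (simp add: shell_def field_simps)
        moreover have "1 / (1 + norm x) ^ J \<le> 1"
          using one_le_power[of "1 + norm x" J] by (subst divide_le_eq_1_pos) (auto intro!: zero_less_power add_pos_nonneg)
        ultimately have "ennreal (norm (1 / (1 + norm x) ^ J)) \<le> f k x"
          unfolding f_def by (simp add: add_increasing flip: ennreal_1 del: ennreal_1)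
        then show ?thesis ..
      qed
      then obtain k where "ennreal (norm (1 / (1 + norm x) ^ J)) \<le> f k x" ..
      also have "f k x \<le> (\<Sum>k. f k x)"
        using sum_le_suminf[of "\<lambda>k. f k x" "{k}"] by simp
      finally show ?thesis .
    qed
    moreover have "AE x in (weight b :: (real^'n) measure). x \<noteq> 0"
      unfolding AE_weight_iff by (rule AE_lborel_singleton)
    ultimately show "AE x in (weight b :: (real^'n) measure). ennreal (norm (1 / (1 + norm x) ^ J)) \<le> (\<Sum>k. f k x)"
      by (auto elim!: AE_mp)
  qed
  also have "\<dots> = (\<Sum>k. \<integral>\<^sup>+x. f k x \<partial>weight b)"
    by (rule nn_integral_suminf) (simp add: f_def)
  finally have "integrable (weight b :: (real^'n) measure) (\<lambda>x. 1 / (1 + norm x) ^ J)"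
    using fin unfolding integrable_iff_bounded by auto
  then show ?thesis by (rule that)
qed

text \<open>The power \<open>J\<close> of \<open>weight_decay_integrable\<close> is one of those in the hypothesis.\<close>

lemma L2_of_rapid_decay:
  fixes f :: "real^'n::finite \<Rightarrow> complex"
  assumes b: "b > - real CARD('n) / 2" and f: "f \<in> borel_measurable borel"
    and decay: "\<And>j. \<exists>C. \<forall>x. (1 + norm x) ^ j * norm (f x) \<le> C"
  shows "f \<in> L2 b"
proof -
  obtain J where J: "integrable (weight b :: (real^'n) measure) (\<lambda>x. 1 / (1 + norm x) ^ J)"
    using weight_decay_integrable[OF b] .
  obtain C where C: "(1 + norm x) ^ J * norm (f x) \<le> C" for x
    using decay by blast
  have "(norm (f x))\<^sup>2 \<le> C\<^sup>2 * (1 / (1 + norm x) ^ J)" for x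
  proof -
    have p: "(1 + norm x) ^ J \<ge> 1" by simp
    have "(norm (f x))\<^sup>2 * (1 + norm x) ^ J \<le> (norm (f x))\<^sup>2 * ((1 + norm x) ^ J)\<^sup>2"
      using p by (intro mult_left_mono self_le_power) auto
    also have "\<dots> = ((1 + norm x) ^ J * norm (f x))\<^sup>2"
      by (simp add: power_mult_distrib mult.commute)
    also have "\<dots> \<le> C\<^sup>2"
      using C by (intro power_mono) (auto intro!: mult_nonneg_nonneg)
    finally show ?thesis
      using p by (simp add: field_simps add_pos_nonneg)
  qed
  then have "integrable (weight b) (\<lambda>x. (norm (f x))\<^sup>2)"
    using f by (intro Bochner_Integration.integrable_bound[OF integrable_mult_right[OF J, of "C\<^sup>2"]])
      (auto intro!: AE_I2 order.trans[OF _ abs_ge_self])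
  then show ?thesis using f by (simp add: L2_def)
qed

lemma schwartz_differentiable: "f \<in> schwartz \<Longrightarrow> f differentiable_on UNIV"
  unfolding schwartz_def by (drule CollectD, drule spec[of _ "[]"]) simp

lemma schwartz_continuous: "f \<in> schwartz \<Longrightarrow> continuous_on UNIV f"
  by (rule differentiable_imp_continuous_on[OF schwartz_differentiable])

lemma schwartz_bounded: "f \<in> schwartz \<Longrightarrow> bounded (range (\<lambda>x. norm x ^ j *\<^sub>R f x))"
  unfolding schwartz_def by (drule CollectD, drule spec[of _ "[]"]) simp

lemma schwartz_pdiff:
  assumes "f \<in> schwartz" shows "pdiff k f \<in> schwartz"
  unfolding schwartz_def
proof (intro CollectI allI)
  fix ks :: "'a list"
  have e: "foldr pdiff ks (pdiff k f) = foldr pdiff (ks @ [k]) f" by simp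
  show "foldr pdiff ks (pdiff k f) differentiable_on UNIV \<and>
      (\<forall>j. bounded (range (\<lambda>x. norm x ^ j *\<^sub>R foldr pdiff ks (pdiff k f) x)))"
    unfolding e using assms unfolding schwartz_def by blast
qed

text \<open>The Schwartz space is the largest set of differentiable functions that decay rapidly and that is stable
under partial derivatives.  This replaces inductions over multi-indices: to see that an operation preserves
the Schwartz space it suffices to find a stable set containing its results.\<close>

lemma schwartz_coinduct:
  assumes f: "f \<in> S"
    and S: "\<And>f. f \<in> S \<Longrightarrow> f differentiable_on UNIV"
      "\<And>f j. f \<in> S \<Longrightarrow> bounded (range (\<lambda>x. norm x ^ j *\<^sub>R f x))"
      "\<And>f k. f \<in> S \<Longrightarrow> pdiff k f \<in> S"
  shows "f \<in> schwartz"
proof -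
  have "foldr pdiff ks f \<in> S" for ks
    by (induction ks) (auto simp: f S(3))
  then show ?thesis unfolding schwartz_def using S by blast
qed

lemma differentiable_along_line:
  fixes f :: "real^'n::finite \<Rightarrow> complex"
  assumes "f differentiable_on UNIV"
  shows "((\<lambda>t. f (x + t *\<^sub>R axis k 1)) has_vector_derivative pdiff k f x) (at 0)"
proof -
  have "f differentiable at (x + 0 *\<^sub>R axis k 1)"
    using assms by (simp add: differentiable_on_def)
  moreover have "(\<lambda>t. x + t *\<^sub>R axis k 1) differentiable at (0::real)"
    by (intro derivative_intros)
  ultimately have "(\<lambda>t. f (x + t *\<^sub>R axis k 1)) differentiable at 0"
    using differentiable_chain_at[of "\<lambda>t::real. x + t *\<^sub>R axis k 1" 0 f] by (simp add: o_def)
  then show ?thesis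
    unfolding pdiff_def by (simp add: vector_derivative_works)
qed

lemma pdiff_unique:
  "((\<lambda>t. f (x + t *\<^sub>R axis k 1)) has_vector_derivative d) (at 0) \<Longrightarrow> pdiff k f x = d"
  unfolding pdiff_def by (rule vector_derivative_at)

lemma pdiff_add:
  assumes "f differentiable_on UNIV" "g differentiable_on UNIV"
  shows "pdiff k (\<lambda>x. f x + g x) = (\<lambda>x. pdiff k f x + pdiff k g x)"
  using assms by (intro ext pdiff_unique has_vector_derivative_add differentiable_along_line)

lemma pdiff_scale:
  assumes "f differentiable_on UNIV"
  shows "pdiff k (\<lambda>x. c * f x) = (\<lambda>x. c * pdiff k f x)"
  using assms by (intro ext pdiff_unique has_vector_derivative_mult_right differentiable_along_line)

lemma differentiable_coord_mult:
  assumes "f differentiable_on UNIV"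
  shows "coord_mult n f differentiable_on UNIV"
proof -
  have "(\<lambda>x :: real^'a. complex_of_real (x $ n)) differentiable at x" for x
    by (intro bounded_linear_imp_differentiable)
       (rule bounded_linear_compose[OF bounded_linear_of_real bounded_linear_vec_nth])
  then have "(\<lambda>x. of_real (x $ n) * f x) differentiable_on UNIV"
    using assms unfolding differentiable_on_def by (auto intro!: differentiable_mult)
  then show ?thesis
    by (simp add: coord_mult_def[abs_def])
qed

lemma pdiff_coord_mult:
  assumes "f differentiable_on UNIV"
  shows "pdiff k (coord_mult n f) = (\<lambda>x. (if k = n then f x else 0) + coord_mult n (pdiff k f) x)"
proof (intro ext pdiff_unique)
  fix x :: "real^'a"
  have 1: "((\<lambda>t. complex_of_real ((x + t *\<^sub>R axis k 1) $ n)) has_vector_derivative (if k = n then 1 else 0)) (at 0)"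
    by (cases "k = n") (auto simp: axis_def intro!: derivative_eq_intros has_vector_derivative_of_real)
  have "((\<lambda>t. complex_of_real ((x + t *\<^sub>R axis k 1) $ n) * f (x + t *\<^sub>R axis k 1)) has_vector_derivative
      (complex_of_real ((x + 0 *\<^sub>R axis k 1) $ n) * pdiff k f x
       + (if k = n then 1 else 0) * f (x + 0 *\<^sub>R axis k 1))) (at 0)"
    by (rule has_vector_derivative_mult[OF 1 differentiable_along_line[OF assms]])
  then show "((\<lambda>t. coord_mult n f (x + t *\<^sub>R axis k 1)) has_vector_derivative
      (if k = n then f x else 0) + coord_mult n (pdiff k f) x) (at 0)"
    by (simp add: coord_mult_def add.commute split: if_splits)
qed

lemma schwartz_add:
  assumes "f \<in> schwartz" "g \<in> schwartz"
  shows "(\<lambda>x. f x + g x) \<in> schwartz"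
proof (rule schwartz_coinduct[where S = "{\<lambda>x. f x + g x |f g. f \<in> schwartz \<and> g \<in> schwartz}"])
  show "(\<lambda>x. f x + g x) \<in> {\<lambda>x. f x + g x |f g. f \<in> schwartz \<and> g \<in> schwartz}"
    using assms by blast
next
  fix h j k assume "h \<in> {\<lambda>x. f x + g x |f g. f \<in> schwartz \<and> g \<in> schwartz}"
  then obtain f g where h: "h = (\<lambda>x. f x + g x)" "f \<in> schwartz" "g \<in> schwartz" by blast
  show "h differentiable_on UNIV"
    unfolding h(1) using h(2,3) by (intro differentiable_on_add schwartz_differentiable)
  show "bounded (range (\<lambda>x. norm x ^ j *\<^sub>R h x))"
    unfolding h(1) scaleR_add_right using h(2,3) by (intro bounded_plus_comp schwartz_bounded)
  show "pdiff k h \<in> {\<lambda>x. f x + g x |f g. f \<in> schwartz \<and> g \<in> schwartz}"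
    unfolding h(1) pdiff_add[OF h(2,3)[THEN schwartz_differentiable]] using h(2,3) schwartz_pdiff by blast
qed

lemma schwartz_scale:
  assumes "f \<in> schwartz"
  shows "(\<lambda>x. c * f x) \<in> schwartz"
proof (rule schwartz_coinduct[where S = "{\<lambda>x. c * f x |f. f \<in> schwartz}"])
  show "(\<lambda>x. c * f x) \<in> {\<lambda>x. c * f x |f. f \<in> schwartz}"
    using assms by blast
next
  fix h j assume "h \<in> {\<lambda>x. c * f x |f. f \<in> schwartz}"
  then obtain f where f: "h = (\<lambda>x. c * f x)" "f \<in> schwartz" by blast
  show "bounded (range (\<lambda>x. norm x ^ j *\<^sub>R h x))"
    using bounded_linear_image[OF schwartz_bounded[OF f(2), of j] bounded_linear_mult_right[of c]] f(1)
    by (simp add: image_image)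
qed (auto simp: pdiff_scale schwartz_differentiable intro!: schwartz_pdiff derivative_intros)

lemma schwartz_diff:
  assumes "f \<in> schwartz" "g \<in> schwartz"
  shows "(\<lambda>x. f x - g x) \<in> schwartz"
  using schwartz_add[OF assms(1) schwartz_scale[OF assms(2), of "- 1"]] by simp

text \<open>Derivatives of \<open>x\<^sub>n f\<close> have the form \<open>x\<^sub>n f' + g\<close> with Schwartz functions \<open>f'\<close> and \<open>g\<close>, and such sums are stable
under differentiation.\<close>

lemma schwartz_coord_mult:
  assumes "f \<in> schwartz"
  shows "coord_mult n f \<in> schwartz"
proof (rule schwartz_coinduct[where S = "{\<lambda>x. coord_mult n f x + g x |f g. f \<in> schwartz \<and> g \<in> schwartz}"])
  have "coord_mult n f = (\<lambda>x. coord_mult n f x + 0 * f x)" by simp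
  then show "coord_mult n f \<in> {\<lambda>x. coord_mult n f x + g x |f g. f \<in> schwartz \<and> g \<in> schwartz}"
    using assms schwartz_scale[OF assms, of 0] by (intro CollectI exI conjI)
next
  fix h j assume "h \<in> {\<lambda>x. coord_mult n f x + g x |f g. f \<in> schwartz \<and> g \<in> schwartz}"
  then obtain f g where h: "h = (\<lambda>x. coord_mult n f x + g x)" "f \<in> schwartz" "g \<in> schwartz" by blast
  obtain C where C: "norm (norm x ^ Suc j *\<^sub>R f x) \<le> C" for x
    using schwartz_bounded[OF h(2), of "Suc j"] unfolding bounded_iff by auto
  have "bounded (range (\<lambda>x. norm x ^ j *\<^sub>R coord_mult n f x))"
    unfolding bounded_iff
  proof (intro exI[of _ C] ballI, clarify)
    fix x
    have "norm (norm x ^ j *\<^sub>R coord_mult n f x) = \<bar>x $ n\<bar> * (norm x ^ j * norm (f x))"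
      by (simp add: coord_mult_def norm_mult)
    also have "\<dots> \<le> norm x * (norm x ^ j * norm (f x))"
      by (intro mult_right_mono component_le_norm_cart) auto
    also have "\<dots> \<le> C" using C[of x] by (simp add: mult.assoc)
    finally show "norm (norm x ^ j *\<^sub>R coord_mult n f x) \<le> C" .
  qed
  then show "bounded (range (\<lambda>x. norm x ^ j *\<^sub>R h x))"
    unfolding h(1) scaleR_add_right using schwartz_bounded[OF h(3)] by (intro bounded_plus_comp)
next
  fix h k assume "h \<in> {\<lambda>x. coord_mult n f x + g x |f g. f \<in> schwartz \<and> g \<in> schwartz}"
  then obtain f g where h: "h = (\<lambda>x. coord_mult n f x + g x)" "f \<in> schwartz" "g \<in> schwartz" by blast
  have "pdiff k h = (\<lambda>x. coord_mult n (pdiff k f) x + ((if k = n then 1 else 0) * f x + pdiff k g x))"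
    unfolding h(1) using h(2,3)
    by (subst pdiff_add) (auto simp: differentiable_coord_mult schwartz_differentiable pdiff_coord_mult)
  moreover have "(\<lambda>x. (if k = n then 1 else 0) * f x + pdiff k g x) \<in> schwartz"
    using h by (intro schwartz_add schwartz_scale schwartz_pdiff)
  ultimately show "pdiff k h \<in> {\<lambda>x. coord_mult n f x + g x |f g. f \<in> schwartz \<and> g \<in> schwartz}"
    using schwartz_pdiff[OF h(2), of k] by (intro CollectI exI conjI)
qed (auto intro!: differentiable_on_add simp: differentiable_coord_mult schwartz_differentiable)

lemma norm_power2_eq_sum: "(norm (x :: real^'n::finite))\<^sup>2 = (\<Sum>k\<in>UNIV. (x $ k)\<^sup>2)"
  by (simp add: norm_vec_def L2_set_def sum_nonneg)

lemma schwartz_sum: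
  "finite A \<Longrightarrow> (\<And>k. k \<in> A \<Longrightarrow> f k \<in> schwartz) \<Longrightarrow> f0 \<in> schwartz \<Longrightarrow> (\<lambda>x. f0 x + (\<Sum>k\<in>A. f k x)) \<in> schwartz"
proof (induction A rule: finite_induct)
  case (insert a A)
  have "(\<lambda>x. f0 x + (\<Sum>k\<in>insert a A. f k x)) = (\<lambda>x. f a x + (f0 x + (\<Sum>k\<in>A. f k x)))"
    using insert.hyps by (simp add: add.left_commute)
  then show ?case
    using insert schwartz_add[of "f a" "\<lambda>x. f0 x + (\<Sum>k\<in>A. f k x)"] by simp
qed simp

lemma schwartz_norm_mult:
  assumes "f \<in> schwartz"
  shows "(\<lambda>x. of_real ((norm x)\<^sup>2) * f x) \<in> schwartz"
proof -
  have "(\<lambda>x. of_real ((norm x)\<^sup>2) * f x) = (\<lambda>x. 0 * f x + (\<Sum>k\<in>UNIV. coord_mult k (coord_mult k f) x))"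
    unfolding norm_power2_eq_sum
    by (simp add: coord_mult_def sum_distrib_right power2_eq_square mult.assoc)
  then show ?thesis
    using assms by (simp only:) (intro schwartz_sum schwartz_coord_mult schwartz_scale finite)
qed

lemma schwartz_in_L2:
  fixes f :: "real^'n::finite \<Rightarrow> complex"
  assumes b: "b > - real CARD('n) / 2" and f: "f \<in> schwartz"
  shows "f \<in> L2 b"
proof (rule L2_of_rapid_decay[OF b])
  show "f \<in> borel_measurable borel"
    using schwartz_continuous[OF f] by (rule borel_measurable_continuous_onI)
  fix j
  obtain C0 where C0: "norm (norm x ^ 0 *\<^sub>R f x) \<le> C0" for x
    using schwartz_bounded[OF f, of 0] unfolding bounded_iff by blast
  obtain C1 where C1: "norm (norm x ^ j *\<^sub>R f x) \<le> C1" for x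
    using schwartz_bounded[OF f, of j] unfolding bounded_iff by blast
  have "(1 + norm x) ^ j * norm (f x) \<le> 2 ^ j * (C0 + C1)" for x
  proof -
    have "(1 + norm x) ^ j \<le> (2 * max 1 (norm x)) ^ j"
      by (intro power_mono) auto
    also have "\<dots> \<le> 2 ^ j * (1 + norm x ^ j)"
      by (auto simp: power_mult_distrib max_def)
    finally have "(1 + norm x) ^ j * norm (f x) \<le> 2 ^ j * (1 + norm x ^ j) * norm (f x)"
      by (rule mult_right_mono) simp
    also have "\<dots> = 2 ^ j * (norm (f x) + norm x ^ j * norm (f x))"
      by (simp add: algebra_simps)
    also have "\<dots> \<le> 2 ^ j * (C0 + C1)"
      using C0[of x] C1[of x] by (intro mult_left_mono add_mono) auto
    finally show ?thesis .
  qed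
  then show "\<exists>C. \<forall>x. (1 + norm x) ^ j * norm (f x) \<le> C" by blast
qed

text \<open>The weight charges every nonempty open set.  This is what makes the Schwartz representatives in the
definitions of \<open>Hb\<close> and \<open>Fb\<close> unique.\<close>

lemma continuous_L2_eq_imp_eq:
  fixes f g :: "real^'n::finite \<Rightarrow> complex"
  assumes f: "continuous_on UNIV f" and g: "continuous_on UNIV g" and eq: "L2_eq b f g"
  shows "f = g"
proof (rule ccontr)
  assume "f \<noteq> g"
  then obtain x where x: "f x \<noteq> g x" by blast
  have "open {x. f x \<noteq> g x}"
    by (intro open_Collect_neq f g)
  then obtain e where e: "e > 0" "ball x e \<subseteq> {x. f x \<noteq> g x}"
    using x openE[of "{x. f x \<noteq> g x}" x] by blast
  have "AE y in lborel. f y = g y"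
    using eq unfolding L2_eq_def AE_weight_iff .
  then have "AE y in lborel. y \<notin> ball x e"
    by (rule AE_mp) (use e in \<open>auto intro!: AE_I2 simp del: mem_ball\<close>)
  then have "emeasure lborel (ball x e) = 0"
    by (subst (asm) AE_iff_measurable[of "ball x e"]) auto
  then have "measure lborel (ball x e) = 0"
    by (simp add: measure_def)
  then show False
    using content_ball_pos[OF e(1), of x] by simp
qed

lemma schwartz_L2_eq_imp_eq: "f \<in> schwartz \<Longrightarrow> g \<in> schwartz \<Longrightarrow> L2_eq b f g \<Longrightarrow> f = g"
  using continuous_L2_eq_imp_eq schwartz_continuous by blast

section \<open>Homogeneous and harmonic polynomials\<close>

text \<open>The homogeneous polynomials (\<open>homogeneous_poly_eq\<close>), generated by multiplications with coordinates.  In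
contrast to the presentation by coefficients, this one supports induction on the degree.\<close>

inductive hom_span :: "nat \<Rightarrow> (real^'n::finite \<Rightarrow> complex) \<Rightarrow> bool" where
  const: "hom_span 0 (\<lambda>x. c)"
| coord: "hom_span m q \<Longrightarrow> hom_span (Suc m) (coord_mult n q)"
| add: "hom_span m p \<Longrightarrow> hom_span m q \<Longrightarrow> hom_span m (\<lambda>x. p x + q x)"

lemma hom_span_scale: "hom_span m p \<Longrightarrow> hom_span m (\<lambda>x. c * p x)"
proof (induction rule: hom_span.induct)
  case (const d)
  show ?case by (rule hom_span.const)
next
  case (coord m q n)
  have "(\<lambda>x. c * coord_mult n q x) = coord_mult n (\<lambda>x. c * q x)"
    by (auto simp: coord_mult_def)
  then show ?case using hom_span.coord[OF coord.IH] by simp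
next
  case (add m p q)
  then show ?case using hom_span.add by (simp add: distrib_left)
qed

lemma hom_span_zero: "hom_span m (\<lambda>x. 0)"
proof (induction m)
  case (Suc m)
  have "coord_mult undefined (\<lambda>x. 0) = (\<lambda>x :: real^'a. 0)"
    by (simp add: coord_mult_def fun_eq_iff)
  then show ?case using hom_span.coord[OF Suc, of undefined] by simp
qed (rule hom_span.const)

lemma hom_span_sum: "(\<And>k. k \<in> A \<Longrightarrow> hom_span m (f k)) \<Longrightarrow> hom_span m (\<lambda>x. \<Sum>k\<in>A. f k x)"
  by (induction A rule: infinite_finite_induct) (auto intro: hom_span_zero hom_span.add)

lemma hom_span_norm_mult:
  assumes "hom_span m q"
  shows "hom_span (Suc (Suc m)) (\<lambda>x. of_real ((norm x)\<^sup>2) * q x)"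
proof -
  have "(\<lambda>x. of_real ((norm x)\<^sup>2) * q x) = (\<lambda>x. \<Sum>k\<in>UNIV. coord_mult k (coord_mult k q) x)"
    unfolding norm_power2_eq_sum
    by (simp add: coord_mult_def sum_distrib_right power2_eq_square mult.assoc)
  then show ?thesis
    using assms by (simp only:) (intro hom_span_sum hom_span.coord)
qed

definition multi_indices :: "nat \<Rightarrow> ('n::finite \<Rightarrow> nat) set" where
  "multi_indices m = {\<alpha>. sum \<alpha> UNIV = m}"

lemma finite_multi_indices: "finite (multi_indices m :: ('n::finite \<Rightarrow> nat) set)"
proof (rule finite_subset)
  show "multi_indices m \<subseteq> (UNIV :: 'n set) \<rightarrow>\<^sub>E {..m}"
    unfolding multi_indices_def by (auto simp: PiE_def extensional_def intro: member_le_sum)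
  show "finite ((UNIV :: 'n set) \<rightarrow>\<^sub>E {..m})"
    by (intro finite_PiE) auto
qed

definition monomial :: "('n::finite \<Rightarrow> nat) \<Rightarrow> real^'n \<Rightarrow> complex" where
  "monomial \<alpha> x = (\<Prod>k\<in>UNIV. of_real (x $ k) ^ \<alpha> k)"

lemma homogeneous_poly_iff:
  "p \<in> homogeneous_poly m \<longleftrightarrow> (\<exists>c. \<forall>x. p x = (\<Sum>\<alpha>\<in>multi_indices m. c \<alpha> * monomial \<alpha> x))"
  by (simp add: homogeneous_poly_def multi_indices_def monomial_def)

lemma coord_mult_monomial: "coord_mult n (monomial \<alpha>) = monomial (\<alpha>(n := Suc (\<alpha> n)))"
proof
  fix x :: "real^'a"
  have "monomial (\<alpha>(n := Suc (\<alpha> n))) x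
      = of_real (x $ n) ^ Suc (\<alpha> n) * (\<Prod>k\<in>UNIV - {n}. of_real (x $ k) ^ \<alpha> k)"
    unfolding monomial_def by (subst prod.remove[of _ n]) (auto intro!: prod.cong)
  also have "\<dots> = of_real (x $ n) * monomial \<alpha> x"
    unfolding monomial_def by (subst (2) prod.remove[of _ n]) auto
  finally show "coord_mult n (monomial \<alpha>) x = monomial (\<alpha>(n := Suc (\<alpha> n))) x"
    by (simp add: coord_mult_def)
qed

lemma sum_update_Suc: "sum (\<alpha>(n := Suc (\<alpha> n))) UNIV = Suc (sum \<alpha> (UNIV :: 'n::finite set))"
proof -
  have "sum (\<alpha>(n := Suc (\<alpha> n))) UNIV = Suc (\<alpha> n) + sum \<alpha> (UNIV - {n})"
    by (subst sum.remove[of _ n]) (auto intro!: sum.cong)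
  also have "\<dots> = Suc (sum \<alpha> UNIV)"
    by (subst (2) sum.remove[of _ n]) auto
  finally show ?thesis .
qed

lemma hom_span_monomial: "\<alpha> \<in> multi_indices m \<Longrightarrow> hom_span m (monomial \<alpha>)"
proof (induction m arbitrary: \<alpha>)
  case 0
  then have "\<alpha> = (\<lambda>_. 0)" by (auto simp: multi_indices_def)
  then have "monomial \<alpha> = (\<lambda>x. 1)" by (auto simp: monomial_def)
  then show ?case by (simp add: hom_span.const)
next
  case (Suc m)
  then obtain n where n: "\<alpha> n \<noteq> 0"
    unfolding multi_indices_def by (metis (mono_tags, lifting) Zero_not_Suc mem_Collect_eq sum.neutral)
  define \<beta> where "\<beta> = \<alpha>(n := \<alpha> n - 1)"
  have \<alpha>: "\<alpha> = \<beta>(n := Suc (\<beta> n))" using n by (auto simp: \<beta>_def)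
  have "Suc (sum \<beta> UNIV) = Suc m"
    using Suc.prems sum_update_Suc[of \<beta> n] \<alpha> by (simp add: multi_indices_def)
  then have "hom_span m (monomial \<beta>)"
    by (intro Suc.IH) (simp add: multi_indices_def)
  from hom_span.coord[OF this, of n] show ?case
    by (subst \<alpha>) (simp add: coord_mult_monomial)
qed

lemma homogeneous_poly_eq: "p \<in> homogeneous_poly m \<longleftrightarrow> hom_span m p"
proof
  assume "p \<in> homogeneous_poly m"
  then obtain c where c: "\<And>x. p x = (\<Sum>\<alpha>\<in>multi_indices m. c \<alpha> * monomial \<alpha> x)"
    unfolding homogeneous_poly_iff by blast
  have "hom_span m (\<lambda>x. \<Sum>\<alpha>\<in>multi_indices m. c \<alpha> * monomial \<alpha> x)"
    by (intro hom_span_sum hom_span_scale hom_span_monomial)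
  moreover have "p = (\<lambda>x. \<Sum>\<alpha>\<in>multi_indices m. c \<alpha> * monomial \<alpha> x)" using c by blast
  ultimately show "hom_span m p" by simp
next
  assume "hom_span m p"
  then show "p \<in> homogeneous_poly m"
  proof (induction rule: hom_span.induct)
    case (const c)
    have "multi_indices 0 = {\<lambda>_ :: 'a. 0}"
      by (auto simp: multi_indices_def)
    then show ?case
      unfolding homogeneous_poly_iff by (intro exI[of _ "\<lambda>_. c"]) (simp add: monomial_def)
  next
    case (add m p q)
    then obtain c d where "\<And>x. p x = (\<Sum>\<alpha>\<in>multi_indices m. c \<alpha> * monomial \<alpha> x)"
      "\<And>x. q x = (\<Sum>\<alpha>\<in>multi_indices m. d \<alpha> * monomial \<alpha> x)"
      unfolding homogeneous_poly_iff by blast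
    then show ?case
      unfolding homogeneous_poly_iff
      by (intro exI[of _ "\<lambda>\<alpha>. c \<alpha> + d \<alpha>"]) (simp add: distrib_right sum.distrib)
  next
    case (coord m q n)
    then obtain c where c: "\<And>x. q x = (\<Sum>\<alpha>\<in>multi_indices m. c \<alpha> * monomial \<alpha> x)"
      unfolding homogeneous_poly_iff by blast
    let ?up = "\<lambda>\<alpha> :: 'a \<Rightarrow> nat. \<alpha>(n := Suc (\<alpha> n))"
    let ?d = "\<lambda>\<beta>. if \<beta> n = 0 then 0 else c (\<beta>(n := \<beta> n - 1))"
    have inj: "inj_on ?up (multi_indices m)"
      by (rule inj_on_inverseI[where g = "\<lambda>\<beta>. \<beta>(n := \<beta> n - 1)"]) auto
    have "coord_mult n q x = (\<Sum>\<beta>\<in>multi_indices (Suc m). ?d \<beta> * monomial \<beta> x)" for x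
    proof -
      have "coord_mult n q x = (\<Sum>\<alpha>\<in>multi_indices m. c \<alpha> * coord_mult n (monomial \<alpha>) x)"
        by (simp add: coord_mult_def c sum_distrib_left mult_ac)
      also have "\<dots> = (\<Sum>\<alpha>\<in>multi_indices m. ?d (?up \<alpha>) * monomial (?up \<alpha>) x)"
        by (simp add: coord_mult_monomial)
      also have "\<dots> = (\<Sum>\<beta>\<in>?up ` multi_indices m. ?d \<beta> * monomial \<beta> x)"
        by (subst sum.reindex[OF inj]) (simp add: o_def)
      also have "\<dots> = (\<Sum>\<beta>\<in>multi_indices (Suc m). ?d \<beta> * monomial \<beta> x)"
      proof (rule sum.mono_neutral_left[OF finite_multi_indices])
        show "?up ` multi_indices m \<subseteq> multi_indices (Suc m)"
          by (auto simp: multi_indices_def sum_update_Suc simp del: fun_upd_apply)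
        show "\<forall>\<beta>\<in>multi_indices (Suc m) - ?up ` multi_indices m. ?d \<beta> * monomial \<beta> x = 0"
        proof
          fix \<beta> :: "'a \<Rightarrow> nat"
          assume \<beta>: "\<beta> \<in> multi_indices (Suc m) - ?up ` multi_indices m"
          have "\<beta> n = 0"
          proof (rule ccontr)
            assume n0: "\<beta> n \<noteq> 0"
            define \<alpha> where "\<alpha> = \<beta>(n := \<beta> n - 1)"
            have e: "\<beta> = ?up \<alpha>" using n0 by (auto simp: \<alpha>_def)
            then have "\<alpha> \<in> multi_indices m"
              using \<beta> sum_update_Suc[of \<alpha> n] by (simp add: multi_indices_def)
            then show False using e \<beta> by blast
          qed
          then show "?d \<beta> * monomial \<beta> x = 0" by simp
        qed
      qed
      finally show ?thesis .
    qed
    then show ?case unfolding homogeneous_poly_iff by (intro exI[of _ ?d] allI)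
  qed
qed

lemma hom_span_differentiable: "hom_span m p \<Longrightarrow> p differentiable_on UNIV"
  by (induction rule: hom_span.induct) (auto intro: differentiable_coord_mult differentiable_on_add)

lemma pdiff_const: "pdiff k (\<lambda>x. c) = (\<lambda>x. 0)"
  by (intro ext pdiff_unique) (rule has_vector_derivative_const)

lemma hom_span_pdiff:
  assumes "hom_span m p"
  shows "(m = 0 \<longrightarrow> pdiff k p = (\<lambda>x. 0)) \<and> hom_span (m - 1) (pdiff k p)"
  using assms
proof (induction rule: hom_span.induct)
  case (const c)
  then show ?case by (simp add: pdiff_const hom_span.const)
next
  case (coord m q n)
  have e: "pdiff k (coord_mult n q) = (\<lambda>x. (if k = n then 1 else 0) * q x + coord_mult n (pdiff k q) x)"
    using hom_span_differentiable[OF coord.hyps] by (auto simp: pdiff_coord_mult)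
  have "hom_span m (coord_mult n (pdiff k q))"
  proof (cases m)
    case 0
    then have "coord_mult n (pdiff k q) = (\<lambda>x. 0)" using coord.IH by (auto simp: coord_mult_def)
    then show ?thesis by (simp add: hom_span_zero)
  next
    case (Suc j)
    then show ?thesis using hom_span.coord coord.IH by fastforce
  qed
  then show ?case
    unfolding e using hom_span.add[OF hom_span_scale[OF coord.hyps]] by simp
next
  case (add m p q)
  then show ?case
    unfolding pdiff_add[OF add.hyps(1,2)[THEN hom_span_differentiable]] by (simp add: hom_span.add)
qed

lemma hom_span_pdiff_differentiable: "hom_span m p \<Longrightarrow> pdiff k p differentiable_on UNIV"
  using hom_span_pdiff hom_span_differentiable by blast

text \<open>Both orders of differentiation produce the same terms in the Leibniz rule for \<open>x\<^sub>n q\<close>.\<close>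

lemma pdiff_commute:
  assumes "hom_span m p"
  shows "pdiff k (pdiff l p) = pdiff l (pdiff k p)"
  using assms
proof (induction rule: hom_span.induct)
  case (coord m q n)
  note d = hom_span_differentiable[OF coord.hyps] hom_span_pdiff_differentiable[OF coord.hyps]
  have "pdiff k (pdiff l (coord_mult n q)) = (\<lambda>x. (if l = n then 1 else 0) * pdiff k q x
      + ((if k = n then 1 else 0) * pdiff l q x + coord_mult n (pdiff k (pdiff l q)) x))" for k l
  proof -
    have e: "pdiff l (coord_mult n q) = (\<lambda>x. (if l = n then 1 else 0) * q x + coord_mult n (pdiff l q) x)"
      using d by (auto simp: pdiff_coord_mult)
    have "pdiff k (pdiff l (coord_mult n q)) = (\<lambda>x. pdiff k (\<lambda>x. (if l = n then 1 else 0) * q x) x + pdiff k (coord_mult n (pdiff l q)) x)"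
      unfolding e using d by (intro pdiff_add differentiable_coord_mult) (auto intro!: derivative_intros)
    then show ?thesis
      using d by (auto simp: pdiff_scale pdiff_coord_mult)
  qed
  then show ?case using coord.IH by auto
next
  case (add m p q)
  then show ?case
    using add.hyps(1,2)[THEN hom_span_differentiable] add.hyps(1,2)[THEN hom_span_pdiff_differentiable]
    by (simp add: pdiff_add)
qed (simp add: pdiff_const)

lemma Euler_homogeneous:
  assumes "hom_span m p"
  shows "(\<Sum>k\<in>UNIV. of_real (x $ k) * pdiff k p x) = of_nat m * p x"
  using assms
proof (induction rule: hom_span.induct)
  case (coord m q n)
  have "(\<Sum>k\<in>UNIV. of_real (x $ k) * pdiff k (coord_mult n q) x)
      = (\<Sum>k\<in>UNIV. (if k = n then of_real (x $ k) * q x else 0) + of_real (x $ n) * (of_real (x $ k) * pdiff k q x))"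
    using hom_span_differentiable[OF coord.hyps]
    by (intro sum.cong) (auto simp: pdiff_coord_mult coord_mult_def algebra_simps)
  also have "\<dots> = of_nat (Suc m) * coord_mult n q x"
    by (simp only: sum.distrib coord.IH sum_distrib_left[symmetric]) (simp add: coord_mult_def algebra_simps)
  finally show ?case .
next
  case (add m p q)
  then show ?case
    using add.hyps(1,2)[THEN hom_span_differentiable] by (simp add: pdiff_add distrib_left sum.distrib)
qed (simp add: pdiff_const)

lemma laplacian_add:
  assumes p: "hom_span m p" and q: "hom_span m' q"
  shows "laplacian (\<lambda>x. p x + q x) x = laplacian p x + laplacian q x"
  using hom_span_differentiable[OF p] hom_span_differentiable[OF q]
    hom_span_pdiff_differentiable[OF p] hom_span_pdiff_differentiable[OF q]
  by (simp add: laplacian_def pdiff_add sum.distrib)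

lemma laplacian_scale:
  assumes p: "hom_span m p"
  shows "laplacian (\<lambda>x. c * p x) x = c * laplacian p x"
  using hom_span_differentiable[OF p] hom_span_pdiff_differentiable[OF p]
  by (simp add: laplacian_def pdiff_scale sum_distrib_left)

lemma laplacian_sum:
  "finite A \<Longrightarrow> (\<And>k. k \<in> A \<Longrightarrow> hom_span m (f k)) \<Longrightarrow>
    laplacian (\<lambda>x. \<Sum>k\<in>A. f k x) x = (\<Sum>k\<in>A. laplacian (f k) x)"
proof (induction A rule: finite_induct)
  case empty
  then show ?case by (simp add: laplacian_def pdiff_const)
next
  case (insert a A)
  then show ?case
    by (simp add: laplacian_add[of m "f a" m "\<lambda>x. \<Sum>k\<in>A. f k x"] hom_span_sum)
qed

lemma laplacian_coord_mult:
  assumes "hom_span m p"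
  shows "laplacian (coord_mult n p) x = 2 * pdiff n p x + of_real (x $ n) * laplacian p x"
proof -
  note d = hom_span_differentiable[OF assms] hom_span_pdiff_differentiable[OF assms]
  have "pdiff k (pdiff k (coord_mult n p)) x
      = (if k = n then 2 * pdiff k p x else 0) + of_real (x $ n) * pdiff k (pdiff k p) x" for k
  proof -
    have e: "pdiff k (coord_mult n p) = (\<lambda>x. (if k = n then 1 else 0) * p x + coord_mult n (pdiff k p) x)"
      using d by (auto simp: pdiff_coord_mult)
    have "pdiff k (pdiff k (coord_mult n p)) = (\<lambda>x. pdiff k (\<lambda>x. (if k = n then 1 else 0) * p x) x + pdiff k (coord_mult n (pdiff k p)) x)"
      unfolding e using d by (intro pdiff_add differentiable_coord_mult) (auto intro!: derivative_intros)
    then show ?thesis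
      using d by (auto simp: pdiff_scale pdiff_coord_mult coord_mult_def)
  qed
  then show ?thesis
    by (simp add: laplacian_def sum.distrib sum_distrib_left)
qed

text \<open>Apply the formula for \<open>\<Delta> (x\<^sub>k p)\<close> twice and sum over \<open>k\<close>; Euler's relation evaluates the cross term
\<open>4 \<Sum> x\<^sub>k \<partial>\<^sub>k q\<close>.\<close>

lemma laplacian_norm_mult:
  fixes q :: "real^'n::finite \<Rightarrow> complex"
  assumes q: "hom_span m q"
  shows "laplacian (\<lambda>x. of_real ((norm x)\<^sup>2) * q x) x
    = of_nat (2 * CARD('n) + 4 * m) * q x + of_real ((norm x)\<^sup>2) * laplacian q x"
proof -
  have e: "(\<lambda>x. of_real ((norm x)\<^sup>2) * q x) = (\<lambda>x. \<Sum>k\<in>UNIV. coord_mult k (coord_mult k q) x)"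
    unfolding norm_power2_eq_sum
    by (simp add: coord_mult_def sum_distrib_right power2_eq_square mult.assoc)
  have "laplacian (coord_mult k (coord_mult k q)) x
      = 2 * q x + 4 * (of_real (x $ k) * pdiff k q x) + of_real ((x $ k)\<^sup>2) * laplacian q x" for k
    using hom_span_differentiable[OF q]
    by (simp add: laplacian_coord_mult[OF hom_span.coord[OF q]] laplacian_coord_mult[OF q] pdiff_coord_mult
        coord_mult_def power2_eq_square algebra_simps)
  then have "laplacian (\<lambda>x. \<Sum>k\<in>UNIV. coord_mult k (coord_mult k q) x) x
      = of_nat (2 * CARD('n)) * q x + 4 * (\<Sum>k\<in>UNIV. of_real (x $ k) * pdiff k q x)
        + of_real (\<Sum>k\<in>UNIV. (x $ k)\<^sup>2) * laplacian q x"
    by (subst laplacian_sum[OF finite hom_span.coord[OF hom_span.coord[OF q]]])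
       (simp_all add: sum.distrib sum_distrib_right flip: sum_distrib_left)
  then show ?thesis
    unfolding e Euler_homogeneous[OF q] by (simp add: norm_power2_eq_sum algebra_simps)
qed

lemma laplacian_pdiff:
  assumes p: "hom_span m p" and h: "\<And>x. laplacian p x = 0"
  shows "laplacian (pdiff n p) x = 0"
proof -
  have d: "pdiff k (pdiff k p) differentiable_on UNIV" for k
    using hom_span_pdiff[OF p] hom_span_pdiff_differentiable by blast
  have "laplacian (pdiff n p) x = (\<Sum>k\<in>UNIV. pdiff n (pdiff k (pdiff k p)) x)"
    unfolding laplacian_def
  proof (rule sum.cong[OF refl])
    fix k
    have "pdiff k (pdiff k (pdiff n p)) = pdiff k (pdiff n (pdiff k p))"
      by (simp only: pdiff_commute[OF p, of k n])
    also have "\<dots> = pdiff n (pdiff k (pdiff k p))"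
      using hom_span_pdiff[OF p] by (intro pdiff_commute) blast
    finally show "pdiff k (pdiff k (pdiff n p)) x = pdiff n (pdiff k (pdiff k p)) x" by simp
  qed
  also have "\<dots> = pdiff n (\<lambda>x. \<Sum>k\<in>UNIV. pdiff k (pdiff k p) x) x"
    by (rule sym, rule pdiff_unique, intro has_vector_derivative_sum differentiable_along_line d)
  also have "(\<lambda>x. \<Sum>k\<in>UNIV. pdiff k (pdiff k p) x) = (\<lambda>x. 0)"
    using h by (simp add: laplacian_def fun_eq_iff)
  finally show ?thesis by (simp add: pdiff_const)
qed

text \<open>The remainder of \<open>x\<^sub>n p\<close> after subtracting the right multiple of \<open>|x|\<^sup>2 \<partial>\<^sub>n p\<close> is harmonic:
  \<open>\<Delta> (x\<^sub>n p) = 2 \<partial>\<^sub>n p\<close> and \<open>\<Delta> (|x|\<^sup>2 \<partial>\<^sub>n p) = (2 N + 4 (m - 1)) \<partial>\<^sub>n p\<close>.\<close>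

lemma coord_mult_harmonic:
  fixes p :: "real^'n::finite \<Rightarrow> complex"
  assumes p: "p \<in> harmonic_poly m"
  obtains (zero) "m = 0" "coord_mult n p \<in> harmonic_poly (Suc m)"
  | (Suc) j q r where "m = Suc j" "q \<in> harmonic_poly (Suc m)" "r \<in> harmonic_poly j"
      "coord_mult n p = (\<lambda>x. q x + of_real ((norm x)\<^sup>2) * r x)"
proof (cases m)
  case 0
  have h: "hom_span m p" "\<And>x. laplacian p x = 0"
    using p by (auto simp: harmonic_poly_def homogeneous_poly_eq)
  have "pdiff n p = (\<lambda>x. 0)"
    using hom_span_pdiff[OF h(1)] 0 by blast
  then have "coord_mult n p \<in> harmonic_poly (Suc m)"
    using h by (simp add: harmonic_poly_def homogeneous_poly_eq hom_span.coord laplacian_coord_mult[OF h(1)])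
  with 0 show ?thesis by (rule zero)
next
  case (Suc j)
  have h: "hom_span m p" "\<And>x. laplacian p x = 0"
    using p by (auto simp: harmonic_poly_def homogeneous_poly_eq)
  (* the degree of the n-th derivative is j = m - 1, and 2 / (2 N + 4 j) = 1 / (N + 2 j) *)
  define c :: complex where "c = 1 / of_nat (CARD('n) + 2 * j)"
  have c: "c * of_nat (CARD('n) + 2 * j) = 1"
    unfolding c_def using zero_less_card_finite[where 'a = 'n] by (simp del: of_nat_add)
  define r where "r = (\<lambda>x. c * pdiff n p x)"
  define q where "q = (\<lambda>x. coord_mult n p x + (- 1) * (of_real ((norm x)\<^sup>2) * r x))"
  have dp: "hom_span j (pdiff n p)"
    using hom_span_pdiff[OF h(1), of n] Suc by simp
  have r: "hom_span j r" "\<And>x. laplacian r x = 0"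
    unfolding r_def using laplacian_pdiff[OF h] by (simp_all add: hom_span_scale dp laplacian_scale[OF dp])
  have nr: "hom_span (Suc m) (\<lambda>x. of_real ((norm x)\<^sup>2) * r x)"
    using hom_span_norm_mult[OF r(1)] Suc by simp
  have q: "hom_span (Suc m) q"
    unfolding q_def by (intro hom_span.add hom_span.coord h hom_span_scale nr)
  have "laplacian q x = 0" for x
  proof -
    have "laplacian q x = 2 * pdiff n p x - of_nat (2 * CARD('n) + 4 * j) * (c * pdiff n p x)"
    unfolding q_def
    using h r by (simp only: laplacian_add[OF hom_span.coord[OF h(1)] hom_span_scale[OF nr]] laplacian_scale[OF nr]
       laplacian_coord_mult[OF h(1)] laplacian_norm_mult[OF r(1)]) (simp add: r_def)
    also have "\<dots> = 2 * pdiff n p x * (1 - c * of_nat (CARD('n) + 2 * j))"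
      by (simp add: algebra_simps)
    finally show ?thesis using c by simp
  qed
  then have "q \<in> harmonic_poly (Suc m)" "r \<in> harmonic_poly j"
    using q r by (simp_all add: harmonic_poly_def homogeneous_poly_eq)
  moreover have "coord_mult n p = (\<lambda>x. q x + of_real ((norm x)\<^sup>2) * r x)"
    by (simp add: q_def)
  ultimately show ?thesis using Suc by (intro that(2)[of j q r])
qed

section \<open>Laguerre polynomials and the action of the coordinates\<close>

text \<open>Written with a binomial coefficient instead of \<open>1 / (l - k)!\<close>, the coefficient vanishes for \<open>k > l\<close>, so
that Laguerre polynomials of different degrees become sums over the same range.\<close>

definition laguerre_coeff :: "nat \<Rightarrow> real \<Rightarrow> nat \<Rightarrow> real" where
  "laguerre_coeff l \<nu> k = Gamma (\<nu> + real l + 1) / (Gamma (\<nu> + real k + 1) * fact l) * real (l choose k)"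

lemma laguerre_expand:
  assumes "l \<le> K"
  shows "laguerre l \<nu> t = (\<Sum>k\<le>K. (-1) ^ k * laguerre_coeff l \<nu> k * t ^ k)"
proof -
  have "laguerre l \<nu> t = (\<Sum>k\<le>l. (-1) ^ k * laguerre_coeff l \<nu> k * t ^ k)"
    unfolding laguerre_def laguerre_coeff_def by (intro sum.cong) (auto simp: binomial_fact field_simps)
  also have "\<dots> = (\<Sum>k\<le>K. (-1) ^ k * laguerre_coeff l \<nu> k * t ^ k)"
    using assms by (intro sum.mono_neutral_left) (auto simp: binomial_eq_0 laguerre_coeff_def)
  finally show ?thesis .
qed

lemma Gamma_Suc_real: "(x :: real) > 0 \<Longrightarrow> Gamma (x + 1) = x * Gamma x"
  by (rule Gamma_plus1) (auto simp: nonpos_Ints_def)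

lemma laguerre_0: "\<nu> > - 1 \<Longrightarrow> laguerre 0 \<nu> t = 1"
proof -
  assume "\<nu> > - 1"
  then have "Gamma (\<nu> + 1) > 0" by (intro Gamma_real_pos) simp
  then show ?thesis by (simp add: laguerre_def)
qed

text \<open>After clearing the \<open>\<Gamma>\<close>-factors this is \<open>(l + 1) (l choose k) = (l + 1 - k) (l + 1 choose k)\<close>.\<close>

lemma laguerre_coeff_index_shift:
  assumes "\<nu> > - 1" "k \<le> Suc l"
  shows "laguerre_coeff (Suc l) \<nu> k = laguerre_coeff (Suc l) (\<nu> + 1) k - laguerre_coeff l (\<nu> + 1) k"
proof -
  define g where "g = Gamma (\<nu> + real l + 2)"
  define h where "h = Gamma (\<nu> + real k + 1)"
  have h: "h > 0" unfolding h_def using assms by (intro Gamma_real_pos) auto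
  have g1: "Gamma (\<nu> + 1 + real (Suc l) + 1) = (\<nu> + real l + 2) * g"
    using Gamma_Suc_real[of "\<nu> + real l + 2"] assms by (simp add: g_def algebra_simps)
  have h1: "Gamma (\<nu> + 1 + real k + 1) = (\<nu> + real k + 1) * h"
    using Gamma_Suc_real[of "\<nu> + real k + 1"] assms by (simp add: h_def algebra_simps)
  have g0: "Gamma (\<nu> + real (Suc l) + 1) = g" "Gamma (\<nu> + 1 + real l + 1) = g"
    by (simp_all add: g_def algebra_simps)
  have "(Suc l - k) * (Suc l choose k) = Suc l * (l choose k)"
    using binomial_absorb_comp[of "Suc l" k] by simp
  then have "real (Suc l - k) * real (Suc l choose k) = real (Suc l) * real (l choose k)"
    by (metis of_nat_mult)
  then have B: "real (l choose k) = (real (Suc l) - real k) * real (Suc l choose k) / real (Suc l)"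
    using assms by (simp add: field_simps of_nat_diff del: of_nat_Suc binomial_Suc_Suc)
  have pos: "\<nu> + real k + 1 > 0" using assms by simp
  have fs: "(fact (Suc l) :: real) = real (Suc l) * fact l" by (rule fact_Suc)
  show ?thesis
    unfolding laguerre_coeff_def g1 h1 g0 h_def[symmetric] B fs using h pos
    by (simp add: divide_simps del: of_nat_Suc binomial_Suc_Suc) (simp add: algebra_simps)
qed

lemma laguerre_index_shift:
  assumes "\<nu> > - 1"
  shows "laguerre (Suc l) \<nu> t = laguerre (Suc l) (\<nu> + 1) t - laguerre l (\<nu> + 1) t"
  unfolding laguerre_expand[OF le_refl[of "Suc l"]] laguerre_expand[OF le_SucI[OF le_refl[of l]]]
    sum_subtractf[symmetric]
  by (intro sum.cong) (simp_all add: laguerre_coeff_index_shift[OF assms] algebra_simps)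

lemma laguerre_times_arg:
  assumes "\<nu> > - 1"
  shows "t * laguerre l (\<nu> + 1) t = (\<nu> + real l + 1) * laguerre l \<nu> t - real (Suc l) * laguerre (Suc l) \<nu> t"
proof -
  define g where "g = Gamma (\<nu> + real l + 2)"
  define c where "c k = (-1) ^ k * g / (Gamma (\<nu> + real k + 1) * fact l)" for k
  have g1: "(\<nu> + real l + 1) * Gamma (\<nu> + real l + 1) = g"
    using Gamma_Suc_real[of "\<nu> + real l + 1"] assms by (simp add: g_def algebra_simps)
  have lc1: "(\<nu> + real l + 1) * laguerre_coeff l \<nu> k = g / (Gamma (\<nu> + real k + 1) * fact l) * real (l choose k)" for k
    unfolding laguerre_coeff_def g1[symmetric] by simp
  have lc2: "real (Suc l) * laguerre_coeff (Suc l) \<nu> k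
      = g / (Gamma (\<nu> + real k + 1) * fact l) * real (Suc l choose k)" for k
  proof -
    have G: "Gamma (\<nu> + real (Suc l) + 1) = g" by (simp add: g_def algebra_simps)
    show ?thesis
      unfolding laguerre_coeff_def G by (simp add: fact_Suc del: of_nat_Suc binomial_Suc_Suc)
  qed
  have "(\<nu> + real l + 1) * laguerre l \<nu> t - real (Suc l) * laguerre (Suc l) \<nu> t
      = (\<Sum>k\<le>Suc l. (-1) ^ k * ((\<nu> + real l + 1) * laguerre_coeff l \<nu> k) * t ^ k
          - (-1) ^ k * (real (Suc l) * laguerre_coeff (Suc l) \<nu> k) * t ^ k)"
    unfolding laguerre_expand[OF le_refl[of "Suc l"]] laguerre_expand[OF le_SucI[OF le_refl[of l]]]
      sum_distrib_left sum_subtractf[symmetric] by (simp only: mult_ac)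
  also have "\<dots> = (\<Sum>k\<le>Suc l. c k * (real (l choose k) - real (Suc l choose k)) * t ^ k)"
    unfolding lc1 lc2 c_def by (simp add: right_diff_distrib left_diff_distrib mult.assoc del: binomial_Suc_Suc)
  (* the term k = 0 vanishes, and Pascal's rule leaves - (l choose k) in the term Suc k *)
  also have "\<dots> = (\<Sum>k\<le>l. c (Suc k) * (real (l choose Suc k) - real (Suc l choose Suc k)) * t ^ Suc k)"
    by (subst sum.atMost_Suc_shift) simp
  also have "\<dots> = (\<Sum>k\<le>l. t * ((-1) ^ k * laguerre_coeff l (\<nu> + 1) k * t ^ k))"
    by (intro sum.cong) (auto simp: c_def laguerre_coeff_def g_def add_ac)
  also have "\<dots> = t * laguerre l (\<nu> + 1) t"
    unfolding laguerre_expand[OF le_refl[of l]] sum_distrib_left ..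
  finally show ?thesis ..
qed

text \<open>The weight of \<open>\<Phi>\<close> under the rotation subgroup, which acts on it by \<open>exp (- i t \<tau>)\<close>.\<close>

definition tau :: "'n::finite itself \<Rightarrow> real \<Rightarrow> nat \<Rightarrow> nat \<Rightarrow> real" where
  "tau T b m l = b + lam T m + 2 * real l + 1"

text \<open>The combinations of functions \<open>\<Phi>\<close> of a common weight.  The degree and the Laguerre index may
differ: raising the former by two and lowering the latter by one preserves the weight.\<close>

inductive_set weight_space :: "real \<Rightarrow> real \<Rightarrow> (real^'n::finite \<Rightarrow> complex) set" for b \<tau> where
  zero: "(\<lambda>x. 0) \<in> weight_space b \<tau>"
| add_Phi: "u \<in> weight_space b \<tau> \<Longrightarrow> p \<in> harmonic_poly m \<Longrightarrow> tau TYPE('n) b m l = \<tau> \<Longrightarrow>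
    (\<lambda>x. u x + c * Phi b m l p x) \<in> weight_space b \<tau>"

lemma weight_space_scale_Phi:
  fixes p :: "real^'n::finite \<Rightarrow> complex"
  assumes "p \<in> harmonic_poly m" "tau TYPE('n) b m l = \<tau>"
  shows "(\<lambda>x. c * Phi b m l p x) \<in> weight_space b \<tau>"
  using weight_space.add_Phi[OF weight_space.zero assms, of c] by simp

lemma lam_Suc: "lam T (Suc m) = lam T m + 1"
  by (simp add: lam_def)

text \<open>The recurrences of the Laguerre polynomials turn \<open>x\<^sub>n \<Phi>\<close> into a sum of functions whose
  weights exceed, or fall short of, that of \<open>\<Phi>\<close> by one.\<close>

lemma coord_mult_Phi:
  fixes p :: "real^'n::finite \<Rightarrow> complex"
  assumes b: "b > - real CARD('n) / 2" and p: "p \<in> harmonic_poly m"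
  shows "\<exists>u\<in>weight_space b (tau TYPE('n) b m l + 1). \<exists>v\<in>weight_space b (tau TYPE('n) b m l - 1).
      coord_mult n (Phi b m l p) = (\<lambda>x. u x + v x)"
proof -
  define \<tau> where "\<tau> = tau TYPE('n) b m l"
  have nu: "b + lam TYPE('n) j > - 1" for j
    using b by (simp add: lam_def field_simps)
  have up: "\<exists>u\<in>weight_space b (\<tau> + 1). \<exists>v\<in>weight_space b (\<tau> - 1).
      (\<lambda>x. of_real (exp (- (norm x)\<^sup>2 / 2) * laguerre l (b + lam TYPE('n) m) ((norm x)\<^sup>2)) * q x) = (\<lambda>x. u x + v x)"
    if q: "q \<in> harmonic_poly (Suc m)" for q :: "real^'n \<Rightarrow> complex"
  proof (cases l)
    case 0
    have "(\<lambda>x. 1 * Phi b (Suc m) l q x) \<in> weight_space b (\<tau> + 1)"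
      using q by (intro weight_space_scale_Phi) (auto simp: \<tau>_def tau_def lam_Suc)
    moreover have "(\<lambda>x. of_real (exp (- (norm x)\<^sup>2 / 2) * laguerre l (b + lam TYPE('n) m) ((norm x)\<^sup>2)) * q x)
        = (\<lambda>x. 1 * Phi b (Suc m) l q x + 0)"
      using nu[of m] nu[of "Suc m"] by (simp add: 0 Phi_def laguerre_0)
    ultimately show ?thesis using weight_space.zero by (intro bexI)
  next
    case (Suc i)
    have "(\<lambda>x. 1 * Phi b (Suc m) l q x) \<in> weight_space b (\<tau> + 1)"
         "(\<lambda>x. (- 1) * Phi b (Suc m) i q x) \<in> weight_space b (\<tau> - 1)"
      using q Suc by (intro weight_space_scale_Phi; auto simp: \<tau>_def tau_def lam_Suc)+
    moreover have "(\<lambda>x. of_real (exp (- (norm x)\<^sup>2 / 2) * laguerre l (b + lam TYPE('n) m) ((norm x)\<^sup>2)) * q x)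
        = (\<lambda>x. 1 * Phi b (Suc m) l q x + (- 1) * Phi b (Suc m) i q x)"
      unfolding Suc Phi_def lam_Suc laguerre_index_shift[OF nu[of m], of i] add.assoc[symmetric]
      by (simp add: algebra_simps)
    ultimately show ?thesis by (intro bexI)
  qed
  have "\<exists>u\<in>weight_space b (\<tau> + 1). \<exists>v\<in>weight_space b (\<tau> - 1). coord_mult n (Phi b m l p) = (\<lambda>x. u x + v x)"
    using p
  proof (cases rule: coord_mult_harmonic[of p m n])
    case zero
    have "coord_mult n (Phi b m l p)
      = (\<lambda>x. of_real (exp (- (norm x)\<^sup>2 / 2) * laguerre l (b + lam TYPE('n) m) ((norm x)\<^sup>2)) * coord_mult n p x)"
      by (simp add: coord_mult_def Phi_def fun_eq_iff)
    then show ?thesis using up[OF zero(2)] by simp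
  next
    case (Suc j q r)
    obtain u v where uv: "u \<in> weight_space b (\<tau> + 1)" "v \<in> weight_space b (\<tau> - 1)"
      "(\<lambda>x. of_real (exp (- (norm x)\<^sup>2 / 2) * laguerre l (b + lam TYPE('n) m) ((norm x)\<^sup>2)) * q x) = (\<lambda>x. u x + v x)"
      using up[OF Suc(2)] by blast
    define c where "c = b + lam TYPE('n) j + real l + 1"
    have u': "(\<lambda>x. u x + (- of_nat (Suc l)) * Phi b j (Suc l) r x) \<in> weight_space b (\<tau> + 1)"
      using uv(1) Suc(3) by (intro weight_space.add_Phi) (auto simp: \<tau>_def tau_def lam_Suc Suc(1))
    have v': "(\<lambda>x. v x + of_real c * Phi b j l r x) \<in> weight_space b (\<tau> - 1)"
      using uv(2) Suc(3) by (intro weight_space.add_Phi) (auto simp: \<tau>_def tau_def lam_Suc Suc(1))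
    have "coord_mult n (Phi b m l p) x
        = (u x + (- of_nat (Suc l)) * Phi b j (Suc l) r x) + (v x + of_real c * Phi b j l r x)" for x
    proof -
      define g where "g = exp (- (norm x)\<^sup>2 / 2)"
      define t where "t = (norm x)\<^sup>2"
      have lag: "t * laguerre l (b + lam TYPE('n) m) t
          = c * laguerre l (b + lam TYPE('n) j) t - real (Suc l) * laguerre (Suc l) (b + lam TYPE('n) j) t"
        using laguerre_times_arg[OF nu[of j], of t l] by (simp add: Suc(1) lam_Suc c_def add_ac)
      have "coord_mult n (Phi b m l p) x = of_real (g * laguerre l (b + lam TYPE('n) m) t) * coord_mult n p x"
        by (simp add: coord_mult_def Phi_def g_def t_def)
      also have "coord_mult n p x = q x + of_real t * r x"
        using Suc(4) by (simp add: t_def)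
      also have "of_real (g * laguerre l (b + lam TYPE('n) m) t) * (q x + of_real t * r x)
          = of_real (g * laguerre l (b + lam TYPE('n) m) t) * q x
          + of_real (g * (t * laguerre l (b + lam TYPE('n) m) t)) * r x"
        by (simp add: algebra_simps)
      also have "of_real (g * laguerre l (b + lam TYPE('n) m) t) * q x = u x + v x"
        using fun_cong[OF uv(3), of x] by (simp add: g_def t_def)
      finally have eq: "coord_mult n (Phi b m l p) x
          = u x + v x + of_real (g * (t * laguerre l (b + lam TYPE('n) m) t)) * r x" .
      have P: "Phi b j i r x = of_real (g * laguerre i (b + lam TYPE('n) j) t) * r x" for i
        by (simp add: Phi_def g_def t_def)
      show ?thesis
        unfolding eq lag P by (simp add: algebra_simps)
    qed
    then have "coord_mult n (Phi b m l p) = (\<lambda>x. (u x + (- of_nat (Suc l)) * Phi b j (Suc l) r x)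
        + (v x + of_real c * Phi b j l r x))" by blast
    with u' v' show ?thesis by (intro bexI)
  qed
  then show ?thesis unfolding \<tau>_def .
qed

section \<open>Completeness of the functions \<open>\<Phi>\<close>\<close>

text \<open>The sets over which the integral vanishes form a Dynkin system; if it contains the open sets then it contains
all Borel sets, in particular the sets on which the real or imaginary part has a fixed sign.\<close>

lemma AE_zero_of_open_integrals:
  fixes \<phi> :: "'a::topological_space \<Rightarrow> complex"
  assumes M: "sets M = sets borel" and int: "integrable M \<phi>"
    and opens: "\<And>A. open A \<Longrightarrow> (LINT x:A|M. \<phi> x) = 0"
  shows "AE x in M. \<phi> x = 0"
proof -
  have sp: "space M = UNIV" using sets_eq_imp_space_eq[OF M] by simp
  have set_int: "set_integrable M A \<phi>" if "A \<in> sets M" for A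
    unfolding set_integrable_def using that int by (rule integrable_mult_indicator)
  have st: "Int_stable {A :: 'a set. open A}" and po: "{A :: 'a set. open A} \<subseteq> Pow UNIV"
    by (auto simp: Int_stable_def)
  have all: "(LINT x:A|M. \<phi> x) = 0" if "A \<in> sigma_sets UNIV {A. open A}" for A
    using st po that
  proof (induction A rule: sigma_sets_induct_disjoint)
    case (basic A) then show ?case using opens by simp
  next
    case empty show ?case by (simp add: set_lebesgue_integral_def)
  next
    case (compl A)
    then have A: "A \<in> sets M" "UNIV - A \<in> sets M" using M by (auto simp: sets_borel)
    have "(LINT x:A \<union> (UNIV - A)|M. \<phi> x) = (LINT x:A|M. \<phi> x) + (LINT x:UNIV - A|M. \<phi> x)"
      using A by (intro set_integral_Un set_int) auto
    moreover have "A \<union> (UNIV - A) = UNIV" by auto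
    ultimately show ?case using opens[of UNIV] compl by simp
  next
    case (union A)
    then have A: "A i \<in> sets M" for i using M by (auto simp: sets_borel)
    have "(LINT x:(\<Union>i. A i)|M. \<phi> x) = (\<Sum>i. (LINT x:(A i)|M. \<phi> x))"
      using union A by (intro lebesgue_integral_countable_add set_int) (auto simp: disjoint_family_on_def)
    then show ?case using union by simp
  qed
  have real_part: "AE x in M. u x \<le> 0"
    if u: "integrable M u" and 0: "\<And>A. A \<in> sets M \<Longrightarrow> (LINT x:A|M. u x) = 0" for u :: "'a \<Rightarrow> real"
  proof -
    have m: "u \<in> borel_measurable M" using u by simp
    have P: "{x. u x > 0} \<in> sets M"
      using measurable_sets[OF m, of "{0<..}"] sp by (simp add: vimage_def)
    have "integrable M (\<lambda>x. indicator {x. u x > 0} x *\<^sub>R u x)"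
      by (rule integrable_mult_indicator[OF P u])
    then have "AE x in M. indicator {x. u x > 0} x *\<^sub>R u x = 0"
      using 0[OF P] unfolding set_lebesgue_integral_def
      by (subst (asm) integral_nonneg_eq_0_iff_AE) (auto simp: indicator_def)
    then show ?thesis by (auto elim!: AE_mp simp: indicator_def)
  qed
  have sets: "A \<in> sigma_sets UNIV {A. open A}" if "A \<in> sets M" for A
    using that M by (simp add: sets_borel)
  have I: "integrable M (\<lambda>x. indicator A x *\<^sub>R \<phi> x)" if "A \<in> sets M" for A
    using set_int[OF that] by (simp add: set_integrable_def)
  have Re: "(LINT x:A|M. Re (\<phi> x)) = 0" and Im: "(LINT x:A|M. Im (\<phi> x)) = 0" if A: "A \<in> sets M" for A
    using all[OF sets[OF A]] integral_Re[OF I[OF A]] integral_Im[OF I[OF A]]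
    by (simp_all add: set_lebesgue_integral_def)
  have "AE x in M. Re (\<phi> x) \<le> 0" "AE x in M. - Re (\<phi> x) \<le> 0" "AE x in M. Im (\<phi> x) \<le> 0" "AE x in M. - Im (\<phi> x) \<le> 0"
    using int Re Im real_part[of "\<lambda>x. Re (\<phi> x)"] real_part[of "\<lambda>x. - Re (\<phi> x)"]
      real_part[of "\<lambda>x. Im (\<phi> x)"] real_part[of "\<lambda>x. - Im (\<phi> x)"]
    by (simp_all add: set_lebesgue_integral_def)
  then show ?thesis
    by eventually_elim (auto simp: complex_eq_iff)
qed

text \<open>Trigonometric polynomials, with real frequencies.\<close>

inductive trig :: "(real^'n::finite \<Rightarrow> complex) \<Rightarrow> bool" where
  base: "trig (\<lambda>x. c * exp (\<i> * of_real (\<xi> \<bullet> x)))"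
| add: "trig f \<Longrightarrow> trig g \<Longrightarrow> trig (\<lambda>x. f x + g x)"

lemma trig_mult:
  assumes "trig f" "trig g" shows "trig (\<lambda>x. f x * g x)"
  using assms
proof (induction arbitrary: g rule: trig.induct)
  case (base c \<xi> g)
  from base.prems show ?case
  proof (induction rule: trig.induct)
    case (base d \<eta>)
    have "(\<lambda>x. c * exp (\<i> * of_real (\<xi> \<bullet> x)) * (d * exp (\<i> * of_real (\<eta> \<bullet> x))))
        = (\<lambda>x. (c * d) * exp (\<i> * of_real ((\<xi> + \<eta>) \<bullet> x)))"
      by (simp add: inner_add_left exp_add algebra_simps fun_eq_iff)
    then show ?case by (simp only: trig.base)
  next
    case (add f g)
    show ?case
      unfolding distrib_left by (intro trig.add add.IH)
  qed
next
  case (add f g h)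
  show ?case
    unfolding distrib_right by (intro trig.add add.IH add.prems)
qed

lemma trig_const: "trig (\<lambda>x. c)"
  using trig.base[of c 0] by simp

lemma trig_sum: "(\<And>k. k \<in> A \<Longrightarrow> trig (f k)) \<Longrightarrow> trig (\<lambda>x. \<Sum>k\<in>A. f k x)"
  by (induction A rule: infinite_finite_induct) (simp_all add: trig_const trig.add)

lemma trig_sin: "trig (\<lambda>x :: real^'n::finite. of_real (sin (x $ k / s)))"
proof -
  have "(\<lambda>x :: real^'n. of_real (sin (x $ k / s))) =
      (\<lambda>x. (- \<i> / 2) * exp (\<i> * of_real (axis k (1 / s) \<bullet> x)) + (\<i> / 2) * exp (\<i> * of_real (axis k (- 1 / s) \<bullet> x)))"
    unfolding sin_of_real[symmetric] sin_exp_eq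
    by (auto simp: inner_axis' field_simps)
  then show ?thesis by (simp only:) (intro trig.intros)
qed

lemma trig_polynomial_sin:
  assumes "real_polynomial_function P"
  shows "trig (\<lambda>x :: real^'n::finite. of_real (P (\<chi> k. sin (x $ k / s))))"
  using assms
proof (induction rule: real_polynomial_function.induct)
  case (linear f)
  interpret bounded_linear f by fact
  have lin: "f y = (\<Sum>k\<in>UNIV. y $ k * f (axis k 1))" for y :: "real^'n"
  proof -
    have "f y = f (\<Sum>k\<in>UNIV. y $ k *\<^sub>R axis k 1)"
      using basis_expansion[of y] by (simp add: scalar_mult_eq_scaleR)
    then show ?thesis by (simp add: sum scaleR)
  qed
  have "(\<lambda>x :: real^'n. complex_of_real (f (\<chi> k. sin (x $ k / s))))
      = (\<lambda>x. \<Sum>k\<in>UNIV. of_real (sin (x $ k / s)) * of_real (f (axis k 1)))"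
    by (rule ext, subst lin) simp
  then show ?case by (simp only:) (intro trig_sum trig_mult trig_sin trig_const)
qed (simp_all add: trig_const trig.add trig_mult)

lemma trig_measurable: "trig f \<Longrightarrow> f \<in> borel_measurable borel"
  by (induction rule: trig.induct) auto

lemma trig_bounded: "trig f \<Longrightarrow> \<exists>C. \<forall>x. norm (f x) \<le> C"
proof (induction rule: trig.induct)
  case (base c \<xi>)
  show ?case by (intro exI[of _ "norm c"]) (simp add: norm_mult)
next
  case (add f g)
  then obtain C D where "\<And>x. norm (f x) \<le> C" "\<And>x. norm (g x) \<le> D" by blast
  then show ?case by (intro exI[of _ "C + D"]) (meson add_mono norm_triangle_ineq order_trans)
qed

lemma bounded_mult_integrable:
  fixes \<phi> f :: "'a \<Rightarrow> complex"
  assumes "integrable M \<phi>" "f \<in> borel_measurable M" "\<And>x. norm (f x) \<le> C"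
  shows "integrable M (\<lambda>x. \<phi> x * f x)"
proof (rule Bochner_Integration.integrable_bound)
  show "integrable M (\<lambda>x. C * norm (\<phi> x))" using assms(1) by simp
  show "(\<lambda>x. \<phi> x * f x) \<in> borel_measurable M" using assms by measurable
  have "norm (\<phi> x * f x) \<le> C * norm (\<phi> x)" for x
    using mult_right_mono[OF assms(3)[of x], of "norm (\<phi> x)"] by (simp add: norm_mult mult.commute)
  then show "AE x in M. norm (\<phi> x * f x) \<le> norm (C * norm (\<phi> x))"
    by (auto intro!: AE_I2 order.trans[OF _ abs_ge_self])
qed

text \<open>An integrable function is determined by its integrals against characters.  On a large box a
  continuous function of \<open>x\<close> is a continuous function of the numbers \<open>sin (x\<^sub>k / s)\<close>, which
  Stone-Weierstrass approximates by a polynomial in them, that is, by a trigonometric polynomial.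
  In contrast to an approximation by polynomials in \<open>x\<close> it stays bounded on the whole space, so
  that the integrals converge.\<close>

lemma AE_zero_of_Fourier_zero:
  fixes \<phi> :: "real^'n::finite \<Rightarrow> complex"
  assumes M: "sets M = sets borel" and int: "integrable M \<phi>"
    and char: "\<And>\<xi>. (LINT x|M. \<phi> x * exp (\<i> * of_real (\<xi> \<bullet> x))) = 0"
  shows "AE x in M. \<phi> x = 0"
proof (rule AE_zero_of_open_integrals[OF M int])
  note [measurable_cong] = M
  note [measurable] = borel_measurable_integrable[OF int]
  have I: "integrable M (\<lambda>x. \<phi> x * f x)" if f: "trig f" for f
  proof -
    have "f \<in> borel_measurable M"
      using trig_measurable[OF f] by measurable
    moreover obtain C where "\<And>x. norm (f x) \<le> C"
      using trig_bounded[OF f] by blast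
    ultimately show ?thesis using int bounded_mult_integrable by blast
  qed
  have T: "(LINT x|M. \<phi> x * f x) = 0" if "trig f" for f
    using that
  proof (induction rule: trig.induct)
    case (base c \<xi>)
    have "(LINT x|M. \<phi> x * (c * exp (\<i> * of_real (\<xi> \<bullet> x)))) = (LINT x|M. c * (\<phi> x * exp (\<i> * of_real (\<xi> \<bullet> x))))"
      by (simp add: mult_ac)
    then show ?case by (simp add: char)
  next
    case (add f g)
    then show ?case using I by (simp add: distrib_left)
  qed
  have cont: "(LINT x|M. \<phi> x * of_real (G x)) = 0"
    if G: "continuous_on UNIV G" and G1: "\<And>x. \<bar>G x\<bar> \<le> 1" for G :: "real^'n \<Rightarrow> real"
  proof -
    (* arcsin recovers the coordinates x $ k from the sines as soon as norm x is at most m + 1 *)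
    have "\<exists>P. real_polynomial_function P \<and>
        (\<forall>y\<in>cbox (- 1) 1. \<bar>G (\<chi> k. real (Suc m) * arcsin (y $ k)) - P y\<bar> < 1 / real (Suc m))" for m
    proof -
      have "continuous_on (cbox (- 1) 1) (\<lambda>y :: real^'n. \<chi> k. real (Suc m) * arcsin (y $ k))"
        by (intro continuous_intros) (auto simp: mem_box_cart)
      then have "continuous_on (cbox (- 1) 1) (\<lambda>y :: real^'n. G (\<chi> k. real (Suc m) * arcsin (y $ k)))"
        by (rule continuous_on_compose2[OF G]) auto
      moreover have "0 < 1 / real (Suc m)" by simp
      ultimately obtain P where "real_polynomial_function P"
        "\<And>y. y \<in> cbox (- 1) 1 \<Longrightarrow> \<bar>G (\<chi> k. real (Suc m) * arcsin (y $ k)) - P y\<bar> < 1 / real (Suc m)"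
        using Stone_Weierstrass_real_polynomial_function[OF compact_cbox] by blast
      then show ?thesis by blast
    qed
    then obtain P where P: "\<And>m. real_polynomial_function (P m)"
      "\<And>m y. y \<in> cbox (- 1) 1 \<Longrightarrow> \<bar>G (\<chi> k. real (Suc m) * arcsin (y $ k)) - P m y\<bar> < 1 / real (Suc m)"
      by metis
    define F where "F m x = P m (\<chi> k. sin (x $ k / real (Suc m)))" for m and x :: "real^'n"
    have box: "(\<chi> k. sin (x $ k / real (Suc m))) \<in> cbox (- 1) (1 :: real^'n)" for m x
      by (auto simp: mem_box_cart)
    have trigF: "trig (\<lambda>x. of_real (F m x))" for m
      unfolding F_def using P(1) by (rule trig_polynomial_sin)
    have "(\<lambda>m. LINT x|M. \<phi> x * of_real (F m x)) \<longlonglongrightarrow> (LINT x|M. \<phi> x * of_real (G x))"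
    proof (rule integral_dominated_convergence[where w = "\<lambda>x. 2 * norm (\<phi> x)"])
      have "G \<in> borel_measurable borel" using G by (rule borel_measurable_continuous_onI)
      then show "(\<lambda>x. \<phi> x * of_real (G x)) \<in> borel_measurable M" by measurable
      show "(\<lambda>x. \<phi> x * of_real (F m x)) \<in> borel_measurable M" for m
        using I[OF trigF] by (rule borel_measurable_integrable)
      show "integrable M (\<lambda>x. 2 * norm (\<phi> x))" using int by simp
      show "AE x in M. (\<lambda>m. \<phi> x * of_real (F m x)) \<longlonglongrightarrow> \<phi> x * of_real (G x)"
      proof (rule AE_I2, intro tendsto_mult tendsto_const tendsto_of_real)
        fix x :: "real^'n"
        have ev: "\<forall>\<^sub>F m in sequentially. norm (F m x - G x) \<le> 1 / real (Suc m)"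
        proof (rule eventually_sequentiallyI)
          fix m assume m: "nat \<lceil>norm x\<rceil> \<le> m"
          have "(\<chi> k. real (Suc m) * arcsin (sin (x $ k / real (Suc m)))) = x"
          proof -
            have "arcsin (sin (x $ k / real (Suc m))) = x $ k / real (Suc m)" for k
            proof -
              have "\<bar>x $ k\<bar> \<le> norm x" by (rule component_le_norm_cart)
              also have "\<dots> \<le> real (Suc m)" using m by linarith
              finally have "\<bar>x $ k / real (Suc m)\<bar> \<le> 1" by simp
              then show ?thesis using pi_gt3 by (intro arcsin_sin) (simp_all only: abs_le_iff, linarith+)
            qed
            then show ?thesis by (simp add: vec_eq_iff del: of_nat_Suc)
          qed
          then show "norm (F m x - G x) \<le> 1 / real (Suc m)"
            using P(2)[OF box[of x m], of m] by (simp add: F_def abs_minus_commute del: of_nat_Suc)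
        qed
        have "(\<lambda>m. F m x - G x) \<longlonglongrightarrow> 0"
          by (rule Lim_null_comparison[OF ev]) (rule lim_1_over_n[THEN LIMSEQ_Suc])
        then show "(\<lambda>m. F m x) \<longlonglongrightarrow> G x" by (simp add: LIM_zero_iff)
      qed
      show "AE x in M. norm (\<phi> x * of_real (F m x)) \<le> 2 * norm (\<phi> x)" for m
      proof (rule AE_I2)
        fix x
        have "\<bar>F m x\<bar> \<le> 1 + 1 / real (Suc m)"
          using P(2)[OF box[of x m], of m] G1[of "\<chi> k. real (Suc m) * arcsin (sin (x $ k / real (Suc m)))"]
          by (simp add: F_def del: of_nat_Suc)
        also have "\<dots> \<le> 2" by simp
        finally show "norm (\<phi> x * of_real (F m x)) \<le> 2 * norm (\<phi> x)"
          using mult_right_mono[of "\<bar>F m x\<bar>" 2 "norm (\<phi> x)"] by (simp add: norm_mult mult.commute)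
      qed
    qed
    then have "(\<lambda>m. 0) \<longlonglongrightarrow> (LINT x|M. \<phi> x * of_real (G x))"
      using T[OF trigF] by simp
    then show ?thesis by (metis LIMSEQ_unique tendsto_const)
  qed
  fix A :: "(real^'n) set" assume A: "open A"
  show "(LINT x:A|M. \<phi> x) = 0"
  proof (cases "A = UNIV")
    case True
    then show ?thesis using cont[of "\<lambda>_. 1"] by (simp add: set_lebesgue_integral_def)
  next
    case False
    then have ne: "- A \<noteq> {}" by auto
    (* continuous functions increasing to the indicator of A *)
    define G where "G m x = min 1 (real m * infdist x (- A))" for m x
    have G: "continuous_on UNIV (G m)" and G1: "\<bar>G m x\<bar> \<le> 1" for m x
      unfolding G_def by (intro continuous_intros) (auto simp: infdist_nonneg abs_le_iff intro: order.trans[of _ 0])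
    have "(\<lambda>m. LINT x|M. \<phi> x * of_real (G m x)) \<longlonglongrightarrow> (LINT x|M. indicator A x *\<^sub>R \<phi> x)"
    proof (rule integral_dominated_convergence[where w = "\<lambda>x. norm (\<phi> x)"])
      have "A \<in> sets M" using A M by simp
      then show "(\<lambda>x. indicator A x *\<^sub>R \<phi> x) \<in> borel_measurable M"
        using borel_measurable_integrable[OF int] by (intro borel_measurable_scaleR borel_measurable_indicator)
      have "G m \<in> borel_measurable borel" for m using G by (rule borel_measurable_continuous_onI)
      then show "(\<lambda>x. \<phi> x * of_real (G m x)) \<in> borel_measurable M" for m by measurable
      show "integrable M (\<lambda>x. norm (\<phi> x))" using int by simp
      show "AE x in M. norm (\<phi> x * of_real (G m x)) \<le> norm (\<phi> x)" for m
        using G1 by (auto intro!: AE_I2 simp: norm_mult mult_left_le)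
      show "AE x in M. (\<lambda>m. \<phi> x * of_real (G m x)) \<longlonglongrightarrow> indicator A x *\<^sub>R \<phi> x"
      proof (rule AE_I2)
        fix x
        have "(\<lambda>m. G m x) \<longlonglongrightarrow> indicator A x"
        proof (cases "x \<in> A")
          case False
          then have "G m x = 0" for m by (simp add: G_def)
          then show ?thesis using False by simp
        next
          case True
          have "infdist x (- A) > 0"
            using in_closed_iff_infdist_zero[of "- A" x] A ne True infdist_nonneg[of x "- A"]
            by (auto simp: less_le)
          then obtain m0 :: nat where m0: "1 / infdist x (- A) \<le> real m0" "infdist x (- A) > 0"
            using real_arch_simple by blast
          have "\<forall>\<^sub>F m in sequentially. G m x = 1"
          proof (rule eventually_sequentiallyI)
            fix m assume "m0 \<le> m"
            then have "1 / infdist x (- A) \<le> real m" using m0 by linarith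
            then show "G m x = 1" using m0(2) by (simp add: G_def field_simps)
          qed
          then show ?thesis using True by (simp add: tendsto_eventually)
        qed
        then have "(\<lambda>m. \<phi> x * of_real (G m x)) \<longlonglongrightarrow> \<phi> x * of_real (indicator A x)"
          by (intro tendsto_intros)
        then show "(\<lambda>m. \<phi> x * of_real (G m x)) \<longlonglongrightarrow> indicator A x *\<^sub>R \<phi> x"
          by (simp add: scaleR_conv_of_real mult.commute)
      qed
    qed
    then have "(\<lambda>m. 0) \<longlonglongrightarrow> (LINT x|M. indicator A x *\<^sub>R \<phi> x)"
      using cont[OF G G1] by simp
    then show ?thesis unfolding set_lebesgue_integral_def by (metis LIMSEQ_unique tendsto_const)
  qed
qed

definition gauss :: "real^'n::finite \<Rightarrow> complex" where
  "gauss x = of_real (exp (- (norm x)\<^sup>2 / 2))"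

inductive_set Phi_span :: "real \<Rightarrow> (real^'n::finite \<Rightarrow> complex) set" for b where
  zero: "(\<lambda>x. 0) \<in> Phi_span b"
| add_Phi: "u \<in> Phi_span b \<Longrightarrow> p \<in> harmonic_poly m \<Longrightarrow> (\<lambda>x. u x + c * Phi b m l p x) \<in> Phi_span b"

lemma weight_space_subset: "u \<in> weight_space b \<tau> \<Longrightarrow> u \<in> Phi_span b"
  by (induction rule: weight_space.induct) (auto intro: Phi_span.intros)

lemma Phi_span_add:
  assumes "u \<in> Phi_span b" "v \<in> Phi_span b"
  shows "(\<lambda>x. u x + v x) \<in> Phi_span b"
  using assms(2)
proof (induction rule: Phi_span.induct)
  case (add_Phi v p m c l)
  then show ?case using Phi_span.add_Phi[OF add_Phi.IH add_Phi.hyps(2), of c] by (simp add: add.assoc)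
qed (use assms(1) in simp)

lemma Phi_span_scale:
  assumes "u \<in> Phi_span b"
  shows "(\<lambda>x. c * u x) \<in> Phi_span b"
  using assms
proof (induction rule: Phi_span.induct)
  case (add_Phi v p m d l)
  then show ?case using Phi_span.add_Phi[OF add_Phi.IH add_Phi.hyps(2), of "c * d"] by (simp add: algebra_simps)
qed (simp add: Phi_span.zero)

lemma Phi_span_sum:
  "(\<And>k. k \<in> A \<Longrightarrow> f k \<in> Phi_span b) \<Longrightarrow> (\<lambda>x. \<Sum>k\<in>A. f k x) \<in> Phi_span b"
  by (induction A rule: infinite_finite_induct) (auto intro: Phi_span.zero Phi_span_add)

lemma Phi_span_coord_mult:
  fixes u :: "real^'n::finite \<Rightarrow> complex"
  assumes b: "b > - real CARD('n) / 2" and "u \<in> Phi_span b"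
  shows "coord_mult n u \<in> Phi_span b"
  using assms(2)
proof (induction rule: Phi_span.induct)
  case zero
  then show ?case using Phi_span.zero by (simp add: coord_mult_def[abs_def])
next
  case (add_Phi u p m c l)
  obtain v w where "v \<in> weight_space b (tau TYPE('n) b m l + 1)" "w \<in> weight_space b (tau TYPE('n) b m l - 1)"
      "coord_mult n (Phi b m l p) = (\<lambda>x. v x + w x)"
    using coord_mult_Phi[OF b add_Phi.hyps(2)] by blast
  then have "coord_mult n (Phi b m l p) \<in> Phi_span b"
    using Phi_span_add weight_space_subset by metis
  from Phi_span_add[OF add_Phi.IH Phi_span_scale[OF this, of c]] show ?case
    by (simp add: coord_mult_def[abs_def] algebra_simps)
qed

lemma gauss_in_Phi_span:
  assumes b: "b > - real CARD('n::finite) / 2"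
  shows "(gauss :: real^'n \<Rightarrow> complex) \<in> Phi_span b"
proof -
  have "hom_span 0 (\<lambda>x :: real^'n. 1 :: complex)" by (rule hom_span.const)
  then have "(\<lambda>x :: real^'n. 1 :: complex) \<in> harmonic_poly 0"
    by (simp add: harmonic_poly_def homogeneous_poly_eq laplacian_def pdiff_const)
  from Phi_span.add_Phi[where b = b and c = 1 and l = 0, OF Phi_span.zero this]
  have "Phi b 0 0 (\<lambda>x :: real^'n. 1) \<in> Phi_span b" by simp
  moreover have "b + lam TYPE('n) 0 > - 1" using b by (simp add: lam_def field_simps)
  then have "Phi b 0 0 (\<lambda>x. 1) = (gauss :: real^'n \<Rightarrow> complex)"
    by (auto simp: Phi_def gauss_def laguerre_0)
  ultimately show ?thesis by simp
qed

text \<open>The factors \<open>\<xi> \<bullet> x\<close> are linear combinations of coordinates, under which the span is stable.\<close>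

lemma Phi_span_inner_power:
  fixes \<xi> :: "real^'n::finite"
  assumes b: "b > - real CARD('n) / 2"
  shows "(\<lambda>x. of_real (\<xi> \<bullet> x) ^ k * gauss x) \<in> Phi_span b"
proof (induction k)
  case 0
  then show ?case using gauss_in_Phi_span[OF b] by simp
next
  case (Suc k)
  let ?u = "\<lambda>x. of_real (\<xi> \<bullet> x) ^ k * gauss x"
  have "(\<lambda>x. of_real (\<xi> \<bullet> x) ^ Suc k * gauss x) = (\<lambda>x. \<Sum>n\<in>UNIV. of_real (\<xi> $ n) * coord_mult n ?u x)"
  proof
    fix x
    have "of_real (\<xi> \<bullet> x) ^ Suc k * gauss x = (\<Sum>n\<in>UNIV. of_real (\<xi> $ n) * of_real (x $ n)) * ?u x"
      by (simp add: inner_vec_def)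
    then show "of_real (\<xi> \<bullet> x) ^ Suc k * gauss x = (\<Sum>n\<in>UNIV. of_real (\<xi> $ n) * coord_mult n ?u x)"
      by (simp only: sum_distrib_right coord_mult_def mult.assoc)
  qed
  then show ?case
    by (simp only:) (intro Phi_span_sum Phi_span_scale Phi_span_coord_mult[OF b] Suc)
qed

lemma power_le_fact_exp: "(r :: real) \<ge> 0 \<Longrightarrow> r ^ j \<le> fact j * exp r"
  using sum_le_suminf[OF summable_exp[of r], of "{j}"] by (simp add: exp_def field_simps scaleR_conv_of_real)

text \<open>Majorants for the exponential series in \<open>orthogonal_Phi_imp_zero\<close>.  Powers of \<open>1 + |x|\<close> are bounded by
\<open>exp |x|\<close>, and completing the square shows that the Gaussian outweighs \<open>exp ((c + 1) |x|)\<close>.\<close>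

lemma gauss_exp_in_L2:
  assumes b: "b > - real CARD('n::finite) / 2"
  shows "(\<lambda>x :: real^'n. gauss x * of_real (exp (c * norm x))) \<in> L2 b"
proof (rule L2_of_rapid_decay[OF b])
  show "(\<lambda>x :: real^'n. gauss x * of_real (exp (c * norm x))) \<in> borel_measurable borel"
    unfolding gauss_def by measurable
  fix j :: nat
  have "(1 + norm x) ^ j * norm (gauss x * of_real (exp (c * norm x))) \<le> fact j * exp (1 + (c + 1)\<^sup>2 / 2)" for x :: "real^'n"
  proof -
    have "(1 + norm x) ^ j * norm (gauss x * of_real (exp (c * norm x)))
        \<le> fact j * exp (1 + norm x) * (exp (- (norm x)\<^sup>2 / 2) * exp (c * norm x))"
      unfolding gauss_def norm_mult by (intro mult_mono power_le_fact_exp) auto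
    also have "\<dots> = fact j * exp (1 + norm x + (- (norm x)\<^sup>2 / 2 + c * norm x))"
      by (simp only: exp_add mult.assoc)
    also have "1 + norm x + (- (norm x)\<^sup>2 / 2 + c * norm x) \<le> 1 + (c + 1)\<^sup>2 / 2"
      using zero_le_power2[of "norm x - (c + 1)"] by (simp add: power2_eq_square field_simps)
    finally show ?thesis by simp
  qed
  then show "\<exists>C. \<forall>x :: real^'n. (1 + norm x) ^ j * norm (gauss x * of_real (exp (c * norm x))) \<le> C" by blast
qed

lemma L2_inner_Phi_span_zero:
  fixes h :: "real^'n::finite \<Rightarrow> complex"
  assumes Phi: "\<And>m l (p :: real^'n \<Rightarrow> complex). p \<in> harmonic_poly m \<Longrightarrow> Phi b m l p \<in> L2 b"
    and h: "h \<in> L2 b" and 0: "\<And>m l p. p \<in> harmonic_poly m \<Longrightarrow> L2_inner b h (Phi b m l p) = 0"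
    and u: "u \<in> Phi_span b"
  shows "u \<in> L2 b \<and> L2_inner b h u = 0"
  using u
proof (induction rule: Phi_span.induct)
  case zero
  then show ?case by (simp add: L2_inner_def)
next
  case (add_Phi u p m c l)
  then show ?case
    using Phi[OF add_Phi.hyps(2)] 0[OF add_Phi.hyps(2)] h
    by (auto simp: L2_inner_add_right L2_inner_scale_right L2_scale)
qed

text \<open>The span of the \<open>\<Phi>\<close> contains the Gaussian and is stable under the coordinates, hence contains
  the products of polynomials and the Gaussian.  Summing exponential series, a function orthogonal
  to the span is orthogonal to all characters times the Gaussian.\<close>

lemma orthogonal_Phi_imp_zero:
  fixes h :: "real^'n::finite \<Rightarrow> complex"
  assumes b: "b > - real CARD('n) / 2"
    and Phi: "\<And>m l (p :: real^'n \<Rightarrow> complex). p \<in> harmonic_poly m \<Longrightarrow> Phi b m l p \<in> L2 b"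
    and h: "h \<in> L2 b" and 0: "\<And>m l p. p \<in> harmonic_poly m \<Longrightarrow> L2_inner b h (Phi b m l p) = 0"
  shows "L2_eq b h (\<lambda>x. 0)"
proof -
  note [measurable] = L2_measurable[OF h]
  have g: "(gauss :: real^'n \<Rightarrow> complex) \<in> L2 b"
    using L2_inner_Phi_span_zero[OF Phi h 0 gauss_in_Phi_span[OF b]] by blast
  note [measurable] = L2_measurable[OF g]
  have "AE x in weight b. h x * gauss x = 0"
  proof (rule AE_zero_of_Fourier_zero)
    show int: "integrable (weight b) (\<lambda>x. h x * gauss x)"
      using h g by (rule L2_integrable_mult)
    fix \<xi> :: "real^'n"
    define z where "z x = \<i> * complex_of_real (\<xi> \<bullet> x)" for x
    have nz: "norm (z x) \<le> norm \<xi> * norm x" for x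
      unfolding z_def norm_mult norm_of_real using Cauchy_Schwarz_ineq2[of \<xi> x] by simp
    let ?s = "\<lambda>m x. \<Sum>k<m. z x ^ k /\<^sub>R fact k"
    let ?W = "\<lambda>x. gauss x * of_real (exp (norm \<xi> * norm x))"
    have term0: "integrable (weight b) (\<lambda>x. h x * gauss x * (z x ^ k /\<^sub>R fact k))
        \<and> (LINT x|weight b. h x * gauss x * (z x ^ k /\<^sub>R fact k)) = 0" for k
    proof -
      let ?u = "\<lambda>x. of_real (\<xi> \<bullet> x) ^ k * gauss x"
      have u: "?u \<in> L2 b" "L2_inner b h ?u = 0"
        using L2_inner_Phi_span_zero[OF Phi h 0 Phi_span_inner_power[OF b, of \<xi> k]] by blast+
      have "cnj (gauss x) = gauss x" for x :: "real^'n" by (simp add: gauss_def)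
      then have "(LINT x|weight b. h x * ?u x) = 0"
        using u(2) by (simp add: L2_inner_def)
      moreover have "integrable (weight b) (\<lambda>x. h x * ?u x)"
        using h u(1) by (rule L2_integrable_mult)
      moreover have "h x * gauss x * (z x ^ k /\<^sub>R fact k) = (\<i> ^ k / fact k) * (h x * ?u x)" for x
        by (simp add: z_def power_mult_distrib scaleR_conv_of_real field_simps)
      ultimately show ?thesis by simp
    qed
    have "(\<lambda>m. LINT x|weight b. h x * gauss x * ?s m x) \<longlonglongrightarrow> (LINT x|weight b. h x * gauss x * exp (z x))"
    proof (rule integral_dominated_convergence[where w = "\<lambda>x. norm (h x * ?W x)"])
      show "(\<lambda>x. h x * gauss x * exp (z x)) \<in> borel_measurable (weight b)"
        "(\<lambda>x. h x * gauss x * ?s m x) \<in> borel_measurable (weight b)" for m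
        unfolding z_def by measurable
      show "integrable (weight b) (\<lambda>x. norm (h x * ?W x))"
        using L2_integrable_mult[OF h gauss_exp_in_L2[OF b]] by (rule integrable_norm)
      show "AE x in weight b. (\<lambda>m. h x * gauss x * ?s m x) \<longlonglongrightarrow> h x * gauss x * exp (z x)"
        using exp_converges unfolding sums_def by (intro AE_I2 tendsto_mult tendsto_const)
      show "AE x in weight b. norm (h x * gauss x * ?s m x) \<le> norm (h x * ?W x)" for m
      proof (rule AE_I2)
        fix x
        have "norm (?s m x) \<le> (\<Sum>k<m. norm (z x) ^ k /\<^sub>R fact k)"
          by (rule order.trans[OF norm_sum]) (simp add: norm_power)
        also have "\<dots> \<le> (\<Sum>k. norm (z x) ^ k /\<^sub>R fact k)"
          by (intro sum_le_suminf summable_exp_generic) auto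
        also have "\<dots> = exp (norm (z x))" by (simp add: exp_def)
        also have "\<dots> \<le> exp (norm \<xi> * norm x)" using nz by simp
        finally have "norm (h x * gauss x) * norm (?s m x) \<le> norm (h x * gauss x) * exp (norm \<xi> * norm x)"
          by (intro mult_left_mono) auto
        then show "norm (h x * gauss x * ?s m x) \<le> norm (h x * ?W x)"
          by (simp add: norm_mult mult.assoc)
      qed
    qed
    moreover have "(LINT x|weight b. h x * gauss x * ?s m x) = 0" for m
      using term0 by (simp add: sum_distrib_left)
    ultimately have "(\<lambda>m. 0) \<longlonglongrightarrow> (LINT x|weight b. h x * gauss x * exp (z x))" by simp
    then show "(LINT x|weight b. h x * gauss x * exp (\<i> * of_real (\<xi> \<bullet> x))) = 0"
      unfolding z_def by (metis LIMSEQ_unique tendsto_const)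
  qed simp
  then show ?thesis
    unfolding L2_eq_def by (auto simp: gauss_def elim!: AE_mp)
qed

section \<open>The representation and its differential\<close>

lemma exp_difference_quotient:
  fixes c :: complex
  shows "((\<lambda>t. (exp (c * of_real t) - 1) / of_real t) \<longlongrightarrow> c) (at (0::real))"
proof -
  have "((\<lambda>z. exp (c * z)) has_field_derivative c) (at 0)"
    by (auto intro!: derivative_eq_intros)
  then have "((\<lambda>z. (exp (c * z) - 1) / z) \<longlongrightarrow> c) (at 0)"
    unfolding has_field_derivative_iff by simp
  moreover have "filterlim (of_real :: real \<Rightarrow> complex) (at 0) (at 0)"
    by (auto simp: filterlim_at eventually_at_filter intro!: tendsto_eq_intros)
  ultimately show ?thesis by (rule filterlim_compose)
qed

lemma trace_conjugate:
  fixes P Q X :: "real^2^2"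
  assumes "P ** Q = mat 1" "trace X = 0"
  shows "trace (Q ** X ** P) = 0"
proof -
  have "trace (Q ** X ** P) = trace (P ** (Q ** X))" by (rule trace_mul_sym)
  also have "P ** (Q ** X) = X" using assms(1) by (simp add: matrix_mul_assoc)
  finally show ?thesis using assms(2) by simp
qed

locale Omega_rep = SL2_cover G \<pi>
  for G :: "('g::topological_space) monoid" (structure) and \<pi> :: "'g \<Rightarrow> real^2^2" +
  fixes b :: real and \<Omega> :: "'g \<Rightarrow> (real^'n::finite \<Rightarrow> complex) \<Rightarrow> real^'n \<Rightarrow> complex"
  assumes b: "b > - real CARD('n) / 2"
    and Omega: "is_Omega_b b G \<pi> \<Omega>"
    and smooth: "smooth_vectors b G \<pi> \<Omega> = {u \<in> L2 b. \<exists>f\<in>schwartz. L2_eq b u f}"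
begin

lemma unitary_rep: "unitary_rep b G \<Omega>"
  using Omega unfolding is_Omega_b_def by blast

lemma unitary: "g \<in> carrier G \<Longrightarrow> L2_unitary b (\<Omega> g)"
  using unitary_rep unfolding unitary_rep_def by blast

lemma Omega_L2: "g \<in> carrier G \<Longrightarrow> f \<in> L2 b \<Longrightarrow> \<Omega> g f \<in> L2 b"
  using unitary unfolding L2_unitary_def by blast

lemma Omega_lin:
  "g \<in> carrier G \<Longrightarrow> f \<in> L2 b \<Longrightarrow> h \<in> L2 b \<Longrightarrow>
    L2_eq b (\<Omega> g (\<lambda>x. c * f x + d * h x)) (\<lambda>x. c * \<Omega> g f x + d * \<Omega> g h x)"
  using unitary unfolding L2_unitary_def by blast

lemma Omega_inner:
  "g \<in> carrier G \<Longrightarrow> f \<in> L2 b \<Longrightarrow> h \<in> L2 b \<Longrightarrow> L2_inner b (\<Omega> g f) (\<Omega> g h) = L2_inner b f h"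
  using unitary unfolding L2_unitary_def by blast

lemma Omega_mult:
  "g \<in> carrier G \<Longrightarrow> h \<in> carrier G \<Longrightarrow> f \<in> L2 b \<Longrightarrow> L2_eq b (\<Omega> (g \<otimes> h) f) (\<Omega> g (\<Omega> h f))"
  using unitary_rep unfolding unitary_rep_def by blast

lemma Omega_diff:
  "g \<in> carrier G \<Longrightarrow> f \<in> L2 b \<Longrightarrow> h \<in> L2 b \<Longrightarrow>
    L2_eq b (\<Omega> g (\<lambda>x. f x - h x)) (\<lambda>x. \<Omega> g f x - \<Omega> g h x)"
  using Omega_lin[of g f h 1 "- 1"] by simp

lemma Omega_scale:
  "g \<in> carrier G \<Longrightarrow> f \<in> L2 b \<Longrightarrow> L2_eq b (\<Omega> g (\<lambda>x. c * f x)) (\<lambda>x. c * \<Omega> g f x)"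
  using Omega_lin[of g f f c 0] by simp

lemma Omega_norm:
  assumes "g \<in> carrier G" "f \<in> L2 b"
  shows "L2_norm b (\<Omega> g f) = L2_norm b f"
proof -
  have "complex_of_real ((L2_norm b (\<Omega> g f))\<^sup>2) = of_real ((L2_norm b f)\<^sup>2)"
    unfolding L2_inner_self[symmetric] using Omega_inner assms by blast
  then show ?thesis
    unfolding of_real_eq_iff by (rule power2_eq_imp_eq) auto
qed

lemma Omega_norm_diff:
  assumes "g \<in> carrier G" "f \<in> L2 b" "h \<in> L2 b"
  shows "L2_norm b (\<lambda>x. \<Omega> g f x - \<Omega> g h x) = L2_norm b (\<lambda>x. f x - h x)"
proof -
  have "L2_norm b (\<lambda>x. \<Omega> g f x - \<Omega> g h x) = L2_norm b (\<Omega> g (\<lambda>x. f x - h x))"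
    using assms by (intro L2_norm_cong L2_diff Omega_L2 L2_eq_sym[OF Omega_diff])
  then show ?thesis using Omega_norm assms by (simp add: L2_diff)
qed

lemma Omega_cong:
  assumes "g \<in> carrier G" "f \<in> L2 b" "h \<in> L2 b" "L2_eq b f h"
  shows "L2_eq b (\<Omega> g f) (\<Omega> g h)"
  using assms Omega_norm_diff[OF assms(1-3)] L2_norm_diff_0_iff[of f b h]
    L2_norm_diff_0_iff[of "\<Omega> g f" b "\<Omega> g h"] by (simp add: Omega_L2)

text \<open>The unit acts as an idempotent isometry, hence trivially.\<close>

lemma Omega_one:
  assumes "f \<in> L2 b"
  shows "L2_eq b (\<Omega> \<one> f) f"
proof -
  have "L2_eq b (\<Omega> \<one> (\<Omega> \<one> f)) (\<Omega> \<one> f)"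
    using Omega_mult[of "\<one>" "\<one>" f] assms L2_eq_sym by simp
  then have "L2_norm b (\<lambda>x. \<Omega> \<one> f x - f x) = 0"
    using Omega_norm_diff[of "\<one>" "\<Omega> \<one> f" f] assms
      L2_norm_diff_0_iff[of "\<Omega> \<one> (\<Omega> \<one> f)" b "\<Omega> \<one> f"] by (simp add: Omega_L2)
  then show ?thesis using L2_norm_diff_0_iff[of "\<Omega> \<one> f" b f] assms by (simp add: Omega_L2)
qed

lemma Omega_Omega_inv:
  assumes "g \<in> carrier G" "f \<in> L2 b"
  shows "L2_eq b (\<Omega> g (\<Omega> (inv\<^bsub>G\<^esub> g) f)) f"
  using L2_eq_trans[OF L2_eq_sym[OF Omega_mult[of g "inv\<^bsub>G\<^esub> g" f]]] Omega_one[OF assms(2)] assms by simp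

lemma Omega_adjoint:
  assumes "g \<in> carrier G" "f \<in> L2 b" "h \<in> L2 b"
  shows "L2_inner b (\<Omega> g f) h = L2_inner b f (\<Omega> (inv\<^bsub>G\<^esub> g) h)"
proof -
  have "L2_inner b (\<Omega> g f) h = L2_inner b (\<Omega> g f) (\<Omega> g (\<Omega> (inv\<^bsub>G\<^esub> g) h))"
    using assms by (intro L2_inner_cong Omega_L2 L2_eq_refl L2_eq_sym[OF Omega_Omega_inv]) auto
  then show ?thesis using assms by (simp add: Omega_inner Omega_L2)
qed

lemma Omega_strongly_continuous:
  assumes f: "f \<in> L2 b" and g: "g \<in> carrier G" and c: "(c \<longlongrightarrow> g) F" "\<forall>\<^sub>F t in F. c t \<in> carrier G"
  shows "L2_tendsto b (\<lambda>t. \<Omega> (c t) f) (\<Omega> g f) F"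
  unfolding L2_tendsto_def
proof (intro conjI)
  show "\<Omega> g f \<in> L2 b" using f g by (rule Omega_L2[rotated])
  show "\<forall>\<^sub>F t in F. \<Omega> (c t) f \<in> L2 b" using c(2) by eventually_elim (rule Omega_L2[OF _ f])
  define N where "N h = L2_norm b (\<lambda>x. \<Omega> h f x - \<Omega> g f x)" for h
  have N: "(N \<longlongrightarrow> 0) (at g within carrier G)" and N0: "N g = 0"
    using unitary_rep f g unfolding unitary_rep_def N_def by auto
  have "((\<lambda>t. N (c t)) \<longlongrightarrow> 0) F"
  proof (rule topological_tendstoI)
    fix U :: "real set" assume U: "open U" "0 \<in> U"
    from topological_tendstoD[OF N U] obtain S where S: "open S" "g \<in> S"
      "\<And>h. h \<in> S \<Longrightarrow> h \<noteq> g \<Longrightarrow> h \<in> carrier G \<Longrightarrow> N h \<in> U"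
      unfolding eventually_at_topological by blast
    from topological_tendstoD[OF c(1) S(1,2)] c(2) show "\<forall>\<^sub>F t in F. N (c t) \<in> U"
    proof eventually_elim
      case (elim t)
      then show ?case using S(3)[of "c t"] N0 U(2) by (cases "c t = g") auto
    qed
  qed
  then show "((\<lambda>t. L2_norm b (\<lambda>x. \<Omega> (c t) f x - \<Omega> g f x)) \<longlongrightarrow> 0) F" by (simp add: N_def)
qed

text \<open>Operators that converge strongly to the identity and are uniformly bounded do not disturb limits.\<close>

lemma Omega_L2_tendsto:
  assumes v: "L2_tendsto b v w F" and c: "(c \<longlongrightarrow> \<one>) F" "\<forall>\<^sub>F t in F. c t \<in> carrier G"
  shows "L2_tendsto b (\<lambda>t. \<Omega> (c t) (v t)) w F"
  unfolding L2_tendsto_def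
proof (intro conjI)
  show w: "w \<in> L2 b" using v by (simp add: L2_tendsto_def)
  have vL: "\<forall>\<^sub>F t in F. v t \<in> L2 b" using v by (simp add: L2_tendsto_def)
  show "\<forall>\<^sub>F t in F. \<Omega> (c t) (v t) \<in> L2 b"
    using c(2) vL by eventually_elim (rule Omega_L2)
  show "((\<lambda>t. L2_norm b (\<lambda>x. \<Omega> (c t) (v t) x - w x)) \<longlongrightarrow> 0) F"
  proof (rule Lim_null_comparison)
    have "((\<lambda>t. L2_norm b (\<lambda>x. v t x - w x) + L2_norm b (\<lambda>x. \<Omega> (c t) w x - \<Omega> \<one> w x)) \<longlongrightarrow> 0 + 0) F"
      using v Omega_strongly_continuous[OF w one_closed c] unfolding L2_tendsto_def
      by (intro tendsto_add) auto
    then show "((\<lambda>t. L2_norm b (\<lambda>x. v t x - w x) + L2_norm b (\<lambda>x. \<Omega> (c t) w x - \<Omega> \<one> w x)) \<longlongrightarrow> 0) F"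
      by simp
    show "\<forall>\<^sub>F t in F. norm (L2_norm b (\<lambda>x. \<Omega> (c t) (v t) x - w x))
        \<le> L2_norm b (\<lambda>x. v t x - w x) + L2_norm b (\<lambda>x. \<Omega> (c t) w x - \<Omega> \<one> w x)"
      using c(2) vL
    proof eventually_elim
      case (elim t)
      have "L2_norm b (\<lambda>x. \<Omega> (c t) (v t) x - w x)
          \<le> L2_norm b (\<lambda>x. \<Omega> (c t) (v t) x - \<Omega> (c t) w x) + L2_norm b (\<lambda>x. \<Omega> (c t) w x - w x)"
        using elim w by (intro L2_norm_triangle_diff Omega_L2)
      also have "L2_norm b (\<lambda>x. \<Omega> (c t) w x - w x) = L2_norm b (\<lambda>x. \<Omega> (c t) w x - \<Omega> \<one> w x)"
        using elim w by (intro L2_norm_cong L2_diff Omega_L2 L2_eq_diff L2_eq_refl L2_eq_sym[OF Omega_one]) auto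
      finally show ?case using elim w by (simp add: Omega_norm_diff)
    qed
  qed
qed

abbreviation dquot :: "'g \<Rightarrow> (real^'n \<Rightarrow> complex) \<Rightarrow> real \<Rightarrow> real^'n \<Rightarrow> complex" where
  "dquot g u t x \<equiv> (\<Omega> g u x - u x) / of_real t"

abbreviation "dOmega X u w \<equiv> has_dOmega b G \<pi> \<Omega> X u w"

lemma cexp_tendsto_one:
  assumes "trace X = 0" "(r \<longlongrightarrow> 0) F"
  shows "((\<lambda>t. cexp (r t *\<^sub>R X)) \<longlongrightarrow> \<one>) F"
proof -
  have "((\<lambda>s. cexp (s *\<^sub>R X)) \<longlongrightarrow> cexp (0 *\<^sub>R X)) (at 0)"
    using continuous_on_cover_exp[OF assms(1)] unfolding continuous_on_def by blast
  then have "((\<lambda>s. cexp (s *\<^sub>R X)) \<longlongrightarrow> cexp (0 *\<^sub>R X)) (nhds 0)"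
    by (simp only: tendsto_at_iff_tendsto_nhds[where g = "\<lambda>s. cexp (s *\<^sub>R X)" and l = 0])
  from filterlim_compose[OF this assms(2)] show ?thesis
    using cover_exp_0[OF assms(1)] by simp
qed

lemma dOmega_iff_L2_tendsto:
  assumes X: "trace X = 0"
  shows "dOmega X u w \<longleftrightarrow> u \<in> L2 b \<and>
    L2_tendsto b (\<lambda>t x. dquot (cexp (t *\<^sub>R X)) u t x) w (at 0)"
  unfolding has_dOmega_def L2_tendsto_def
  by (auto intro!: always_eventually L2_divide L2_diff Omega_L2 cover_exp_closed[OF X])

lemma dOmega_L2: "dOmega X u w \<Longrightarrow> u \<in> L2 b" "dOmega X u w \<Longrightarrow> w \<in> L2 b"
  by (simp_all add: has_dOmega_def)

lemma dOmega_unique: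
  assumes "trace X = 0" "dOmega X u w" "dOmega X u w'"
  shows "L2_eq b w w'"
  using assms L2_tendsto_unique[of b _ w "at (0::real)" w'] by (auto simp: dOmega_iff_L2_tendsto)

text \<open>Unitarity gives \<open>\<langle>(\<Omega> (exp t X) u - u) / t, v\<rangle> = - \<langle>u, (\<Omega> (exp (- t) X) v - v) / (- t)\<rangle>\<close>, and \<open>- t\<close> tends to \<open>0\<close> with
\<open>t\<close>.\<close>

lemma dOmega_skew:
  assumes X: "trace X = 0" and u: "dOmega X u w" and v: "dOmega X v w'"
  shows "L2_inner b w v = - L2_inner b u w'"
proof -
  note mem = dOmega_L2[OF u] dOmega_L2[OF v]
  let ?q = "\<lambda>u t x. dquot (cexp (t *\<^sub>R X)) u t x"
  have car: "cexp (t *\<^sub>R X) \<in> carrier G" for t by (rule cover_exp_closed[OF X])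
  have lim1: "((\<lambda>t. L2_inner b (?q u t) v) \<longlongrightarrow> L2_inner b w v) (at 0)"
    using u mem by (intro L2_tendsto_inner) (auto simp: dOmega_iff_L2_tendsto[OF X])
  have "((\<lambda>t. L2_inner b (?q v t) u) \<longlongrightarrow> L2_inner b w' u) (at 0)"
    using v mem by (intro L2_tendsto_inner) (auto simp: dOmega_iff_L2_tendsto[OF X])
  moreover have "filterlim uminus (at 0) (at (0::real))"
    by (auto simp: filterlim_at eventually_at_filter intro!: tendsto_eq_intros)
  ultimately have "((\<lambda>t. L2_inner b (?q v (- t)) u) \<longlongrightarrow> L2_inner b w' u) (at 0)"
    by (rule filterlim_compose)
  then have lim2: "((\<lambda>t. - cnj (L2_inner b (?q v (- t)) u)) \<longlongrightarrow> - cnj (L2_inner b w' u)) (at 0)"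
    by (intro tendsto_intros)
  have eq: "- cnj (L2_inner b (?q v (- t)) u) = L2_inner b (?q u t) v" for t
  proof -
    have q: "L2_inner b (\<lambda>x. (\<Omega> (cexp (s *\<^sub>R X)) u x - u x) / c) v
        = (L2_inner b (\<Omega> (cexp (s *\<^sub>R X)) u) v - L2_inner b u v) / c"
      if "u \<in> L2 b" "v \<in> L2 b" for s u v c
    proof -
      have "(\<lambda>x. (\<Omega> (cexp (s *\<^sub>R X)) u x - u x) / c) = (\<lambda>x. (1 / c) * (\<Omega> (cexp (s *\<^sub>R X)) u x - u x))"
        by simp
      then show ?thesis
        using that car by (simp only: L2_inner_scale_left L2_inner_diff_left Omega_L2) simp
    qed
    have "L2_inner b (\<Omega> (cexp ((- t) *\<^sub>R X)) v) u = cnj (L2_inner b (\<Omega> (cexp (t *\<^sub>R X)) u) v)"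
      using mem car by (subst L2_inner_commute) (simp only: Omega_adjoint cover_exp_minus[OF X])
    then show ?thesis
      unfolding q[OF mem(3,1)] q[OF mem(1,3)]
      by (simp add: L2_inner_commute[of b v u] divide_simps)
  qed
  have "L2_inner b w v = - cnj (L2_inner b w' u)"
    using tendsto_unique[OF _ lim1 lim2[unfolded eq]] by simp
  then show ?thesis by (simp add: L2_inner_commute[of b u w'])
qed

text \<open>The chain rule for a reparametrized one-parameter group.\<close>

lemma Omega_curve_derivative:
  assumes X: "trace X = 0" and u: "dOmega X u w" and r: "r 0 = 0" "(r has_real_derivative \<rho>) (at 0)"
  shows "L2_tendsto b (\<lambda>t x. dquot (cexp (r t *\<^sub>R X)) u t x) (\<lambda>x. of_real \<rho> * w x) (at 0)"
  unfolding L2_tendsto_def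
proof (intro conjI always_eventually allI)
  note mem = dOmega_L2[OF u]
  have car: "cexp (t *\<^sub>R X) \<in> carrier G" for t by (rule cover_exp_closed[OF X])
  show "(\<lambda>x. of_real \<rho> * w x) \<in> L2 b" using mem by (intro L2_scale)
  show "(\<lambda>x. dquot (cexp (r t *\<^sub>R X)) u t x) \<in> L2 b" for t
    using mem car by (intro L2_divide L2_diff Omega_L2)
  (* r may vanish away from 0 too; the value 0 makes N continuous at s = 0 *)
  define N where "N s = (if s = 0 then 0 else L2_norm b (\<lambda>x. dquot (cexp (s *\<^sub>R X)) u s x - w x))" for s
  have "(N \<longlongrightarrow> N 0) (at 0)"
    using u unfolding has_dOmega_def N_def
    by (auto intro: Lim_transform_eventually simp: eventually_at_filter)
  then have "(N \<longlongrightarrow> N 0) (nhds 0)"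
    by (simp add: tendsto_at_iff_tendsto_nhds)
  moreover have r0: "(r \<longlongrightarrow> 0) (at 0)"
    using DERIV_isCont[OF r(2)] r(1) by (simp add: isCont_def)
  ultimately have N: "((\<lambda>t. N (r t)) \<longlongrightarrow> 0) (at 0)"
    using filterlim_compose by (fastforce simp: N_def)
  have q: "((\<lambda>t. r t / t) \<longlongrightarrow> \<rho>) (at 0)"
    using r unfolding has_field_derivative_iff by simp
  show "((\<lambda>t. L2_norm b (\<lambda>x. dquot (cexp (r t *\<^sub>R X)) u t x - of_real \<rho> * w x)) \<longlongrightarrow> 0) (at 0)"
  proof (rule Lim_null_comparison)
    have "((\<lambda>t. \<bar>r t / t\<bar> * N (r t) + \<bar>r t / t - \<rho>\<bar> * L2_norm b w) \<longlongrightarrow> \<bar>\<rho>\<bar> * 0 + \<bar>\<rho> - \<rho>\<bar> * L2_norm b w) (at 0)"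
      using N q by (intro tendsto_intros)
    then show "((\<lambda>t. \<bar>r t / t\<bar> * N (r t) + \<bar>r t / t - \<rho>\<bar> * L2_norm b w) \<longlongrightarrow> 0) (at 0)" by simp
    have "L2_norm b (\<lambda>x. dquot (cexp (r t *\<^sub>R X)) u t x - of_real \<rho> * w x)
        \<le> \<bar>r t / t\<bar> * N (r t) + \<bar>r t / t - \<rho>\<bar> * L2_norm b w" for t
    proof (cases "r t = 0")
      case True
      have "L2_norm b (\<lambda>x. dquot (cexp (r t *\<^sub>R X)) u t x - of_real \<rho> * w x)
          = L2_norm b (\<lambda>x. (- of_real \<rho>) * w x)"
      proof (rule L2_norm_cong)
        have "L2_eq b (\<Omega> (cexp (r t *\<^sub>R X)) u) u"
          using True Omega_one[OF mem(1)] cover_exp_0[OF X] by simp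
        then show "L2_eq b (\<lambda>x. dquot (cexp (r t *\<^sub>R X)) u t x - of_real \<rho> * w x) (\<lambda>x. (- of_real \<rho>) * w x)"
          unfolding L2_eq_def by (auto elim!: AE_mp)
        show "(\<lambda>x. (- of_real \<rho>) * w x) \<in> L2 b" using mem by (intro L2_scale)
      qed (use mem car in \<open>intro L2_scale L2_diff L2_divide Omega_L2\<close>)
      also have "\<dots> = \<bar>\<rho>\<bar> * L2_norm b w"
        by (subst L2_norm_scale) simp
      finally show ?thesis using True by simp
    next
      case False
      let ?a = "\<lambda>x. of_real (r t / t) * (dquot (cexp (r t *\<^sub>R X)) u (r t) x - w x)"
      let ?b = "\<lambda>x. of_real (r t / t - \<rho>) * w x"
      have ab: "?a \<in> L2 b" "?b \<in> L2 b"
        using mem car by (auto intro!: L2_scale L2_diff L2_divide Omega_L2)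
      have "(\<lambda>x. dquot (cexp (r t *\<^sub>R X)) u t x - of_real \<rho> * w x) = (\<lambda>x. ?a x + ?b x)"
      proof -
        have "of_real (r t / t) * (c / of_real (r t)) = c / of_real t" for c :: complex
          using False by simp
        then show ?thesis
          by (simp only: right_diff_distrib of_real_diff left_diff_distrib) simp
      qed
      then have "L2_norm b (\<lambda>x. dquot (cexp (r t *\<^sub>R X)) u t x - of_real \<rho> * w x)
          \<le> L2_norm b ?a + L2_norm b ?b"
        using L2_norm_triangle[OF ab] by simp
      then show ?thesis
        using False by (simp only: L2_norm_scale norm_of_real) (simp add: N_def)
    qed
    then show "\<forall>\<^sub>F t in at 0. norm (L2_norm b (\<lambda>x. dquot (cexp (r t *\<^sub>R X)) u t x - of_real \<rho> * w x))
        \<le> \<bar>r t / t\<bar> * N (r t) + \<bar>r t / t - \<rho>\<bar> * L2_norm b w"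
      by (intro always_eventually) simp
  qed
qed

abbreviation "X_low \<equiv> mat2 0 0 1 0"
abbreviation "X_up \<equiv> mat2 0 1 0 0"
abbreviation "X_diag \<equiv> mat2 1 0 0 (-1)"
abbreviation "X_rot \<equiv> mat2 0 (-1) 1 0"

lemma trace_X: "trace X_low = 0" "trace X_up = 0" "trace X_diag = 0" "trace X_rot = 0"
  by simp_all

text \<open>Additivity of the differential for \<open>X_rot = X_low - X_up\<close>, from the decomposition
  \<open>exp (t X_rot) = exp (tan t X_low) exp (ln (cos t) X_diag) exp (- tan t X_up)\<close>: the middle factor
  does not contribute to the derivative at \<open>0\<close>, because \<open>ln (cos t)\<close> is of second order.\<close>

lemma dOmega_rot:
  assumes l: "dOmega X_low u wl" and up: "dOmega X_up u wu" and d: "dOmega X_diag u wd"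
  shows "L2_tendsto b (\<lambda>t x. dquot (cexp (t *\<^sub>R X_rot)) u t x) (\<lambda>x. wl x - wu x) (at 0)"
proof -
  note u = dOmega_L2(1)[OF l]
  define p where "p t = cexp (tan t *\<^sub>R X_low)" for t
  define q where "q t = cexp (ln (cos t) *\<^sub>R X_diag)" for t
  define r where "r t = cexp ((- tan t) *\<^sub>R X_up)" for t
  have car: "p t \<in> carrier G" "q t \<in> carrier G" "r t \<in> carrier G" for t
    unfolding p_def q_def r_def by (intro cover_exp_closed trace_X)+
  have tan0: "(tan \<longlongrightarrow> 0) (at (0::real))" and lncos0: "((\<lambda>t. ln (cos t)) \<longlongrightarrow> 0) (at (0::real))"
    by (auto intro!: tendsto_eq_intros)
  have p1: "(p \<longlongrightarrow> \<one>) (at 0)" and q1: "(q \<longlongrightarrow> \<one>) (at 0)"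
    unfolding p_def[abs_def] q_def[abs_def] by (intro cexp_tendsto_one trace_X tan0 lncos0)+
  let ?Q = "\<lambda>g t x. (\<Omega> (g t) u x - u x) / of_real t"
  have P: "L2_tendsto b (?Q p) (\<lambda>x. of_real 1 * wl x) (at 0)"
    unfolding p_def by (rule Omega_curve_derivative[OF trace_X(1) l]) (auto intro!: derivative_eq_intros)
  have Q: "L2_tendsto b (?Q q) (\<lambda>x. of_real 0 * wd x) (at 0)"
    unfolding q_def by (rule Omega_curve_derivative[OF trace_X(3) d]) (auto intro!: derivative_eq_intros)
  have R: "L2_tendsto b (?Q r) (\<lambda>x. of_real (- 1) * wu x) (at 0)"
    unfolding r_def by (rule Omega_curve_derivative[OF trace_X(2) up]) (auto intro!: derivative_eq_intros)
  have sum: "L2_tendsto b (\<lambda>t x. \<Omega> (p t) (\<Omega> (q t) (?Q r t)) x + (\<Omega> (p t) (?Q q t) x + ?Q p t x))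
      (\<lambda>x. of_real (- 1) * wu x + (of_real 0 * wd x + of_real 1 * wl x)) (at 0)"
    using car by (intro L2_tendsto_add Omega_L2_tendsto[OF _ p1] Omega_L2_tendsto[OF _ q1] P Q R always_eventually) auto
  have ev: "\<forall>\<^sub>F t in at 0. L2_eq b (?Q (\<lambda>t. cexp (t *\<^sub>R X_rot)) t)
      (\<lambda>x. \<Omega> (p t) (\<Omega> (q t) (?Q r t)) x + (\<Omega> (p t) (?Q q t) x + ?Q p t x))"
  proof -
    have "\<forall>\<^sub>F t in at (0::real). \<bar>t\<bar> < pi / 2"
      unfolding eventually_at by (intro exI[of _ "pi / 2"]) (auto simp: dist_real_def)
    then show ?thesis
    proof eventually_elim
      case (elim t)
      have quot: "L2_eq b (\<Omega> g (\<lambda>x. (v x - u x) / c)) (\<lambda>x. (\<Omega> g v x - \<Omega> g u x) / c)"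
        if "g \<in> carrier G" "v \<in> L2 b" for g v c
        using Omega_lin[OF that u, of "1 / c" "- 1 / c"] by (simp add: diff_divide_distrib)
      note qr = Omega_L2[OF car(3) u] Omega_L2[OF car(2) u]
      have "cexp (t *\<^sub>R X_rot) = p t \<otimes> (q t \<otimes> r t)"
        using cover_exp_gauss_decomposition[OF elim] car by (simp only: p_def q_def r_def m_assoc)
      then have e1: "L2_eq b (\<Omega> (cexp (t *\<^sub>R X_rot)) u) (\<Omega> (p t) (\<Omega> (q t) (\<Omega> (r t) u)))"
      proof -
        assume e: "cexp (t *\<^sub>R X_rot) = p t \<otimes> (q t \<otimes> r t)"
        note qrc = m_closed[OF car(2)[of t] car(3)[of t]]
        have "L2_eq b (\<Omega> (cexp (t *\<^sub>R X_rot)) u) (\<Omega> (p t) (\<Omega> (q t \<otimes> r t) u))"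
          unfolding e by (rule Omega_mult[OF car(1) qrc u])
        also have "L2_eq b \<dots> (\<Omega> (p t) (\<Omega> (q t) (\<Omega> (r t) u)))"
          by (rule Omega_cong[OF car(1) Omega_L2[OF qrc u] Omega_L2[OF car(2) qr(1)] Omega_mult[OF car(2,3) u]])
        finally show ?thesis .
      qed
      have "L2_eq b (\<Omega> (q t) (?Q r t)) (\<lambda>x. (\<Omega> (q t) (\<Omega> (r t) u) x - \<Omega> (q t) u x) / of_real t)"
        using car qr by (intro quot)
      then have "L2_eq b (\<Omega> (p t) (\<Omega> (q t) (?Q r t)))
          (\<Omega> (p t) (\<lambda>x. (\<Omega> (q t) (\<Omega> (r t) u) x - \<Omega> (q t) u x) / of_real t))"
        using car qr u by (intro Omega_cong) (auto intro!: Omega_L2 L2_divide L2_diff)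
      also have "L2_eq b \<dots> (\<lambda>x. (\<Omega> (p t) (\<Omega> (q t) (\<Omega> (r t) u)) x - \<Omega> (p t) (\<Omega> (q t) u) x) / of_real t)"
        using Omega_lin[OF car(1) Omega_L2[OF car(2) qr(1)] qr(2), where c = "1 / of_real t" and d = "- 1 / of_real t"]
        by (simp add: diff_divide_distrib)
      finally have e2: "L2_eq b (\<Omega> (p t) (\<Omega> (q t) (?Q r t)))
          (\<lambda>x. (\<Omega> (p t) (\<Omega> (q t) (\<Omega> (r t) u)) x - \<Omega> (p t) (\<Omega> (q t) u) x) / of_real t)" .
      have e3: "L2_eq b (\<Omega> (p t) (?Q q t)) (\<lambda>x. (\<Omega> (p t) (\<Omega> (q t) u) x - \<Omega> (p t) u x) / of_real t)"
        using car qr by (intro quot)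
      from e1 e2 e3 show ?case
        unfolding L2_eq_def by eventually_elim (simp add: diff_divide_distrib)
    qed
  qed
  have rotcar: "cexp (t *\<^sub>R X_rot) \<in> carrier G" for t by (intro cover_exp_closed trace_X)
  have lhsL: "?Q (\<lambda>t. cexp (t *\<^sub>R X_rot)) t \<in> L2 b" for t
    using rotcar u by (auto intro!: L2_divide L2_diff Omega_L2)
  have w: "(\<lambda>x. wl x - wu x) \<in> L2 b" using l up by (intro L2_diff dOmega_L2(2))
  have lim: "(\<lambda>x. of_real (- 1) * wu x + (of_real 0 * wd x + of_real 1 * wl x)) = (\<lambda>x. wl x - wu x)"
    by simp
  from sum have sumL: "\<forall>\<^sub>F t in at 0. (\<lambda>x. \<Omega> (p t) (\<Omega> (q t) (?Q r t)) x + (\<Omega> (p t) (?Q q t) x + ?Q p t x)) \<in> L2 b"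
      and sum0: "((\<lambda>t. L2_norm b (\<lambda>x. (\<Omega> (p t) (\<Omega> (q t) (?Q r t)) x + (\<Omega> (p t) (?Q q t) x + ?Q p t x)) - (wl x - wu x))) \<longlongrightarrow> 0) (at 0)"
    unfolding lim L2_tendsto_def by blast+
  have "((\<lambda>t. L2_norm b (\<lambda>x. ?Q (\<lambda>t. cexp (t *\<^sub>R X_rot)) t x - (wl x - wu x))) \<longlongrightarrow> 0) (at 0)"
  proof (rule Lim_transform_eventually[OF sum0])
    show "\<forall>\<^sub>F t in at 0. L2_norm b (\<lambda>x. (\<Omega> (p t) (\<Omega> (q t) (?Q r t)) x + (\<Omega> (p t) (?Q q t) x + ?Q p t x)) - (wl x - wu x))
        = L2_norm b (\<lambda>x. ?Q (\<lambda>t. cexp (t *\<^sub>R X_rot)) t x - (wl x - wu x))"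
      using ev sumL
    proof eventually_elim
      case (elim t)
      show ?case
        by (intro L2_norm_cong L2_diff[OF elim(2) w] L2_diff[OF lhsL w] L2_eq_diff[OF L2_eq_sym[OF elim(1)] L2_eq_refl])
    qed
  qed
  then show ?thesis
    unfolding L2_tendsto_def using w lhsL by (auto intro: always_eventually)
qed

end

context Omega_rep
begin

section \<open>The representation on the weight spaces\<close>

text \<open>Inductive access to \<open>Walg\<close>, which is defined by finite families.\<close>

lemma Walg_zero: "(\<lambda>x. 0) \<in> Walg b"
  unfolding Walg_def by (intro CollectI exI[of _ "0::nat"]) simp

lemma Walg_add_Phi:
  fixes u :: "real^'n \<Rightarrow> complex"
  assumes u: "u \<in> Walg b" and p: "p \<in> harmonic_poly m"
  shows "(\<lambda>x. u x + c * Phi b m l p x) \<in> Walg b"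
proof -
  obtain J :: nat and c' m' l' p' where J: "\<And>j. j < J \<Longrightarrow> p' j \<in> harmonic_poly (m' j)"
    "u = (\<lambda>x. \<Sum>j<J. c' j * Phi b (m' j) (l' j) (p' j) x)"
    using u unfolding Walg_def by blast
  show ?thesis
    unfolding Walg_def
  proof (intro CollectI exI conjI)
    show "\<forall>j<Suc J. (p'(J := p)) j \<in> harmonic_poly ((m'(J := m)) j)"
      using J(1) p by (simp add: less_Suc_eq)
    show "(\<lambda>x. u x + c * Phi b m l p x)
        = (\<lambda>x. \<Sum>j<Suc J. (c'(J := c)) j * Phi b ((m'(J := m)) j) ((l'(J := l)) j) ((p'(J := p)) j) x)"
      by (simp add: J(2))
  qed
qed

lemma weight_space_Walg: "(u :: real^'n \<Rightarrow> complex) \<in> weight_space b \<tau> \<Longrightarrow> u \<in> Walg b"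
  by (induction rule: weight_space.induct) (simp_all add: Walg_zero Walg_add_Phi)

lemma Walg_dOmega:
  assumes "u \<in> Walg b"
  shows "dOmega X_up u (\<lambda>x. \<i> / 2 * of_real ((norm x)\<^sup>2) * u x)"
    and "dOmega X_low u (\<lambda>x. \<i> / 2 * Hb_alg b u x)"
    and "dOmega X_diag u (\<lambda>x. euler u x + of_real ((real CARD('n) + 2 * b) / 2) * u x)"
  using Omega assms unfolding is_Omega_b_def by blast+

lemma weight_space_L2: "(u :: real^'n \<Rightarrow> complex) \<in> weight_space b \<tau> \<Longrightarrow> u \<in> L2 b"
  by (rule dOmega_L2(1)[OF Walg_dOmega(1)[OF weight_space_Walg]])

lemma Phi_L2:
  fixes p :: "real^'n \<Rightarrow> complex"
  assumes "p \<in> harmonic_poly m"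
  shows "Phi b m l p \<in> L2 b"
proof -
  have "Phi b m l p \<in> Walg b"
    using Walg_add_Phi[OF Walg_zero assms, of 1] by simp
  then show ?thesis using Walg_dOmega(1) dOmega_L2(1) by blast
qed

lemma Omega_rot_Phi:
  fixes p :: "real^'n \<Rightarrow> complex"
  assumes "p \<in> harmonic_poly m"
  shows "L2_eq b (\<Omega> (cexp (t *\<^sub>R X_rot)) (Phi b m l p))
    (\<lambda>x. exp (- \<i> * of_real (t * tau TYPE('n) b m l)) * Phi b m l p x)"
  using Omega assms unfolding is_Omega_b_def tau_def by blast

lemma Omega_rot_weight_space:
  assumes "u \<in> weight_space b \<tau>"
  shows "L2_eq b (\<Omega> (cexp (t *\<^sub>R X_rot)) u) (\<lambda>x. exp (- \<i> * of_real (t * \<tau>)) * u x)"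
  using assms
proof (induction rule: weight_space.induct)
  have car: "cexp (t *\<^sub>R X_rot) \<in> carrier G" by (intro cover_exp_closed trace_X)
  {
    case zero
    then show ?case using Omega_scale[OF car L2_zero, of 0] by simp
  next
    case (add_Phi u p m l c)
    have "L2_eq b (\<Omega> (cexp (t *\<^sub>R X_rot)) (\<lambda>x. 1 * u x + c * Phi b m l p x))
        (\<lambda>x. 1 * \<Omega> (cexp (t *\<^sub>R X_rot)) u x + c * \<Omega> (cexp (t *\<^sub>R X_rot)) (Phi b m l p) x)"
      by (rule Omega_lin[OF car weight_space_L2[OF add_Phi.hyps(1)] Phi_L2[OF add_Phi.hyps(2)]])
    also have "L2_eq b \<dots> (\<lambda>x. 1 * (exp (- \<i> * of_real (t * \<tau>)) * u x) + c * (exp (- \<i> * of_real (t * \<tau>)) * Phi b m l p x))"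
      using add_Phi.IH Omega_rot_Phi[OF add_Phi.hyps(2), of t l] add_Phi.hyps(3) by (intro L2_eq_lin) auto
    finally show ?case by (simp add: algebra_simps)
  }
qed

lemma dOmega_cong:
  assumes "dOmega X u w" "L2_eq b w w'" "w' \<in> L2 b" "trace X = 0"
  shows "dOmega X u w'"
proof -
  note mem = dOmega_L2[OF assms(1)]
  have "L2_norm b (\<lambda>x. dquot (cexp (t *\<^sub>R X)) u t x - w x)
      = L2_norm b (\<lambda>x. dquot (cexp (t *\<^sub>R X)) u t x - w' x)" for t
    using mem assms cover_exp_closed[OF assms(4), of t]
    by (intro L2_norm_cong L2_diff L2_divide Omega_L2 L2_eq_diff L2_eq_refl) auto
  then show ?thesis using assms(1,3) mem unfolding has_dOmega_def by simp
qed

text \<open>The rotation subgroup acts on \<open>u\<close> through scalars, which gives its differential; as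
\<open>X_rot = X_low - X_up\<close>, that of \<open>X_low\<close> is obtained by adding the known action of \<open>X_up\<close>.\<close>

lemma dOmega_low_weight_space:
  assumes u: "u \<in> weight_space b \<tau>"
  shows "dOmega X_low u (\<lambda>x. \<i> / 2 * of_real ((norm x)\<^sup>2) * u x - \<i> * of_real \<tau> * u x)"
proof -
  note W = Walg_dOmega[OF weight_space_Walg[OF u]]
  note uL = weight_space_L2[OF u]
  let ?up = "\<lambda>x. \<i> / 2 * of_real ((norm x)\<^sup>2) * u x"
  let ?low = "\<lambda>x. \<i> / 2 * Hb_alg b u x"
  let ?Q = "\<lambda>t x. dquot (cexp (t *\<^sub>R X_rot)) u t x"
  have QL: "?Q t \<in> L2 b" for t
    using uL by (intro L2_divide L2_diff Omega_L2 cover_exp_closed trace_X)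
  have "L2_tendsto b ?Q (\<lambda>x. (- \<i> * of_real \<tau>) * u x) (at 0)"
    unfolding L2_tendsto_def
  proof (intro conjI always_eventually allI QL)
    show "(\<lambda>x. (- \<i> * of_real \<tau>) * u x) \<in> L2 b" using uL by (rule L2_scale)
    have "L2_norm b (\<lambda>x. ?Q t x - (- \<i> * of_real \<tau>) * u x)
        = norm ((exp ((- \<i> * of_real \<tau>) * of_real t) - 1) / of_real t - (- \<i> * of_real \<tau>)) * L2_norm b u" for t
    proof -
      have "L2_norm b (\<lambda>x. ?Q t x - (- \<i> * of_real \<tau>) * u x)
          = L2_norm b (\<lambda>x. ((exp ((- \<i> * of_real \<tau>) * of_real t) - 1) / of_real t - (- \<i> * of_real \<tau>)) * u x)"
      proof (rule L2_norm_cong)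
        show "(\<lambda>x. ?Q t x - (- \<i> * of_real \<tau>) * u x) \<in> L2 b"
          using QL[of t] L2_scale[OF uL, of "- \<i> * of_real \<tau>"] by (rule L2_diff)
        show "(\<lambda>x. ((exp ((- \<i> * of_real \<tau>) * of_real t) - 1) / of_real t - (- \<i> * of_real \<tau>)) * u x) \<in> L2 b"
          using uL by (rule L2_scale)
        show "L2_eq b (\<lambda>x. ?Q t x - (- \<i> * of_real \<tau>) * u x)
            (\<lambda>x. ((exp ((- \<i> * of_real \<tau>) * of_real t) - 1) / of_real t - (- \<i> * of_real \<tau>)) * u x)"
          using Omega_rot_weight_space[OF u, of t] unfolding L2_eq_def
          by eventually_elim (simp add: algebra_simps diff_divide_distrib)
      qed
      then show ?thesis by (simp only: L2_norm_scale)
    qed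
    moreover have "((\<lambda>t. norm ((exp ((- \<i> * of_real \<tau>) * of_real t) - 1) / of_real t - (- \<i> * of_real \<tau>)) * L2_norm b u)
        \<longlongrightarrow> norm (- \<i> * of_real \<tau> - (- \<i> * of_real \<tau>)) * L2_norm b u) (at 0)"
      by (intro tendsto_intros exp_difference_quotient)
    ultimately show "((\<lambda>t. L2_norm b (\<lambda>x. ?Q t x - (- \<i> * of_real \<tau>) * u x)) \<longlongrightarrow> 0) (at 0)"
      by simp
  qed
  then have "L2_eq b (\<lambda>x. (- \<i> * of_real \<tau>) * u x) (\<lambda>x. ?low x - ?up x)"
    using dOmega_rot[OF W(2,1,3)] by (rule L2_tendsto_unique) simp
  then have "L2_eq b ?low (\<lambda>x. ?up x - \<i> * of_real \<tau> * u x)"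
    unfolding L2_eq_def by eventually_elim (simp add: algebra_simps)
  moreover have "(\<lambda>x. ?up x - \<i> * of_real \<tau> * u x) \<in> L2 b"
    using dOmega_L2(2)[OF W(1)] L2_scale[OF uL, of "\<i> * of_real \<tau>"] by (rule L2_diff)
  ultimately show ?thesis using W(2) by (intro dOmega_cong[OF W(2)] trace_X)
qed

section \<open>Smooth vectors\<close>

text \<open>Right translation by \<open>g\<close> turns the left-invariant vector field of \<open>X\<close> into that of
  \<open>g\<^sup>-\<^sup>1 X g\<close>.\<close>

lemma smooth_map_right_translate:
  fixes \<phi>0 :: "'g \<Rightarrow> real^'n \<Rightarrow> complex"
  assumes "smooth_map b G \<pi> \<phi>0" and g: "g \<in> carrier G"
    and "\<And>h. h \<in> carrier G \<Longrightarrow> \<phi> h \<in> L2 b \<and> L2_eq b (\<phi> h) (\<phi>0 (h \<otimes> g))"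
  shows "smooth_map b G \<pi> \<phi>"
proof -
  define R where "R \<phi> \<longleftrightarrow> (\<exists>\<phi>0. smooth_map b G \<pi> \<phi>0 \<and>
    (\<forall>h\<in>carrier G. \<phi> h \<in> L2 b \<and> L2_eq b (\<phi> h) (\<phi>0 (h \<otimes> g))))" for \<phi> :: "'g \<Rightarrow> real^'n \<Rightarrow> complex"
  have "R \<phi>" unfolding R_def using assms by blast
  then show ?thesis
  proof (rule smooth_map.coinduct[of R])
    fix \<phi> :: "'g \<Rightarrow> real^'n \<Rightarrow> complex"
    assume "R \<phi>"
    then obtain \<phi>0 where \<phi>0: "smooth_map b G \<pi> \<phi>0"
      and \<phi>: "\<And>h. h \<in> carrier G \<Longrightarrow> \<phi> h \<in> L2 b" "\<And>h. h \<in> carrier G \<Longrightarrow> L2_eq b (\<phi> h) (\<phi>0 (h \<otimes> g))"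
      unfolding R_def by blast
    from \<phi>0 have 0: "\<forall>h\<in>carrier G. \<phi>0 h \<in> L2 b"
        "\<forall>h\<in>carrier G. ((\<lambda>k. L2_norm b (\<lambda>x. \<phi>0 k x - \<phi>0 h x)) \<longlongrightarrow> 0) (at h within carrier G)"
        "\<forall>X. trace X = 0 \<longrightarrow> (\<exists>\<psi>. smooth_map b G \<pi> \<psi> \<and> (\<forall>h\<in>carrier G.
          ((\<lambda>t. L2_norm b (\<lambda>x. (\<phi>0 (h \<otimes> cexp (t *\<^sub>R X)) x - \<phi>0 h x) / of_real t - \<psi> h x)) \<longlongrightarrow> 0) (at 0)))"
      by (cases rule: smooth_map.cases; blast)+
    have hg: "h \<otimes> g \<in> carrier G" if "h \<in> carrier G" for h using that g by simp
    have cont: "((\<lambda>k. L2_norm b (\<lambda>x. \<phi> k x - \<phi> h x)) \<longlongrightarrow> 0) (at h within carrier G)" if h: "h \<in> carrier G" for h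
    proof -
      have "continuous_on (carrier G) (\<lambda>k. k \<otimes> g)"
        using g by (intro continuous_on_mult continuous_intros) auto
      then have "((\<lambda>k. k \<otimes> g) \<longlongrightarrow> h \<otimes> g) (at h within carrier G)"
        using h unfolding continuous_on_def by blast
      moreover have "\<forall>\<^sub>F k in at h within carrier G. k \<otimes> g \<in> carrier G \<and> k \<otimes> g \<noteq> h \<otimes> g"
        unfolding eventually_at_filter using g h by (auto intro!: always_eventually)
      ultimately have "filterlim (\<lambda>k. k \<otimes> g) (at (h \<otimes> g) within carrier G) (at h within carrier G)"
        unfolding filterlim_at by (auto elim: eventually_mono)
      then have "((\<lambda>k. L2_norm b (\<lambda>x. \<phi>0 (k \<otimes> g) x - \<phi>0 (h \<otimes> g) x)) \<longlongrightarrow> 0) (at h within carrier G)"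
        using filterlim_compose[OF bspec[OF 0(2) hg[OF h]]] by blast
      moreover have "\<forall>\<^sub>F k in at h within carrier G. L2_norm b (\<lambda>x. \<phi>0 (k \<otimes> g) x - \<phi>0 (h \<otimes> g) x)
          = L2_norm b (\<lambda>x. \<phi> k x - \<phi> h x)"
      proof -
        have "L2_norm b (\<lambda>x. \<phi>0 (k \<otimes> g) x - \<phi>0 (h \<otimes> g) x) = L2_norm b (\<lambda>x. \<phi> k x - \<phi> h x)"
          if k: "k \<in> carrier G" for k
          using 0(1) hg h k \<phi> by (intro L2_norm_cong L2_diff L2_eq_diff L2_eq_sym[OF \<phi>(2)]) auto
        then show ?thesis unfolding eventually_at_filter by (auto intro!: always_eventually)
      qed
      ultimately show ?thesis by (rule Lim_transform_eventually)
    qed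
    have deriv: "\<exists>\<psi>. R \<psi> \<and> (\<forall>h\<in>carrier G.
          ((\<lambda>t. L2_norm b (\<lambda>x. (\<phi> (h \<otimes> cexp (t *\<^sub>R X)) x - \<phi> h x) / of_real t - \<psi> h x)) \<longlongrightarrow> 0) (at 0))"
      if X: "trace X = 0" for X
    proof -
      let ?Y = "\<pi> (inv\<^bsub>G\<^esub> g) ** X ** \<pi> g"
      have "trace ?Y = 0" using \<pi>_inv(1)[OF g] X by (rule trace_conjugate)
      then obtain \<psi>0 where \<psi>0: "smooth_map b G \<pi> \<psi>0" "\<And>h. h \<in> carrier G \<Longrightarrow>
          ((\<lambda>t. L2_norm b (\<lambda>x. (\<phi>0 (h \<otimes> cexp (t *\<^sub>R ?Y)) x - \<phi>0 h x) / of_real t - \<psi>0 h x)) \<longlongrightarrow> 0) (at 0)"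
        using 0(3) by blast
      have \<psi>0L: "\<psi>0 h \<in> L2 b" if "h \<in> carrier G" for h
        using \<psi>0(1) that by (cases rule: smooth_map.cases) blast
      define \<psi> where "\<psi> h = \<psi>0 (h \<otimes> g)" for h
      have "R \<psi>"
        unfolding R_def \<psi>_def using \<psi>0(1) \<psi>0L[OF hg] L2_eq_refl
        by (intro exI[of _ \<psi>0] conjI ballI)
      moreover have "((\<lambda>t. L2_norm b (\<lambda>x. (\<phi> (h \<otimes> cexp (t *\<^sub>R X)) x - \<phi> h x) / of_real t - \<psi> h x)) \<longlongrightarrow> 0) (at 0)"
        if h: "h \<in> carrier G" for h
      proof -
        have "L2_norm b (\<lambda>x. (\<phi>0 (h \<otimes> g \<otimes> cexp (t *\<^sub>R ?Y)) x - \<phi>0 (h \<otimes> g) x) / of_real t - \<psi>0 (h \<otimes> g) x)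
            = L2_norm b (\<lambda>x. (\<phi> (h \<otimes> cexp (t *\<^sub>R X)) x - \<phi> h x) / of_real t - \<psi> h x)" for t
        proof -
          have e: "cexp (t *\<^sub>R X) \<in> carrier G" by (rule cover_exp_closed[OF X])
          have "h \<otimes> g \<otimes> cexp (t *\<^sub>R ?Y) = h \<otimes> (g \<otimes> inv\<^bsub>G\<^esub> g) \<otimes> cexp (t *\<^sub>R X) \<otimes> g"
            using h g e by (simp only: cover_exp_conjugate[OF X g] m_assoc m_closed inv_closed)
          then have eq: "h \<otimes> g \<otimes> cexp (t *\<^sub>R ?Y) = h \<otimes> cexp (t *\<^sub>R X) \<otimes> g"
            using h g by simp
          have he: "h \<otimes> cexp (t *\<^sub>R X) \<in> carrier G" using h e by simp
          have m: "\<phi>0 (h \<otimes> cexp (t *\<^sub>R X) \<otimes> g) \<in> L2 b" "\<phi>0 (h \<otimes> g) \<in> L2 b" "\<psi>0 (h \<otimes> g) \<in> L2 b"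
            using 0(1) \<psi>0L hg[OF he] hg[OF h] by blast+
          show ?thesis
            unfolding eq \<psi>_def
          proof (rule L2_norm_cong)
            show "L2_eq b (\<lambda>x. (\<phi>0 (h \<otimes> cexp (t *\<^sub>R X) \<otimes> g) x - \<phi>0 (h \<otimes> g) x) / of_real t - \<psi>0 (h \<otimes> g) x)
                (\<lambda>x. (\<phi> (h \<otimes> cexp (t *\<^sub>R X)) x - \<phi> h x) / of_real t - \<psi>0 (h \<otimes> g) x)"
              using \<phi>(2)[OF he] \<phi>(2)[OF h] unfolding L2_eq_def by eventually_elim simp
          qed (intro L2_diff L2_divide m \<phi>(1) he h)+
        qed
        then show ?thesis using \<psi>0(2)[OF hg[OF h]] by simp
      qed
      ultimately show ?thesis by blast
    qed
    have deriv': "\<exists>\<psi>. (R \<psi> \<or> smooth_map b G \<pi> \<psi>) \<and> (\<forall>h\<in>carrier G.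
          ((\<lambda>t. L2_norm b (\<lambda>x. (\<phi> (h \<otimes> cexp (t *\<^sub>R X)) x - \<phi> h x) / of_real t - \<psi> h x)) \<longlongrightarrow> 0) (at 0))"
      if X: "trace X = 0" for X
      using deriv[OF X] by (elim exE conjE) (intro exI conjI disjI1)
    show "\<exists>\<phi>'. \<phi> = \<phi>' \<and> (\<forall>g\<in>carrier G. \<phi>' g \<in> L2 b) \<and>
        (\<forall>g\<in>carrier G. ((\<lambda>h. L2_norm b (\<lambda>x. \<phi>' h x - \<phi>' g x)) \<longlongrightarrow> 0) (at g within carrier G)) \<and>
        (\<forall>X. trace X = 0 \<longrightarrow> (\<exists>\<psi>. (R \<psi> \<or> smooth_map b G \<pi> \<psi>) \<and> (\<forall>h\<in>carrier G.
          ((\<lambda>t. L2_norm b (\<lambda>x. (\<phi>' (h \<otimes> cexp (t *\<^sub>R X)) x - \<phi>' h x) / of_real t - \<psi> h x)) \<longlongrightarrow> 0) (at 0))))"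
      by (intro exI[of _ \<phi>] conjI refl ballI allI impI \<phi>(1) cont deriv')
  qed
qed

lemma schwartz_L2: "(f :: real^'n \<Rightarrow> complex) \<in> schwartz \<Longrightarrow> f \<in> L2 b"
  by (rule schwartz_in_L2[OF b])

lemma schwartz_smooth: "f \<in> schwartz \<Longrightarrow> smooth_map b G \<pi> (\<lambda>g. \<Omega> g f)"
proof -
  assume f: "f \<in> schwartz"
  then have "f \<in> smooth_vectors b G \<pi> \<Omega>"
    unfolding smooth using schwartz_L2 L2_eq_refl by blast
  then show ?thesis by (simp add: smooth_vectors_def)
qed

lemma smooth_imp_schwartz:
  "u \<in> L2 b \<Longrightarrow> smooth_map b G \<pi> (\<lambda>g. \<Omega> g u) \<Longrightarrow> \<exists>f\<in>schwartz. L2_eq b u f"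
proof -
  assume "u \<in> L2 b" "smooth_map b G \<pi> (\<lambda>g. \<Omega> g u)"
  then have "u \<in> smooth_vectors b G \<pi> \<Omega>" by (simp add: smooth_vectors_def)
  then show ?thesis unfolding smooth by blast
qed

text \<open>Schwartz functions are the smooth vectors, and the orbit map of \<open>\<Omega> g f\<close> is a right translate of
that of \<open>f\<close>.\<close>

lemma Omega_schwartz:
  assumes g: "g \<in> carrier G" and f: "f \<in> schwartz"
  shows "\<exists>h\<in>schwartz. L2_eq b (\<Omega> g f) h"
proof (rule smooth_imp_schwartz)
  note fL = schwartz_L2[OF f]
  show "\<Omega> g f \<in> L2 b" using g fL by (rule Omega_L2)
  show "smooth_map b G \<pi> (\<lambda>h. \<Omega> h (\<Omega> g f))"
  proof (rule smooth_map_right_translate[OF schwartz_smooth[OF f] g])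
    fix h assume h: "h \<in> carrier G"
    show "\<Omega> h (\<Omega> g f) \<in> L2 b \<and> L2_eq b (\<Omega> h (\<Omega> g f)) (\<Omega> (h \<otimes> g) f)"
      using h g fL L2_eq_sym[OF Omega_mult[OF h g fL]] by (simp add: Omega_L2)
  qed
qed

text \<open>The derivative of the orbit map of \<open>f\<close> along \<open>X\<close> is the orbit map of its value \<open>w\<close> at \<open>1\<close>, and it is smooth
because all iterated derivatives of a smooth map are.\<close>

lemma dOmega_schwartz:
  assumes X: "trace X = 0" and f: "f \<in> schwartz"
  shows "\<exists>h\<in>schwartz. dOmega X f h"
proof -
  note fL = schwartz_L2[OF f]
  from schwartz_smooth[OF f] obtain \<psi> where \<psi>: "smooth_map b G \<pi> \<psi>"
      "\<And>g. g \<in> carrier G \<Longrightarrow> ((\<lambda>t. L2_norm b (\<lambda>x. (\<Omega> (g \<otimes> cexp (t *\<^sub>R X)) f x - \<Omega> g f x) / of_real t - \<psi> g x)) \<longlongrightarrow> 0) (at 0)"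
    using X by (cases rule: smooth_map.cases) blast
  have \<psi>L: "\<psi> g \<in> L2 b" if "g \<in> carrier G" for g
    using \<psi>(1) that by (cases rule: smooth_map.cases) blast
  have e: "cexp (t *\<^sub>R X) \<in> carrier G" for t by (rule cover_exp_closed[OF X])
  define w where "w = \<psi> \<one>"
  have wL: "w \<in> L2 b" unfolding w_def by (rule \<psi>L) simp
  have d: "dOmega X f w"
    unfolding has_dOmega_def
  proof (intro conjI fL wL)
    have "L2_norm b (\<lambda>x. (\<Omega> (\<one> \<otimes> cexp (t *\<^sub>R X)) f x - \<Omega> \<one> f x) / of_real t - w x)
        = L2_norm b (\<lambda>x. dquot (cexp (t *\<^sub>R X)) f t x - w x)" for t
    proof (rule L2_norm_cong)
      show "L2_eq b (\<lambda>x. (\<Omega> (\<one> \<otimes> cexp (t *\<^sub>R X)) f x - \<Omega> \<one> f x) / of_real t - w x)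
          (\<lambda>x. dquot (cexp (t *\<^sub>R X)) f t x - w x)"
        using Omega_one[OF fL] e unfolding L2_eq_def by (auto elim!: AE_mp)
    qed (use e in \<open>intro L2_diff L2_divide Omega_L2 fL wL; simp\<close>)+
    then show "((\<lambda>t. L2_norm b (\<lambda>x. dquot (cexp (t *\<^sub>R X)) f t x - w x)) \<longlongrightarrow> 0) (at 0)"
      using \<psi>(2)[of "\<one>"] by (simp add: w_def)
  qed
  have "smooth_map b G \<pi> (\<lambda>g. \<Omega> g w)"
  proof (rule smooth_map_right_translate[OF \<psi>(1) one_closed])
    fix g assume g: "g \<in> carrier G"
    let ?Q = "\<lambda>t x. (\<Omega> (g \<otimes> cexp (t *\<^sub>R X)) f x - \<Omega> g f x) / of_real t"
    have QL: "?Q t \<in> L2 b" for t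
      using g e fL by (intro L2_divide L2_diff Omega_L2) auto
    have 1: "L2_tendsto b ?Q (\<psi> g) (at 0)"
      unfolding L2_tendsto_def using QL \<psi>L[OF g] \<psi>(2)[OF g] by (auto intro: always_eventually)
    have "L2_norm b (\<lambda>x. ?Q t x - \<Omega> g w x)
        = L2_norm b (\<lambda>x. dquot (cexp (t *\<^sub>R X)) f t x - w x)" for t
    proof -
      let ?q = "\<lambda>x. dquot (cexp (t *\<^sub>R X)) f t x"
      have q: "?q \<in> L2 b" using e fL by (intro L2_divide L2_diff Omega_L2)
      have "L2_eq b (\<Omega> g (\<lambda>x. (1 / of_real t) * \<Omega> (cexp (t *\<^sub>R X)) f x + (- 1 / of_real t) * f x))
         (\<lambda>x. (1 / of_real t) * \<Omega> g (\<Omega> (cexp (t *\<^sub>R X)) f) x + (- 1 / of_real t) * \<Omega> g f x)"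
        by (rule Omega_lin[OF g Omega_L2[OF e fL] fL])
      then have "L2_eq b (\<Omega> g ?q) (\<lambda>x. (\<Omega> g (\<Omega> (cexp (t *\<^sub>R X)) f) x - \<Omega> g f x) / of_real t)"
        by (simp add: diff_divide_distrib)
      then have "L2_eq b (?Q t) (\<Omega> g ?q)"
        using Omega_mult[OF g e[of t] fL] unfolding L2_eq_def by eventually_elim simp
      then have "L2_norm b (\<lambda>x. ?Q t x - \<Omega> g w x) = L2_norm b (\<lambda>x. \<Omega> g ?q x - \<Omega> g w x)"
        using QL[of t] g q wL by (intro L2_norm_cong L2_diff Omega_L2 L2_eq_diff L2_eq_refl)
      then show ?thesis using Omega_norm_diff[OF g q wL] by simp
    qed
    then have 2: "L2_tendsto b ?Q (\<Omega> g w) (at 0)"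
      unfolding L2_tendsto_def using QL d Omega_L2[OF g wL]
      by (auto intro: always_eventually simp: has_dOmega_def)
    show "\<Omega> g w \<in> L2 b \<and> L2_eq b (\<Omega> g w) (\<psi> (g \<otimes> \<one>))"
      using L2_tendsto_unique[OF 2 1] Omega_L2[OF g wL] g by simp
  qed
  then obtain h where "h \<in> schwartz" "L2_eq b w h"
    using smooth_imp_schwartz wL by blast
  then show ?thesis using dOmega_cong[OF d _ schwartz_L2 X] by blast
qed

section \<open>Conjugation by the generalized Fourier transform\<close>

text \<open>These are the two defining properties of \<open>Hb\<close>.  They follow since the derivative of a Schwartz function
exists, is represented by a Schwartz function and is unique.\<close>

lemma Hb_schwartz:
  assumes f: "f \<in> schwartz"
  shows "Hb b G \<pi> \<Omega> f \<in> schwartz" "dOmega X_low f (\<lambda>x. \<i> / 2 * Hb b G \<pi> \<Omega> f x)"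
proof -
  obtain h0 where h0: "h0 \<in> schwartz" "dOmega X_low f h0"
    using dOmega_schwartz[OF trace_X(1) f] by blast
  have "\<exists>!h. h \<in> schwartz \<and> dOmega X_low f (\<lambda>x. \<i> / 2 * h x)"
  proof (rule ex1I)
    have "(\<lambda>x. \<i> / 2 * (- 2 * \<i> * h0 x)) = h0" by (simp add: field_simps)
    then show "(\<lambda>x. - 2 * \<i> * h0 x) \<in> schwartz \<and> dOmega X_low f (\<lambda>x. \<i> / 2 * (- 2 * \<i> * h0 x))"
      using h0 schwartz_scale[OF h0(1), of "- 2 * \<i>"] by simp
    fix h assume h: "h \<in> schwartz \<and> dOmega X_low f (\<lambda>x. \<i> / 2 * h x)"
    then have "L2_eq b (\<lambda>x. \<i> / 2 * h x) h0"
      using dOmega_unique[OF trace_X(1)] h0(2) by blast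
    then have "(\<lambda>x. \<i> / 2 * h x) = h0"
      using h h0 by (intro schwartz_L2_eq_imp_eq schwartz_scale) auto
    then show "h = (\<lambda>x. - 2 * \<i> * h0 x)" by (auto simp: field_simps)
  qed
  from theI'[OF this] show "Hb b G \<pi> \<Omega> f \<in> schwartz" "dOmega X_low f (\<lambda>x. \<i> / 2 * Hb b G \<pi> \<Omega> f x)"
    unfolding Hb_def by auto
qed

abbreviation "T \<equiv> half_Hb_minus_sq b G \<pi> \<Omega>"
abbreviation "D \<equiv> Db b G \<pi> \<Omega>"
abbreviation "F \<equiv> Fb b G \<pi> \<Omega>"

lemma T_schwartz:
  assumes "f \<in> schwartz" shows "T f \<in> schwartz"
proof -
  have "T f = (\<lambda>x. (1 / 2) * (Hb b G \<pi> \<Omega> f x - of_real ((norm x)\<^sup>2) * f x))"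
    by (auto simp: half_Hb_minus_sq_def)
  then show ?thesis
    using assms by (simp only:) (intro schwartz_scale schwartz_diff Hb_schwartz schwartz_norm_mult)
qed

lemma D_schwartz:
  assumes "f \<in> schwartz" shows "D n f \<in> schwartz"
proof -
  have "D n f = (\<lambda>x. T (coord_mult n f) x - coord_mult n (T f) x)"
    by (auto simp: Db_def)
  then show ?thesis
    using assms by (simp only:) (intro schwartz_diff T_schwartz schwartz_coord_mult)
qed

text \<open>\<open>T\<close> is symmetric and \<open>- \<tau>\<close> is its eigenvalue on functions of weight \<open>\<tau>\<close>.\<close>

lemma T_weight_space_adjoint:
  assumes f: "f \<in> schwartz" and u: "u \<in> weight_space b \<tau>"
  shows "L2_inner b (T f) u = - of_real \<tau> * L2_inner b f u"
proof -
  note fL = schwartz_L2[OF f] and uL = weight_space_L2[OF u]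
  have HL: "Hb b G \<pi> \<Omega> f \<in> L2 b" by (intro schwartz_L2 Hb_schwartz f)
  have nf: "(\<lambda>x. of_real ((norm x)\<^sup>2) * f x) \<in> L2 b" by (intro schwartz_L2 schwartz_norm_mult f)
  have nu: "(\<lambda>x. \<i> / 2 * (of_real ((norm x)\<^sup>2) * u x)) \<in> L2 b"
    using dOmega_L2(2)[OF Walg_dOmega(1)[OF weight_space_Walg[OF u]]] by (simp add: mult.assoc)
  then have nu': "(\<lambda>x. of_real ((norm x)\<^sup>2) * u x) \<in> L2 b"
    using L2_scale[OF nu, of "- 2 * \<i>"] by (simp add: mult.assoc[symmetric])
  have "L2_inner b (\<lambda>x. \<i> / 2 * Hb b G \<pi> \<Omega> f x) u
      = - L2_inner b f (\<lambda>x. \<i> / 2 * of_real ((norm x)\<^sup>2) * u x - \<i> * of_real \<tau> * u x)"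
    by (rule dOmega_skew[OF trace_X(1) Hb_schwartz(2)[OF f] dOmega_low_weight_space[OF u]])
  then have "\<i> / 2 * L2_inner b (Hb b G \<pi> \<Omega> f) u
      = - (cnj (\<i> / 2) * L2_inner b f (\<lambda>x. of_real ((norm x)\<^sup>2) * u x) - cnj (\<i> * of_real \<tau>) * L2_inner b f u)"
    using L2_inner_diff_right[OF fL nu L2_scale[OF uL, of "\<i> * of_real \<tau>"]]
    by (simp only: L2_inner_scale_left L2_inner_scale_right mult.assoc complex_cnj_mult)
  then have "\<i> * (L2_inner b (Hb b G \<pi> \<Omega> f) u) = \<i> * (L2_inner b f (\<lambda>x. of_real ((norm x)\<^sup>2) * u x) - 2 * of_real \<tau> * L2_inner b f u)"
    by (simp add: algebra_simps)
  then have H: "L2_inner b (Hb b G \<pi> \<Omega> f) u = L2_inner b f (\<lambda>x. of_real ((norm x)\<^sup>2) * u x) - 2 * of_real \<tau> * L2_inner b f u"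
    by simp
  have "L2_inner b (T f) u = L2_inner b (\<lambda>x. (1 / 2) * (Hb b G \<pi> \<Omega> f x - of_real ((norm x)\<^sup>2) * f x)) u"
    by (simp add: half_Hb_minus_sq_def[abs_def])
  also have "\<dots> = (1 / 2) * (L2_inner b (Hb b G \<pi> \<Omega> f) u - L2_inner b (\<lambda>x. of_real ((norm x)\<^sup>2) * f x) u)"
    using HL nf uL by (simp only: L2_inner_scale_left L2_inner_diff_left)
  also have "L2_inner b (\<lambda>x. of_real ((norm x)\<^sup>2) * f x) u = L2_inner b f (\<lambda>x. of_real ((norm x)\<^sup>2) * u x)"
    by (simp add: L2_inner_def mult_ac)
  finally show ?thesis unfolding H by simp
qed

lemma coord_mult_adjoint: "L2_inner b (coord_mult n f) u = L2_inner b f (coord_mult n u)"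
  by (simp add: L2_inner_def coord_mult_def mult_ac)

text \<open>A commutator of symmetric operators, \<open>D\<^sub>n\<close> is antisymmetric, and it
maps \<open>w\<close> to \<open>- (\<tau> + 1) u - (\<tau> - 1) v + \<tau> (u + v)\<close>.\<close>

lemma D_adjoint:
  assumes f: "f \<in> schwartz" and w: "w \<in> weight_space b \<tau>"
    and uv: "u \<in> weight_space b (\<tau> + 1)" "v \<in> weight_space b (\<tau> - 1)" "coord_mult n w = (\<lambda>x. u x + v x)"
  shows "L2_inner b (D n f) w = L2_inner b f u - L2_inner b f v"
proof -
  note fL = schwartz_L2[OF f] and uL = weight_space_L2[OF uv(1)] and vL = weight_space_L2[OF uv(2)]
    and wL = weight_space_L2[OF w]
  have TL: "T f \<in> L2 b" "T (coord_mult n f) \<in> L2 b" "coord_mult n (T f) \<in> L2 b"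
    by (intro schwartz_L2 T_schwartz schwartz_coord_mult f)+
  have "L2_inner b (D n f) w = L2_inner b (T (coord_mult n f)) w - L2_inner b (coord_mult n (T f)) w"
    unfolding Db_def[abs_def] using TL wL by (simp add: L2_inner_diff_left)
  also have "L2_inner b (T (coord_mult n f)) w = - of_real \<tau> * L2_inner b f (\<lambda>x. u x + v x)"
    using T_weight_space_adjoint[OF schwartz_coord_mult[OF f, of n] w] by (simp add: coord_mult_adjoint uv(3))
  also have "L2_inner b (coord_mult n (T f)) w = L2_inner b (T f) (\<lambda>x. u x + v x)"
    by (simp add: coord_mult_adjoint uv(3))
  also have "\<dots> = - of_real (\<tau> + 1) * L2_inner b f u - of_real (\<tau> - 1) * L2_inner b f v"
    using TL uL vL by (simp add: L2_inner_add_right T_weight_space_adjoint[OF f uv(1)] T_weight_space_adjoint[OF f uv(2)] algebra_simps)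
  finally show ?thesis
    using fL uL vL by (simp add: L2_inner_add_right algebra_simps)
qed

definition phase :: complex where
  "phase = exp (\<i> * of_real (pi / 2 * (b + real CARD('n) / 2)))"

abbreviation "rot \<equiv> cexp ((pi / 2) *\<^sub>R X_rot)"

lemma rot_closed: "rot \<in> carrier G"
  by (intro cover_exp_closed trace_X)

lemma norm_phase: "phase * cnj phase = 1"
proof -
  have "norm phase = 1" unfolding phase_def by (rule norm_exp_i_times)
  then show ?thesis by (simp flip: complex_norm_square)
qed

lemma phase_nonzero: "phase \<noteq> 0"
  by (simp add: phase_def)

lemma F_eqI:
  assumes "h \<in> schwartz" "L2_eq b h (\<lambda>x. phase * \<Omega> rot f x)"
  shows "F f = h"
  unfolding Fb_def phase_def[symmetric]
proof (rule the_equality)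
  fix h' assume "h' \<in> schwartz \<and> L2_eq b h' (\<lambda>x. phase * \<Omega> rot f x)"
  then show "h' = h"
    using assms schwartz_L2_eq_imp_eq L2_eq_trans L2_eq_sym by blast
qed (use assms in blast)

lemma F_schwartz:
  assumes f: "f \<in> schwartz"
  shows "F f \<in> schwartz" "L2_eq b (F f) (\<lambda>x. phase * \<Omega> rot f x)"
proof -
  obtain h where h: "h \<in> schwartz" "L2_eq b (\<Omega> rot f) h"
    using Omega_schwartz[OF rot_closed f] by blast
  have 1: "(\<lambda>x. phase * h x) \<in> schwartz" using h(1) by (rule schwartz_scale)
  have 2: "L2_eq b (\<lambda>x. phase * h x) (\<lambda>x. phase * \<Omega> rot f x)"
    by (intro L2_eq_scale L2_eq_sym[OF h(2)])
  show "F f \<in> schwartz" "L2_eq b (F f) (\<lambda>x. phase * \<Omega> rot f x)"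
    using 1 2 F_eqI[OF 1 2] by auto
qed

text \<open>The inverse of a group element acts on the Schwartz space as well.\<close>

lemma F_surj:
  assumes f: "f \<in> schwartz"
  shows "f \<in> F ` schwartz"
proof -
  obtain h where h: "h \<in> schwartz" "L2_eq b (\<Omega> (inv\<^bsub>G\<^esub> rot) f) h"
    using Omega_schwartz[OF inv_closed[OF rot_closed] f] by blast
  note fL = schwartz_L2[OF f] and hL = schwartz_L2[OF h(1)]
  let ?h = "\<lambda>x. inverse phase * h x"
  have "L2_eq b (\<Omega> rot h) (\<Omega> rot (\<Omega> (inv\<^bsub>G\<^esub> rot) f))"
    using rot_closed fL hL h(2) by (intro Omega_cong Omega_L2 L2_eq_sym[OF h(2)]) auto
  also have "L2_eq b \<dots> f" using rot_closed fL by (rule Omega_Omega_inv)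
  finally have "L2_eq b (\<Omega> rot h) f" .
  then have "L2_eq b f (\<lambda>x. phase * \<Omega> rot ?h x)"
    using Omega_scale[OF rot_closed hL, of "inverse phase"]
    unfolding L2_eq_def by eventually_elim (simp add: phase_nonzero)
  then have "F ?h = f" by (rule F_eqI[OF f])
  then show ?thesis using schwartz_scale[OF h(1)] by blast
qed

lemma F_inv:
  assumes "f \<in> schwartz"
  shows "Fb_inv b G \<pi> \<Omega> f \<in> schwartz" "F (Fb_inv b G \<pi> \<Omega> f) = f"
  unfolding Fb_inv_def using F_surj[OF assms] by (rule inv_into_into, rule f_inv_into_f)

lemma F_inner:
  assumes f: "f \<in> schwartz" and u: "u \<in> L2 b"
  shows "L2_inner b (F f) (\<lambda>x. phase * \<Omega> rot u x) = L2_inner b f u"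
proof -
  note fL = schwartz_L2[OF f]
  have "L2_inner b (F f) (\<lambda>x. phase * \<Omega> rot u x) = L2_inner b (\<lambda>x. phase * \<Omega> rot f x) (\<lambda>x. phase * \<Omega> rot u x)"
    using schwartz_L2[OF F_schwartz(1)[OF f]] F_schwartz(2)[OF f] rot_closed fL u
    by (intro L2_inner_cong L2_scale Omega_L2 L2_eq_refl)
  also have "\<dots> = phase * cnj phase * L2_inner b f u"
    using rot_closed fL u by (simp add: L2_inner_scale_left L2_inner_scale_right Omega_inner)
  finally show ?thesis by (simp add: norm_phase)
qed

text \<open>The eigenvalue of \<open>\<F>\<^sub>b\<close> on the functions of weight \<open>\<tau>\<close>.\<close>

definition F_factor :: "real \<Rightarrow> complex" where
  "F_factor \<tau> = phase * exp (- \<i> * of_real (pi / 2 * \<tau>))"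

lemma F_factor_nonzero: "F_factor \<tau> \<noteq> 0"
  by (simp add: F_factor_def phase_nonzero)

text \<open>A change of the weight by one contributes a quarter turn.\<close>

lemma F_factor_shift: "F_factor (\<tau> + 1) = - \<i> * F_factor \<tau>" "F_factor (\<tau> - 1) = \<i> * F_factor \<tau>"
proof -
  have i: "exp (\<i> * of_real (pi / 2)) = \<i>"
    using cis_conv_exp[of "pi / 2"] by (simp only: cis_pi_half)
  have "exp (- \<i> * of_real (pi / 2)) = inverse (exp (\<i> * of_real (pi / 2)))"
    by (simp only: exp_minus mult_minus_left)
  also have "\<dots> = - \<i>" unfolding i by simp
  finally have e: "exp (- \<i> * of_real (pi / 2)) = - \<i>" "exp (\<i> * of_real (pi / 2)) = \<i>"
    using i by simp_all
  have r: "pi / 2 * (\<tau> + 1) = pi / 2 * \<tau> + pi / 2" "pi / 2 * (\<tau> - 1) = pi / 2 * \<tau> - pi / 2"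
    by (simp_all add: field_simps)
  have "- \<i> * of_real (pi / 2 * (\<tau> + 1)) = - \<i> * of_real (pi / 2 * \<tau>) + (- \<i> * of_real (pi / 2))"
    unfolding r of_real_add by (simp only: distrib_left)
  moreover have "- \<i> * of_real (pi / 2 * (\<tau> - 1)) = - \<i> * of_real (pi / 2 * \<tau>) + \<i> * of_real (pi / 2)"
    unfolding r of_real_diff by (simp only: right_diff_distrib mult_minus_left diff_minus_eq_add)
  ultimately show "F_factor (\<tau> + 1) = - \<i> * F_factor \<tau>" "F_factor (\<tau> - 1) = \<i> * F_factor \<tau>"
    unfolding F_factor_def by (simp_all only: exp_add e mult_ac)
qed

text \<open>Unitarity, in the form in which \<open>\<F>\<^sub>b\<close> is moved to the side of an eigenfunction.\<close>

lemma F_inner_weight_space: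
  assumes f: "f \<in> schwartz" and u: "u \<in> weight_space b \<tau>"
  shows "L2_inner b f u = cnj (F_factor \<tau>) * L2_inner b (F f) u"
proof -
  note uL = weight_space_L2[OF u]
  have "L2_inner b f u = L2_inner b (F f) (\<lambda>x. phase * \<Omega> rot u x)"
    using F_inner[OF f uL] ..
  also have "\<dots> = L2_inner b (F f) (\<lambda>x. F_factor \<tau> * u x)"
  proof (rule L2_inner_cong)
    show "L2_eq b (\<lambda>x. phase * \<Omega> rot u x) (\<lambda>x. F_factor \<tau> * u x)"
      using Omega_rot_weight_space[OF u, of "pi / 2"] unfolding F_factor_def L2_eq_def
      by eventually_elim simp
  qed (use schwartz_L2[OF F_schwartz(1)[OF f]] rot_closed uL in \<open>auto intro!: L2_scale Omega_L2\<close>)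
  finally show ?thesis by (simp only: L2_inner_scale_right)
qed

lemma schwartz_eq_of_Phi_inner:
  fixes f h :: "real^'n \<Rightarrow> complex"
  assumes f: "f \<in> schwartz" "h \<in> schwartz"
    and eq: "\<And>m l (p :: real^'n \<Rightarrow> complex). p \<in> harmonic_poly m \<Longrightarrow> L2_inner b f (Phi b m l p) = L2_inner b h (Phi b m l p)"
  shows "f = h"
proof -
  note L = f[THEN schwartz_L2]
  have "L2_eq b (\<lambda>x. f x - h x) (\<lambda>x. 0)"
    using L eq Phi_L2 by (intro orthogonal_Phi_imp_zero[OF b]) (auto simp: L2_inner_diff_left)
  then have "L2_eq b f h" by (simp add: L2_eq_def)
  then show ?thesis using f schwartz_L2_eq_imp_eq by blast
qed

lemma coord_mult_Phi_weight_spaces: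
  fixes p :: "real^'n \<Rightarrow> complex"
  assumes "p \<in> harmonic_poly m"
  obtains \<tau> u v where "Phi b m l p \<in> weight_space b \<tau>" "u \<in> weight_space b (\<tau> + 1)"
    "v \<in> weight_space b (\<tau> - 1)" "coord_mult n (Phi b m l p) = (\<lambda>x. u x + v x)"
  using coord_mult_Phi[OF b assms, of l n] weight_space_scale_Phi[OF assms refl, of 1 b l] by auto

text \<open>Let \<open>x\<^sub>n \<Phi> = u + v\<close> be the decomposition into weights.  Paired with \<open>\<Phi>\<close> and multiplied by the conjugate of
its eigenvalue, both sides become \<open>\<langle>f, u\<rangle> + \<langle>f, v\<rangle>\<close>.\<close>

lemma F_coord_mult:
  assumes f: "f \<in> schwartz"
  shows "F (coord_mult n f) = (\<lambda>x. \<i> * D n (F f) x)"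
proof (rule schwartz_eq_of_Phi_inner)
  show "F (coord_mult n f) \<in> schwartz" by (intro F_schwartz schwartz_coord_mult f)
  show "(\<lambda>x. \<i> * D n (F f) x) \<in> schwartz" by (intro schwartz_scale D_schwartz F_schwartz f)
  fix m l and p :: "real^'n \<Rightarrow> complex" assume p: "p \<in> harmonic_poly m"
  obtain \<tau> u v where w: "Phi b m l p \<in> weight_space b \<tau>"
    and uv: "u \<in> weight_space b (\<tau> + 1)" "v \<in> weight_space b (\<tau> - 1)" "coord_mult n (Phi b m l p) = (\<lambda>x. u x + v x)"
    using coord_mult_Phi_weight_spaces[OF p] .
  let ?\<mu> = "cnj (F_factor \<tau>)"
  have "?\<mu> * L2_inner b (F (coord_mult n f)) (Phi b m l p) = L2_inner b f (\<lambda>x. u x + v x)"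
    using F_inner_weight_space[OF schwartz_coord_mult[OF f, of n] w] by (simp add: coord_mult_adjoint uv(3))
  also have "\<dots> = L2_inner b f u + L2_inner b f v"
    using f uv by (intro L2_inner_add_right schwartz_L2 weight_space_L2)
  also have "\<dots> = ?\<mu> * (\<i> * (L2_inner b (F f) u - L2_inner b (F f) v))"
    unfolding F_inner_weight_space[OF f uv(1)] F_inner_weight_space[OF f uv(2)] F_factor_shift
    by (simp add: algebra_simps)
  also have "L2_inner b (F f) u - L2_inner b (F f) v = L2_inner b (D n (F f)) (Phi b m l p)"
    using D_adjoint[OF F_schwartz(1)[OF f] w uv] by simp
  finally show "L2_inner b (F (coord_mult n f)) (Phi b m l p) = L2_inner b (\<lambda>x. \<i> * D n (F f) x) (Phi b m l p)"
    using F_factor_nonzero[of \<tau>] by (simp add: L2_inner_scale_left)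
qed

text \<open>In the same way both sides become \<open>\<langle>f, u\<rangle> - \<langle>f, v\<rangle>\<close>.\<close>

lemma F_D:
  assumes f: "f \<in> schwartz"
  shows "F (D n f) = (\<lambda>x. \<i> * coord_mult n (F f) x)"
proof (rule schwartz_eq_of_Phi_inner)
  show "F (D n f) \<in> schwartz" by (intro F_schwartz D_schwartz f)
  show "(\<lambda>x. \<i> * coord_mult n (F f) x) \<in> schwartz"
    by (intro schwartz_scale schwartz_coord_mult F_schwartz f)
  fix m l and p :: "real^'n \<Rightarrow> complex" assume p: "p \<in> harmonic_poly m"
  obtain \<tau> u v where w: "Phi b m l p \<in> weight_space b \<tau>"
    and uv: "u \<in> weight_space b (\<tau> + 1)" "v \<in> weight_space b (\<tau> - 1)" "coord_mult n (Phi b m l p) = (\<lambda>x. u x + v x)"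
    using coord_mult_Phi_weight_spaces[OF p] .
  let ?\<mu> = "cnj (F_factor \<tau>)"
  have "?\<mu> * L2_inner b (F (D n f)) (Phi b m l p) = L2_inner b f u - L2_inner b f v"
    using F_inner_weight_space[OF D_schwartz[OF f, of n] w] D_adjoint[OF f w uv] by simp
  also have "\<dots> = ?\<mu> * (\<i> * (L2_inner b (F f) u + L2_inner b (F f) v))"
    unfolding F_inner_weight_space[OF f uv(1)] F_inner_weight_space[OF f uv(2)] F_factor_shift
    by (simp add: algebra_simps)
  also have "L2_inner b (F f) u + L2_inner b (F f) v = L2_inner b (coord_mult n (F f)) (Phi b m l p)"
    using F_schwartz(1)[OF f] uv
    by (simp add: coord_mult_adjoint L2_inner_add_right schwartz_L2 weight_space_L2)
  finally show "L2_inner b (F (D n f)) (Phi b m l p) = L2_inner b (\<lambda>x. \<i> * coord_mult n (F f) x) (Phi b m l p)"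
    using F_factor_nonzero[of \<tau>] by (simp add: L2_inner_scale_left)
qed

end

theorem theorem3p2p1:
  fixes b :: real
    and G :: "('g::topological_space) monoid"
    and \<pi> :: "'g \<Rightarrow> real^2^2"
    and \<Omega> :: "'g \<Rightarrow> (real^'n::finite \<Rightarrow> complex) \<Rightarrow> real^'n \<Rightarrow> complex"
    and n :: 'n
  assumes "b > - real CARD('n) / 2"
    and "universal_cover_SL2 G \<pi>"
    and "is_Omega_b b G \<pi> \<Omega>"
    and "smooth_vectors b G \<pi> \<Omega> = {u \<in> L2 b. \<exists>f\<in>schwartz. L2_eq b u f}"
  shows "\<forall>f\<in>schwartz.
      Fb b G \<pi> \<Omega> (Db b G \<pi> \<Omega> n (Fb_inv b G \<pi> \<Omega> f)) = (\<lambda>x. \<i> * coord_mult n f x) \<and>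
      Fb b G \<pi> \<Omega> (coord_mult n (Fb_inv b G \<pi> \<Omega> f)) = (\<lambda>x. \<i> * Db b G \<pi> \<Omega> n f x)"
proof -
  interpret Omega_rep G \<pi> b \<Omega>
    using assms by unfold_locales
  show ?thesis
    using F_D[OF F_inv(1)] F_coord_mult[OF F_inv(1)] F_inv(2) by simp
qed

end
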